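(* Let $\{\mathcal{M}^n_t\}_{t\in[t_0,T)}$ be a smooth family of boundaries $\mathcal{M}^n_t=\partial\Omega_t$ of bounded convex bodies $\Omega_t\subset\mathbb{R}^{n+1}$ moving with inward normal speed $$F(x,t)=f^\alpha\big(\nu(x,t),[A_{(x,t)}]\big)$$ for some $\alpha>0$, where $f:S^n\times\Gamma_+^{n\times n}\to\mathbb{R}_+$ is a smooth function which is $\mathrm{SO}(n)$-invariant, monotone non-decreasing and inverse-concave in its second entry. Suppose that the hypersurfaces $\mathcal{M}^n_t$ contract to a point at time $T$. Then the $(1+\alpha)$-th root $w:=((1+\alpha)(u-t_0))^{\frac{1}{1+\alpha}}$ of the arrival time $u:\Omega_{t_0}\to\mathbb{R}$ is concave. Equivalently, $$\partial_tF+2\nabla_VF+A(V,V)+\frac{\alpha F}{(1+\alpha)(t-t_0)}\ge0\quad\text{for all }V\in T\mathcal{M}_t,\ t\in(t_0,T).$$ If the solution is ancient (that is, $t_0=-\infty$ and the family is defined for $t\in(-\infty,T)$), then the arrival time $u$ is concave. Equivalently, $$\partial_tF+2\nabla_VF+A(V,V)\ge0\quad\text{for all }V\in T\mathcal{M}_t,\ t\in(-\infty,T).$$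
   Context: $\nu(x,t)$ is the outward unit normal to $\mathcal{M}^n_t$ at $x$, $A_{(x,t)}$ is the second fundamental form of $\mathcal{M}^n_t$ at $x$ (with the sign convention that $A\ge0$ for boundaries of convex bodies), and $[A_{(x,t)}]$ is its component matrix with respect to an orthonormal frame for $T_x\mathcal{M}^n_t$; it lies in $\Gamma_+^{n\times n}$, the cone of positive definite symmetric $n\times n$ matrices, so that $F$ is defined. $\mathbb{R}_+$ is the set of positive reals. Moving with inward normal speed $F$ means moving with normal velocity $-F\nu$. $f$ is $\mathrm{SO}(n)$-invariant if it is invariant under conjugation of its second entry by elements of $\mathrm{SO}(n)$; monotone non-decreasing in its second entry if $r\ge s$ (i.e. $r-s$ positive semi-definite) implies $f(p,r)\ge f(p,s)$; and inverse-concave in its second entry if, for each $p\in S^n$, the dual function $r\mapsto f_\ast(p,r):=1/f(p,r^{-1})$ is concave on $\Gamma_+^{n\times n}$. $\nabla$ denotes the gradient/derivative along $\mathcal{M}_t$, and $\partial_tF$ is the time derivative of $F$ along a family of parametrizations $X(\cdot,t)$ of $\mathcal{M}^n_t$ satisfying $\partial_tX=-F\nu$. The arrival time $u$ is the function determined by $u(p)=t\iff p\in\mathcal{M}^n_t$; it is well defined since the hypersurfaces move monotonically inwards, and at the point to which the hypersurfaces contract it takes the value $T$. For an ancient solution, the domain $\Omega_{t_0}$ of $u$ is understood as $\bigcup_{t<T}\Omega_t$. *)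

theory Defs
  imports "HOL-Analysis.Analysis"
begin

primrec C_k_on ::
  "nat \<Rightarrow> 'a::euclidean_space set \<Rightarrow> ('a \<Rightarrow> 'b::real_normed_vector) \<Rightarrow> bool" where
  "C_k_on 0 U g \<longleftrightarrow> continuous_on U g"
| "C_k_on (Suc k) U g \<longleftrightarrow>
     (\<exists>g'. (\<forall>x\<in>U. (g has_derivative g' x) (at x)) \<and> (\<forall>v. C_k_on k U (\<lambda>x. g' x v)))"

text \<open>Smoothness on an arbitrary subset of a Euclidean space, through local smooth extensions.
  On an embedded submanifold this is the usual smoothness; on a product with a half-open time
  interval it includes smoothness up to the initial time.\<close>

definition smooth_on :: "'a::euclidean_space set \<Rightarrow> ('a \<Rightarrow> 'b::real_normed_vector) \<Rightarrow> bool" where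
  "smooth_on S g \<longleftrightarrow>
     (\<forall>x\<in>S. \<exists>U h. open U \<and> x \<in> U \<and> (\<forall>k. C_k_on k U h) \<and> (\<forall>y\<in>S \<inter> U. h y = g y))"

definition pos_semidef :: "real^'n^'n \<Rightarrow> bool" where
  "pos_semidef r \<longleftrightarrow> transpose r = r \<and> (\<forall>v. 0 \<le> v \<bullet> (r *v v))"

definition Gamma_plus :: "(real^'n^'n) set" where
  "Gamma_plus = {r. transpose r = r \<and> (\<forall>v. v \<noteq> 0 \<longrightarrow> 0 < v \<bullet> (r *v v))}"

definition SO_invariant :: "(real^'m \<Rightarrow> real^'n^'n \<Rightarrow> real) \<Rightarrow> bool" where
  "SO_invariant f \<longleftrightarrow> (\<forall>p\<in>sphere 0 1. \<forall>r\<in>Gamma_plus. \<forall>Q.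
     rotation_matrix Q \<longrightarrow> f p (Q ** r ** transpose Q) = f p r)"

definition monotone_snd :: "(real^'m \<Rightarrow> real^'n^'n \<Rightarrow> real) \<Rightarrow> bool" where
  "monotone_snd f \<longleftrightarrow> (\<forall>p\<in>sphere 0 1. \<forall>r\<in>Gamma_plus. \<forall>s\<in>Gamma_plus.
     pos_semidef (r - s) \<longrightarrow> f p s \<le> f p r)"

definition inverse_concave :: "(real^'m \<Rightarrow> real^'n^'n \<Rightarrow> real) \<Rightarrow> bool" where
  "inverse_concave f \<longleftrightarrow>
     (\<forall>p\<in>sphere 0 1. concave_on Gamma_plus (\<lambda>r. 1 / f p (matrix_inv r)))"

definition admissible_speed :: "(real^'m \<Rightarrow> real^'n^'n \<Rightarrow> real) \<Rightarrow> bool" where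
  "admissible_speed f \<longleftrightarrow>
     (\<forall>p\<in>sphere 0 1. \<forall>r\<in>Gamma_plus. 0 < f p r) \<and>
     smooth_on (sphere 0 1 \<times> Gamma_plus) (\<lambda>(p, r). f p r) \<and>
     SO_invariant f \<and> monotone_snd f \<and> inverse_concave f"

definition convex_body :: "'a::euclidean_space set \<Rightarrow> bool" where
  "convex_body K \<longleftrightarrow> compact K \<and> convex K \<and> interior K \<noteq> {}"

text \<open>Velocities at \<open>x\<close> of curves in \<open>M\<close>. Only differentiability at the base point is asked of the
  curves; for an embedded smooth submanifold this gives the usual tangent space.\<close>

definition tangent_space :: "'a::real_normed_vector set \<Rightarrow> 'a \<Rightarrow> 'a set" where
  "tangent_space M x =
     {v. \<exists>c::real \<Rightarrow> 'a. range c \<subseteq> M \<and> c 0 = x \<and> (c has_vector_derivative v) (at 0)}"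

definition outward_normal :: "'a::euclidean_space set \<Rightarrow> 'a \<Rightarrow> 'a" where
  "outward_normal K x =
     (THE \<nu>. norm \<nu> = 1 \<and> (\<forall>v\<in>tangent_space (frontier K) x. \<nu> \<bullet> v = 0) \<and>
            (\<forall>\<^sub>F s in at_right 0. x + s *\<^sub>R \<nu> \<notin> K))"

text \<open>A Frechet derivative within \<open>M\<close> is determined only on vectors tangent to \<open>M\<close>, where it is the
  derivative along \<open>M\<close>; accordingly \<open>along M g x v\<close> and \<open>second_ff K x v w\<close> are
  meaningful only for tangent \<open>v\<close>.\<close>

definition along ::
  "'a::real_normed_vector set \<Rightarrow> ('a \<Rightarrow> 'b::real_normed_vector) \<Rightarrow> 'a \<Rightarrow> 'a \<Rightarrow> 'b" where
  "along M g x v = frechet_derivative g (at x within M) v"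

text \<open>With the outward normal, \<open>A(v, w) = D\<^sub>v \<nu> \<bullet> w\<close> is nonnegative on convex bodies.\<close>

definition second_ff :: "'a::euclidean_space set \<Rightarrow> 'a \<Rightarrow> 'a \<Rightarrow> 'a \<Rightarrow> real" where
  "second_ff K x v w = along (frontier K) (outward_normal K) x v \<bullet> w"

text \<open>The frame is not required to span: in the theorem the index type has as many elements as the
  dimension of the hypersurface.\<close>

definition orthonormal_frame :: "(real^'m) set \<Rightarrow> real^'m \<Rightarrow> ('n \<Rightarrow> real^'m) \<Rightarrow> bool" where
  "orthonormal_frame M x e \<longleftrightarrow>
     (\<forall>i. e i \<in> tangent_space M x) \<and> (\<forall>i j. e i \<bullet> e j = (if i = j then 1 else 0))"

definition second_ff_matrix ::
  "(real^'m) set \<Rightarrow> real^'m \<Rightarrow> ('n::finite \<Rightarrow> real^'m) \<Rightarrow> real^'n^'n" where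
  "second_ff_matrix K x e = (\<chi> i j. second_ff K x (e i) (e j))"

text \<open>\<open>J\<close> is the time interval, \<open>X\<close> a smooth family of embeddings of the sphere with
  \<open>X(\<cdot>, t)\<close> parametrizing the boundary of \<open>\<Omega> t\<close>, and \<open>F x t\<close> the speed at the point \<open>x\<close> of
  that boundary. The speed is prescribed for every frame; by rotation invariance its value does
  not depend on the frame (a symmetric matrix commutes with a reflection, so its orbits under
  \<open>SO(n)\<close> and \<open>O(n)\<close> agree and no orientation of the frame is needed).\<close>

definition convex_flow ::
  "(real^'m \<Rightarrow> real^'n^'n \<Rightarrow> real) \<Rightarrow> real \<Rightarrow> real set \<Rightarrow> (real \<Rightarrow> (real^'m) set) \<Rightarrow>
   (real^'m \<Rightarrow> real \<Rightarrow> real^'m) \<Rightarrow> (real^'m \<Rightarrow> real \<Rightarrow> real) \<Rightarrow> bool" where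
  "convex_flow f \<alpha> J \<Omega> X F \<longleftrightarrow>
     (\<forall>t\<in>J. convex_body (\<Omega> t)) \<and>
     smooth_on (sphere 0 1 \<times> J) (\<lambda>(p, t). X p t) \<and>
     (\<forall>t\<in>J. bij_betw (\<lambda>p. X p t) (sphere 0 1) (frontier (\<Omega> t))) \<and>
     (\<forall>t\<in>J. \<forall>p\<in>sphere 0 1.
        inj_on (along (sphere 0 1) (\<lambda>q. X q t) p) (tangent_space (sphere 0 1) p)) \<and>
     (\<forall>t\<in>J. \<forall>x\<in>frontier (\<Omega> t). \<forall>e::'n \<Rightarrow> real^'m. orthonormal_frame (frontier (\<Omega> t)) x e \<longrightarrow>
        second_ff_matrix (\<Omega> t) x e \<in> Gamma_plus \<and>
        F x t = f (outward_normal (\<Omega> t) x) (second_ff_matrix (\<Omega> t) x e) powr \<alpha>) \<and>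
     (\<forall>t\<in>J. \<forall>p\<in>sphere 0 1.
        (X p has_vector_derivative - F (X p t) t *\<^sub>R outward_normal (\<Omega> t) (X p t))
          (at t within J))"

definition contracts_to :: "(real \<Rightarrow> 'a::euclidean_space set) \<Rightarrow> real \<Rightarrow> 'a \<Rightarrow> bool" where
  "contracts_to \<Omega> T z \<longleftrightarrow> (\<forall>\<epsilon>>0. \<forall>\<^sub>F t in at_left T. frontier (\<Omega> t) \<subseteq> ball z \<epsilon>)"

definition arrival_time ::
  "real set \<Rightarrow> (real \<Rightarrow> 'a::euclidean_space set) \<Rightarrow> real \<Rightarrow> 'a \<Rightarrow> 'a \<Rightarrow> real" where
  "arrival_time J \<Omega> T z p = (if p = z then T else (THE t. t \<in> J \<and> p \<in> frontier (\<Omega> t)))"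

text \<open>The expression \<open>\<partial>\<^sub>t F + 2 \<nabla>\<^sub>V F + A(V, V)\<close> at the point \<open>X p t\<close>. The time derivative is
  taken at fixed parameter \<open>p\<close>.\<close>

definition Harnack_quantity ::
  "(real \<Rightarrow> 'a::euclidean_space set) \<Rightarrow> ('b \<Rightarrow> real \<Rightarrow> 'a) \<Rightarrow> ('a \<Rightarrow> real \<Rightarrow> real) \<Rightarrow>
   'b \<Rightarrow> real \<Rightarrow> 'a \<Rightarrow> real" where
  "Harnack_quantity \<Omega> X F p t V =
     deriv (\<lambda>s. F (X p s) s) t
     + 2 * along (frontier (\<Omega> t)) (\<lambda>x. F x t) (X p t) V
     + second_ff (\<Omega> t) (X p t) V V"

end

theory Submission
  imports Defs
begin

text \<open>Write \<open>K s = {w \<ge> s}\<close>, the body at the time \<open>t\<close> with \<open>(1 + \<alpha>) (t - t\<^sub>0) = s powr (1 + \<alpha>)\<close>.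
  Concavity of \<open>w\<close> is proved by a maximum principle. If
  \<open>w ((1 - l) x + l y) - (1 - l) w x - l w y\<close> has a negative minimum at \<open>(x, y)\<close>, where \<open>w\<close> takes the
  values \<open>a\<close>, \<open>b\<close> and, at the convex combination, \<open>d\<close>, then minimality forces the inclusion
  \<open>(1 - l) K a + l K b \<subseteq> K d\<close>, and the three boundaries have a common normal at the touching
  points. To first order in time this gives \<open>a powr \<alpha> * F\<^sub>a \<le> d powr \<alpha> * F\<^sub>d\<close>, and likewise for \<open>b\<close>. To
  second order in space it gives \<open>A\<^sub>d\<inverse> \<ge> (1 - l) A\<^sub>a\<inverse> + l A\<^sub>b\<inverse>\<close>, hence by monotonicity and
  inverse-concavity \<open>1 / f\<^sub>d \<ge> (1 - l) / f\<^sub>a + l / f\<^sub>b\<close>. Together these yield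
  \<open>d \<ge> (1 - l) a + l b\<close>, a contradiction.

  The Harnack inequality is the second order consequence of \<open>K (s - \<delta>) / 2 + K (s + \<delta>) / 2 \<subseteq> K s\<close>,
  tested on the boundary points reached from \<open>X p t\<close> by moving with velocity \<open>V\<close> along the flow.
  For ancient solutions \<open>t\<^sub>0\<close> tends to \<open>-\<infinity>\<close>.\<close>


section \<open>Boundaries of convex bodies\<close>

lemma along_eq:
  assumes g: "(g has_derivative g') (at x within M)" and v: "v \<in> tangent_space M x"
  shows "along M g x v = g' v"
proof -
  obtain c where c: "range c \<subseteq> M" "c 0 = x" "(c has_vector_derivative v) (at 0)"
    using v unfolding tangent_space_def by blast
  have *: "((g \<circ> c) has_vector_derivative h v) (at 0)" if "(g has_derivative h) (at x within M)" for h
    using vector_derivative_diff_chain_within[of c v 0 UNIV g h] c that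
    by (auto intro: has_derivative_subset)
  have "(g has_derivative frechet_derivative g (at x within M)) (at x within M)"
    using g frechet_derivative_works differentiable_def by blast
  then show ?thesis
    unfolding along_def using *[OF g] * vector_derivative_unique_at by blast
qed

definition sphere_curve :: "'a::euclidean_space \<Rightarrow> 'a \<Rightarrow> real \<Rightarrow> 'a" where
  "sphere_curve p v s = (p + s *\<^sub>R v) /\<^sub>R sqrt (1 + s\<^sup>2 * (v \<bullet> v))"

definition sphere_curve_velocity :: "'a::euclidean_space \<Rightarrow> 'a \<Rightarrow> real \<Rightarrow> 'a" where
  "sphere_curve_velocity p v s =
     v /\<^sub>R sqrt (1 + s\<^sup>2 * (v \<bullet> v)) -
     (s * (v \<bullet> v) / (sqrt (1 + s\<^sup>2 * (v \<bullet> v))) ^ 3) *\<^sub>R (p + s *\<^sub>R v)"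

lemma sphere_curve_0 [simp]: "sphere_curve p v 0 = p"
  by (simp add: sphere_curve_def)

lemma sphere_curve_velocity_0 [simp]: "sphere_curve_velocity p v 0 = v"
  by (simp add: sphere_curve_velocity_def)

lemma one_plus_square_pos: "0 < 1 + s\<^sup>2 * (v \<bullet> v)" for s :: real
  by (simp add: add_pos_nonneg)

lemma sphere_curve_in_sphere:
  assumes "p \<in> sphere 0 1" "p \<bullet> v = 0"
  shows "sphere_curve p v s \<in> sphere 0 1"
proof -
  have "p \<bullet> p = 1"
    using assms(1) by (simp add: dot_square_norm)
  then have "norm (p + s *\<^sub>R v) = sqrt (1 + s\<^sup>2 * (v \<bullet> v))"
    using assms(2) by (simp add: norm_eq_sqrt_inner inner_add_left inner_add_right inner_commute
        power2_eq_square algebra_simps)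
  moreover have "norm (p + s *\<^sub>R v) > 0"
    using calculation one_plus_square_pos[of s v] by simp
  ultimately show ?thesis
    by (simp add: sphere_curve_def divide_inverse_commute [symmetric])
qed

lemma sphere_curve_has_vector_derivative:
  "(sphere_curve p v has_vector_derivative sphere_curve_velocity p v s) (at s)"
proof -
  have *: "((\<lambda>s. inverse (sqrt (1 + s\<^sup>2 * (v \<bullet> v)))) has_real_derivative
      - (s * (v \<bullet> v) / (sqrt (1 + s\<^sup>2 * (v \<bullet> v))) ^ 3)) (at s)"
    using one_plus_square_pos[of s v]
    by (auto intro!: derivative_eq_intros simp: field_simps power3_eq_cube power2_eq_square)
  show ?thesis
    unfolding sphere_curve_def [abs_def] sphere_curve_velocity_def
    by (rule derivative_eq_intros * refl | simp)+
qed

lemma continuous_sphere_curve: "continuous_on UNIV (sphere_curve p v)"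
  by (intro continuous_at_imp_continuous_on ballI
      has_vector_derivative_continuous[OF sphere_curve_has_vector_derivative])

lemma continuous_sphere_curve_velocity: "continuous_on UNIV (sphere_curve_velocity p v)"
  unfolding sphere_curve_velocity_def [abs_def]
  using one_plus_square_pos[of _ v]
  by (intro continuous_intros) (metis less_irrefl power_eq_0_iff real_sqrt_eq_zero_cancel_iff)+

lemma tangent_space_sphere:
  fixes p :: "'a::euclidean_space"
  assumes "p \<in> sphere 0 1"
  shows "tangent_space (sphere 0 1) p = {v. p \<bullet> v = 0}"
proof (intro set_eqI iffI)
  fix v assume "v \<in> tangent_space (sphere 0 1) p"
  then obtain c where c: "range c \<subseteq> sphere 0 1" "c 0 = p" "(c has_vector_derivative v) (at 0)"
    unfolding tangent_space_def by blast
  have "((\<lambda>s. c s \<bullet> c s) has_vector_derivative 2 * (p \<bullet> v)) (at 0)"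
    using bounded_bilinear.has_vector_derivative[OF bounded_bilinear_inner c(3) c(3)] c(2)
    by (simp add: inner_commute)
  moreover have "c s \<bullet> c s = 1" for s
    using c(1) by (auto simp: dot_square_norm image_subset_iff)
  ultimately have "((\<lambda>s. 1) has_vector_derivative 2 * (p \<bullet> v)) (at (0::real))"
    by simp
  then show "v \<in> {v. p \<bullet> v = 0}"
    using vector_derivative_unique_at[OF _ has_vector_derivative_const] by fastforce
next
  fix v assume "v \<in> {v. p \<bullet> v = 0}"
  then show "v \<in> tangent_space (sphere 0 1) p"
    unfolding tangent_space_def
    using sphere_curve_in_sphere[OF assms] sphere_curve_has_vector_derivative[of p v 0]
    by (intro CollectI exI[of _ "sphere_curve p v"]) auto
qed

lemma unit_normals_of_hyperplane:
  fixes \<nu> n :: "'a::real_inner"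
  assumes "norm \<nu> = 1" "norm n = 1" "\<And>v. \<nu> \<bullet> v = 0 \<Longrightarrow> n \<bullet> v = 0"
  shows "n = \<nu> \<or> n = - \<nu>"
proof -
  define v where "v = n - (\<nu> \<bullet> n) *\<^sub>R \<nu>"
  have nu: "\<nu> \<bullet> \<nu> = 1"
    using assms(1) by (simp add: dot_square_norm)
  have "\<nu> \<bullet> v = 0"
    by (simp add: v_def inner_diff_right nu)
  with assms(3) have "v \<bullet> v = 0"
    by (simp add: v_def inner_diff_left)
  then have n: "n = (\<nu> \<bullet> n) *\<^sub>R \<nu>"
    by (simp add: v_def)
  then have "norm n = \<bar>\<nu> \<bullet> n\<bar> * norm \<nu>"
    by (metis norm_scaleR)
  then have "\<bar>\<nu> \<bullet> n\<bar> = 1"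
    using assms(1,2) by simp
  then show ?thesis
    using n by (metis abs_eq_iff' abs_1 scaleR_minus_left scaleR_one)
qed

lemma convex_body_support:
  fixes K :: "'a::euclidean_space set"
  assumes K: "convex_body K" and x: "x \<in> frontier K"
  obtains \<nu> where "norm \<nu> = 1" "\<And>y. y \<in> K \<Longrightarrow> \<nu> \<bullet> y \<le> \<nu> \<bullet> x"
proof -
  have "closed K" "convex K" "interior K \<noteq> {}"
    using K by (auto simp: convex_body_def compact_imp_closed)
  moreover have "x \<in> K" "x \<notin> rel_interior K"
    using x calculation by (auto simp: frontier_def rel_interior_nonempty_interior)
  ultimately obtain a where a: "a \<noteq> 0" "\<And>y. y \<in> K \<Longrightarrow> a \<bullet> x \<le> a \<bullet> y"
    using supporting_hyperplane_rel_boundary by metis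
  show ?thesis
    by (rule that[of "- a /\<^sub>R norm a"]) (use a in \<open>auto simp: divide_simps\<close>)
qed

lemma interior_not_maximal:
  fixes K :: "'a::real_inner set"
  assumes "x \<in> interior K" "\<nu> \<noteq> 0"
  obtains y where "y \<in> K" "\<nu> \<bullet> x < \<nu> \<bullet> y"
proof -
  obtain r where r: "r > 0" "ball x r \<subseteq> K"
    using assms(1) by (auto simp: mem_interior)
  let ?y = "x + (r / (2 * norm \<nu>)) *\<^sub>R \<nu>"
  have "?y \<in> ball x r"
    using r assms(2) by (simp add: dist_norm)
  moreover have "\<nu> \<bullet> x < \<nu> \<bullet> ?y"
    using r assms(2) by (simp add: inner_add_right)
  ultimately show ?thesis
    using r that by blast
qed

lemma convex_body_max_on_frontier:
  fixes K :: "'a::euclidean_space set"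
  assumes K: "convex_body K" and "\<nu> \<noteq> 0"
  obtains x where "x \<in> frontier K" "\<And>y. y \<in> K \<Longrightarrow> \<nu> \<bullet> y \<le> \<nu> \<bullet> x"
proof -
  have "compact K" "K \<noteq> {}"
    using K interior_subset by (auto simp: convex_body_def)
  then obtain x where x: "x \<in> K" "\<And>y. y \<in> K \<Longrightarrow> \<nu> \<bullet> y \<le> \<nu> \<bullet> x"
    using continuous_attains_sup[of K "\<lambda>y. \<nu> \<bullet> y"] continuous_on_inner[OF continuous_on_const continuous_on_id]
    by blast
  have "x \<notin> interior K"
    using interior_not_maximal[OF _ \<open>\<nu> \<noteq> 0\<close>] x(2) by (metis not_less)
  then show ?thesis
    using x that closure_subset by (auto simp: frontier_def)
qed

lemma support_orthogonal_tangent: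
  assumes sup: "\<And>y. y \<in> frontier K \<Longrightarrow> \<nu> \<bullet> y \<le> \<nu> \<bullet> x" and v: "v \<in> tangent_space (frontier K) x"
  shows "\<nu> \<bullet> v = (0::real)"
proof -
  obtain c where c: "range c \<subseteq> frontier K" "c 0 = x" "(c has_vector_derivative v) (at 0)"
    using v unfolding tangent_space_def by blast
  have "((\<lambda>s. \<nu> \<bullet> c s) has_vector_derivative \<nu> \<bullet> v) (at 0)"
    using bounded_bilinear.has_vector_derivative[OF bounded_bilinear_inner
        has_vector_derivative_const c(3)] by simp
  then have "((\<lambda>s. \<nu> \<bullet> c s) has_real_derivative \<nu> \<bullet> v) (at 0)"
    by (simp add: has_real_derivative_iff_has_vector_derivative)
  then show ?thesis
    by (rule DERIV_local_max[where d = 1]) (use c sup in auto)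
qed

locale convex_embedding =
  fixes K :: "'a::euclidean_space set" and Y :: "'a \<Rightarrow> 'a" and D :: "'a \<Rightarrow> 'a \<Rightarrow> 'a"
  assumes body: "convex_body K"
    and bij: "bij_betw Y (sphere 0 1) (frontier K)"
    and deriv: "p \<in> sphere 0 1 \<Longrightarrow> (Y has_derivative D p) (at p within sphere 0 1)"
    and immersion: "p \<in> sphere 0 1 \<Longrightarrow>
          inj_on (along (sphere 0 1) Y p) (tangent_space (sphere 0 1) p)"
begin

lemma K_facts: "compact K" "closed K" "convex K" "interior K \<noteq> {}" "frontier K \<subseteq> K"
  using body by (auto simp: convex_body_def compact_imp_closed frontier_subset_closed)

lemma Y_frontier: "p \<in> sphere 0 1 \<Longrightarrow> Y p \<in> frontier K"
  using bij by (auto simp: bij_betw_def)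

lemma Y_image: "Y ` sphere 0 1 = frontier K"
  using bij by (auto simp: bij_betw_def)

lemma linear_D: "p \<in> sphere 0 1 \<Longrightarrow> linear (D p)"
  using deriv has_derivative_linear by blast

lemma inj_D:
  assumes p: "p \<in> sphere 0 1"
  shows "inj_on (D p) {v. p \<bullet> v = 0}"
  using immersion[OF p] along_eq[OF deriv[OF p]]
  unfolding tangent_space_sphere[OF p] inj_on_def by auto

lemma D_tangent:
  assumes p: "p \<in> sphere 0 1" and v: "p \<bullet> v = 0"
  shows "D p v \<in> tangent_space (frontier K) (Y p)"
proof -
  let ?c = "\<lambda>s. Y (sphere_curve p v s)"
  have "(Y \<circ> sphere_curve p v has_vector_derivative D p v) (at 0)"
    by (rule vector_derivative_diff_chain_within)
      (use sphere_curve_has_vector_derivative[of p v 0] deriv[OF p] sphere_curve_in_sphere[OF p v]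
        in \<open>auto intro: has_derivative_subset\<close>)
  then show ?thesis
    unfolding tangent_space_def
    using sphere_curve_in_sphere[OF p v] Y_frontier
    by (intro CollectI exI[of _ ?c]) (auto simp: comp_def)
qed

lemma tangent_space_frontier:
  assumes p: "p \<in> sphere 0 1" and nu: "norm \<nu> = 1" "\<And>y. y \<in> K \<Longrightarrow> \<nu> \<bullet> y \<le> \<nu> \<bullet> Y p"
  shows "tangent_space (frontier K) (Y p) = {v. \<nu> \<bullet> v = 0}" "D p ` {v. p \<bullet> v = 0} = {v. \<nu> \<bullet> v = 0}"
proof -
  have sub1: "D p ` {v. p \<bullet> v = 0} \<subseteq> tangent_space (frontier K) (Y p)"
    using D_tangent[OF p] by auto
  have sub2: "tangent_space (frontier K) (Y p) \<subseteq> {v. \<nu> \<bullet> v = 0}"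
    using support_orthogonal_tangent[of K \<nu> "Y p"] nu(2) K_facts(5) by blast
  have p0: "p \<noteq> 0" "\<nu> \<noteq> 0"
    using p nu by auto
  have eq: "D p ` {v. p \<bullet> v = 0} = {v. \<nu> \<bullet> v = 0}"
  proof (rule subspace_dim_equal)
    show "subspace (D p ` {v. p \<bullet> v = 0})"
      by (intro linear_subspace_image linear_D p subspace_hyperplane)
    have "dim (D p ` {v. p \<bullet> v = 0}) = dim {v. p \<bullet> v = 0}"
      by (intro dim_image_eq linear_D p)
         (use inj_D[OF p] span_eq_iff subspace_hyperplane in metis)
    then show "dim {v. \<nu> \<bullet> v = 0} \<le> dim (D p ` {v. p \<bullet> v = 0})"
      using p0 by (simp add: dim_hyperplane)
    show "D p ` {v. p \<bullet> v = 0} \<subseteq> {v. \<nu> \<bullet> v = 0}"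
      using sub1 sub2 by blast
  qed (rule subspace_hyperplane)
  then show "D p ` {v. p \<bullet> v = 0} = {v. \<nu> \<bullet> v = 0}" .
  then show "tangent_space (frontier K) (Y p) = {v. \<nu> \<bullet> v = 0}"
    using sub1 sub2 by blast
qed

lemma support_unique:
  assumes p: "p \<in> sphere 0 1" and nu: "norm \<nu> = 1" "\<And>y. y \<in> K \<Longrightarrow> \<nu> \<bullet> y \<le> \<nu> \<bullet> Y p"
    and n: "norm n = 1" "\<And>y. y \<in> K \<Longrightarrow> n \<bullet> y \<le> n \<bullet> Y p"
  shows "n = \<nu>"
proof (rule ccontr)
  assume "n \<noteq> \<nu>"
  moreover have "n = \<nu> \<or> n = - \<nu>"
    using tangent_space_frontier(1)[OF p nu] tangent_space_frontier(1)[OF p n]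
    by (intro unit_normals_of_hyperplane nu n) auto
  ultimately have n_eq: "n = - \<nu>" by simp
  obtain k where k: "k \<in> interior K"
    using K_facts(4) by blast
  obtain y where "y \<in> K" "\<nu> \<bullet> k < \<nu> \<bullet> y"
    using interior_not_maximal[OF k, of \<nu>] nu by force
  then show False
    using nu(2)[of y] n(2)[of k] n_eq k interior_subset by fastforce
qed

lemma outward_normal_eq:
  assumes p: "p \<in> sphere 0 1" and nu: "norm \<nu> = 1" "\<And>y. y \<in> K \<Longrightarrow> \<nu> \<bullet> y \<le> \<nu> \<bullet> Y p"
  shows "outward_normal K (Y p) = \<nu>"
  unfolding outward_normal_def
proof (rule the_equality)
  have out: "Y p + s *\<^sub>R \<nu> \<notin> K" if "s > 0" for s
    using nu(2)[of "Y p + s *\<^sub>R \<nu>"] that nu(1)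
    by (auto simp: inner_add_right dot_square_norm)
  show "norm \<nu> = 1 \<and> (\<forall>v\<in>tangent_space (frontier K) (Y p). \<nu> \<bullet> v = 0) \<and>
      (\<forall>\<^sub>F s in at_right 0. Y p + s *\<^sub>R \<nu> \<notin> K)"
    using nu tangent_space_frontier(1)[OF p nu] out eventually_at_right_less
    by (auto elim!: eventually_mono simp: eventually_at_right_field intro!: exI[of _ 1])
next
  fix n assume n: "norm n = 1 \<and> (\<forall>v\<in>tangent_space (frontier K) (Y p). n \<bullet> v = 0) \<and>
      (\<forall>\<^sub>F s in at_right 0. Y p + s *\<^sub>R n \<notin> K)"
  have xK: "Y p \<in> K"
    using Y_frontier[OF p] K_facts by auto
  have "n = \<nu> \<or> n = - \<nu>"
    using n tangent_space_frontier(1)[OF p nu] by (intro unit_normals_of_hyperplane nu) auto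
  moreover have "n \<noteq> - \<nu>"
  proof
    assume n_eq: "n = - \<nu>"
    then obtain b where b: "b > 0" "\<And>s. 0 < s \<Longrightarrow> s < b \<Longrightarrow> Y p - s *\<^sub>R \<nu> \<notin> K"
      using n by (auto simp: eventually_at_right_field)
    define R where "R = (\<lambda>s. Y p - s *\<^sub>R \<nu>) ` {0<..}"
    have "Y p - s *\<^sub>R \<nu> \<notin> K" if "s > 0" for s
    proof
      assume sK: "Y p - s *\<^sub>R \<nu> \<in> K"
      define m where "m = min (1/2) (b / (2 * s))"
      have m: "0 < m" "m < 1" "m * s < b"
        using b that by (auto simp: m_def min_def field_simps)
      have "(1 - m) *\<^sub>R Y p + m *\<^sub>R (Y p - s *\<^sub>R \<nu>) \<in> K"
        using m K_facts(3) xK sK by (auto simp: convex_alt)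
      then have "Y p - (m * s) *\<^sub>R \<nu> \<in> K"
        by (simp add: algebra_simps)
      then show False
        using b(2)[of "m * s"] m that by auto
    qed
    then have "K \<inter> R = {}"
      by (auto simp: R_def)
    moreover have "convex R"
    proof -
      have "R = (\<lambda>x. Y p + x) ` ((\<lambda>s. - s *\<^sub>R \<nu>) ` {0<..})"
        unfolding R_def image_image by simp
      moreover have "linear (\<lambda>s. - s *\<^sub>R \<nu>)"
        by (auto intro!: linearI simp: algebra_simps)
      ultimately show ?thesis
        by (metis convex_translation convex_linear_image convex_real_interval(3))
    qed
    moreover have "R \<noteq> {}" "K \<noteq> {}"
      using xK by (auto simp: R_def)
    ultimately obtain a c where a: "a \<noteq> 0" "\<And>y. y \<in> K \<Longrightarrow> a \<bullet> y \<le> c" "\<And>y. y \<in> R \<Longrightarrow> c \<le> a \<bullet> y"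
      using separating_hyperplane_sets[of K R] K_facts(3) by metis
    have "c \<le> a \<bullet> Y p - s * (a \<bullet> \<nu>)" if "s > 0" for s
      using a(3)[of "Y p - s *\<^sub>R \<nu>"] that by (auto simp: R_def inner_diff_right)
    then have "\<forall>\<^sub>F s in at_right 0. c \<le> a \<bullet> Y p - s * (a \<bullet> \<nu>)"
      using eventually_at_right_less[of 0] by (rule eventually_mono[rotated])
    moreover have "((\<lambda>s. a \<bullet> Y p - s * (a \<bullet> \<nu>)) \<longlongrightarrow> a \<bullet> Y p - 0 * (a \<bullet> \<nu>)) (at_right 0)"
      by (intro tendsto_intros)
    ultimately have ca: "c \<le> a \<bullet> Y p"
      using tendsto_lowerbound by fastforce
    then have "a /\<^sub>R norm a = \<nu>"
      using a by (intro support_unique[OF p nu]) (fastforce simp: divide_simps)+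
    then have "a = norm a *\<^sub>R \<nu>"
      using a(1) by (auto simp: divide_simps)
    then have "a \<bullet> \<nu> = norm a"
      using nu(1) by (metis inner_scaleR_left dot_square_norm mult.right_neutral one_power2)
    moreover have "Y p - \<nu> \<in> R"
      unfolding R_def by (rule image_eqI[of _ _ 1]) auto
    then have "c \<le> a \<bullet> (Y p - \<nu>)"
      by (rule a(3))
    then have "c \<le> a \<bullet> Y p - a \<bullet> \<nu>"
      by (simp add: inner_diff_right)
    ultimately show False
      using a(1) a(2)[OF xK] ca zero_less_norm_iff[of a] by linarith
  qed
  ultimately show "n = \<nu>" by blast
qed

abbreviation N :: "'a \<Rightarrow> 'a" where "N p \<equiv> outward_normal K (Y p)"

lemma normal_support:
  assumes p: "p \<in> sphere 0 1"
  shows "norm (N p) = 1" and "y \<in> K \<Longrightarrow> N p \<bullet> y \<le> N p \<bullet> Y p"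
proof -
  obtain \<nu> where nu: "norm \<nu> = 1" "\<And>y. y \<in> K \<Longrightarrow> \<nu> \<bullet> y \<le> \<nu> \<bullet> Y p"
    using convex_body_support[OF body Y_frontier[OF p]] by metis
  then show "norm (N p) = 1" and "y \<in> K \<Longrightarrow> N p \<bullet> y \<le> N p \<bullet> Y p"
    using outward_normal_eq[OF p nu] by auto
qed

lemma tangent_eq:
  assumes "p \<in> sphere 0 1"
  shows "tangent_space (frontier K) (Y p) = {v. N p \<bullet> v = 0}"
    and "D p ` {v. p \<bullet> v = 0} = {v. N p \<bullet> v = 0}"
  using tangent_space_frontier[OF assms normal_support(1)[OF assms] normal_support(2)[OF assms]]
  by blast+

lemma normal_eqI:
  assumes p: "p \<in> sphere 0 1" and n: "norm n = 1" "\<And>q. q \<in> sphere 0 1 \<Longrightarrow> n \<bullet> Y q \<le> n \<bullet> Y p"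
  shows "N p = n"
proof -
  obtain x where x: "x \<in> frontier K" "\<And>y. y \<in> K \<Longrightarrow> n \<bullet> y \<le> n \<bullet> x"
    using convex_body_max_on_frontier[OF body, of n] n(1) by (metis norm_zero zero_neq_one)
  then obtain q where "q \<in> sphere 0 1" "x = Y q"
    using Y_image by blast
  then show ?thesis
    using n(2)[of q] x(2) by (intro outward_normal_eq[OF p n(1)]) fastforce
qed

lemma mem_iff_halfspaces:
  "x \<in> K \<longleftrightarrow> (\<forall>n. norm n = 1 \<longrightarrow> (\<exists>q\<in>sphere 0 1. n \<bullet> x \<le> n \<bullet> Y q))"
proof
  assume "x \<in> K"
  then show "\<forall>n. norm n = 1 \<longrightarrow> (\<exists>q\<in>sphere 0 1. n \<bullet> x \<le> n \<bullet> Y q)"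
    using convex_body_max_on_frontier[OF body] Y_image by (metis (no_types) imageE norm_zero zero_neq_one)
next
  assume R: "\<forall>n. norm n = 1 \<longrightarrow> (\<exists>q\<in>sphere 0 1. n \<bullet> x \<le> n \<bullet> Y q)"
  show "x \<in> K"
  proof (rule ccontr)
    assume "x \<notin> K"
    then obtain a b where ab: "a \<bullet> x < b" "\<And>y. y \<in> K \<Longrightarrow> a \<bullet> y > b"
      using separating_hyperplane_closed_point K_facts by metis
    have a0: "a \<noteq> 0"
      using ab K_facts(4) interior_subset by fastforce
    then obtain q where q: "q \<in> sphere 0 1" "(- a /\<^sub>R norm a) \<bullet> x \<le> (- a /\<^sub>R norm a) \<bullet> Y q"
      using R[rule_format, of "- a /\<^sub>R norm a"] by auto
    have "a \<bullet> Y q \<le> a \<bullet> x"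
      using q(2) a0 by (simp add: divide_simps)
    then show False
      using ab(1) ab(2)[of "Y q"] Y_frontier[OF q(1)] K_facts(5) by auto
  qed
qed

text \<open>The derivative of \<open>Y\<close> along the sphere may be changed in the radial direction, because
  \<open>p \<bullet> q - 1 = - (norm (q - p))\<^sup>2 / 2\<close> for unit vectors. Giving it the normal as
  radial value makes it invertible.\<close>

lemma radial_modification:
  assumes p: "p \<in> sphere 0 1"
  shows "(Y has_derivative (\<lambda>v. D p v + (p \<bullet> v) *\<^sub>R w)) (at p within sphere 0 1)"
proof -
  have *: "((\<lambda>q. Y q + (p \<bullet> q - 1 + ((q - p) \<bullet> (q - p)) / 2) *\<^sub>R w) has_derivative
      (\<lambda>v. D p v + (p \<bullet> v) *\<^sub>R w)) (at p within sphere 0 1)"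
    by (rule derivative_eq_intros deriv[OF p] refl | simp)+
  have "p \<bullet> q - 1 + ((q - p) \<bullet> (q - p)) / 2 = 0" if "q \<in> sphere 0 1" for q
  proof -
    have "q \<bullet> q = 1" "p \<bullet> p = 1"
      using that p by (auto simp: dot_square_norm)
    then show ?thesis
      by (simp add: inner_diff_left inner_diff_right inner_commute field_simps)
  qed
  then show ?thesis
    by (intro has_derivative_transform[OF p _ *]) simp
qed

lemma along_frontier:
  assumes p: "p \<in> sphere 0 1"
    and \<psi>: "((\<lambda>q. \<phi> (Y q)) has_derivative \<psi>) (at p within sphere 0 1)"
  shows "\<phi> differentiable (at (Y p) within frontier K)"
    and "p \<bullet> v = 0 \<Longrightarrow> along (frontier K) \<phi> (Y p) (D p v) = \<psi> v"
proof -
  define D' where "D' = (\<lambda>v. D p v + (p \<bullet> v) *\<^sub>R (N p - D p p))"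
  have D': "(Y has_derivative D') (at p within sphere 0 1)"
    unfolding D'_def by (rule radial_modification[OF p])
  have lin: "linear D'"
    using D' has_derivative_linear by blast
  have pp: "p \<bullet> p = 1" "N p \<bullet> N p = 1"
    using p normal_support(1)[OF p] by (auto simp: dot_square_norm)
  have "inj D'"
  proof (subst linear_injective_0[OF lin], intro allI impI)
    fix v assume v: "D' v = 0"
    define u where "u = v - (p \<bullet> v) *\<^sub>R p"
    have pu: "p \<bullet> u = 0"
      by (simp add: u_def inner_diff_right pp)
    have "D' v = D p u + (p \<bullet> v) *\<^sub>R N p"
      unfolding D'_def u_def using linear_D[OF p]
      by (simp add: linear_diff linear_scale algebra_simps)
    then have eq: "D p u + (p \<bullet> v) *\<^sub>R N p = 0"
      using v by simp
    have "N p \<bullet> D p u = 0"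
      using tangent_eq(2)[OF p] pu by blast
    then have a: "p \<bullet> v = 0"
      using arg_cong[OF eq, of "\<lambda>x. N p \<bullet> x"] by (simp add: inner_add_right pp)
    then have "D p u = D p 0"
      using eq linear_D[OF p] by (simp add: linear_0)
    then have "u = 0"
      using inj_onD[OF inj_D[OF p]] pu by auto
    then show "v = 0"
      using a by (simp add: u_def)
  qed
  then obtain g' where g': "linear g'" "g' \<circ> D' = id"
    using linear_injective_left_inverse[OF lin] by blast
  define g where "g = the_inv_into (sphere 0 1) Y"
  have inj: "inj_on Y (sphere 0 1)"
    using bij by (auto simp: bij_betw_def)
  have gY: "g (Y q) = q" if "q \<in> sphere 0 1" for q
    using the_inv_into_f_f[OF inj that] by (simp add: g_def)
  have "continuous_on (sphere 0 1) Y"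
    using deriv has_derivative_continuous continuous_on_eq_continuous_within by blast
  then have "continuous_on (frontier K) g"
    unfolding g_def Y_image[symmetric] by (intro continuous_on_inv_into inj compact_sphere)
  then have g_deriv: "(g has_derivative g') (at (Y p) within frontier K)"
    using has_derivative_inverse_within[OF D' _ p g' gY] Y_frontier[OF p]
    by (simp add: Y_image continuous_on_eq_continuous_within)
  have "g ` frontier K \<subseteq> sphere 0 1"
    using gY Y_image by force
  then have "((\<lambda>q. \<phi> (Y q)) has_derivative \<psi>) (at (g (Y p)) within g ` frontier K)"
    using \<psi> gY[OF p] has_derivative_subset by fastforce
  from diff_chain_within[OF g_deriv this]
  have "((\<lambda>y. \<phi> (Y (g y))) has_derivative (\<psi> \<circ> g')) (at (Y p) within frontier K)"
    by (simp add: comp_def)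
  then have \<phi>: "(\<phi> has_derivative (\<psi> \<circ> g')) (at (Y p) within frontier K)"
    by (rule has_derivative_transform[rotated 2]) (use Y_frontier[OF p] gY Y_image in force)+
  then show "\<phi> differentiable (at (Y p) within frontier K)"
    by (auto simp: differentiable_def)
  assume v: "p \<bullet> v = 0"
  have "g' (D p v) = v"
    using fun_cong[OF g'(2), of v] v by (simp add: D'_def)
  then show "along (frontier K) \<phi> (Y p) (D p v) = \<psi> v"
    using along_eq[OF \<phi> D_tangent[OF p v]] by simp
qed

end


section \<open>Inverse-concave speeds\<close>

lemma Gamma_plus_inverse:
  fixes A :: "real^'n^'n"
  assumes A: "A \<in> Gamma_plus"
  shows "A ** matrix_inv A = mat 1" "matrix_inv A ** A = mat 1"
    and "matrix_inv A \<in> Gamma_plus" "matrix_inv (matrix_inv A) = A"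
proof -
  have pos: "\<And>v. v \<noteq> 0 \<Longrightarrow> 0 < v \<bullet> (A *v v)" and tr: "transpose A = A"
    using A by (auto simp: Gamma_plus_def)
  have "inj ((*v) A)"
  proof (rule injI)
    fix x y assume "A *v x = A *v y"
    then have "A *v (x - y) = 0"
      by (simp add: matrix_vector_mult_diff_distrib)
    then show "x = y"
      using pos[of "x - y"] by (cases "x - y = 0") auto
  qed
  then obtain B where "B ** A = mat 1"
    using matrix_left_invertible_injective by blast
  then have "\<exists>B. A ** B = mat 1 \<and> B ** A = mat 1"
    using matrix_left_right_inverse by blast
  from someI_ex[OF this]
  show inv: "A ** matrix_inv A = mat 1" "matrix_inv A ** A = mat 1"
    unfolding matrix_inv_def by auto
  have "\<exists>B. matrix_inv A ** B = mat 1 \<and> B ** matrix_inv A = mat 1"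
    using inv by blast
  from someI_ex[OF this]
  have inv2: "matrix_inv A ** matrix_inv (matrix_inv A) = mat 1"
    unfolding matrix_inv_def[of "matrix_inv A"] by auto
  show "matrix_inv (matrix_inv A) = A"
    by (metis inv(1) inv2 matrix_mul_assoc matrix_mul_lid matrix_mul_rid)
  have "transpose (matrix_inv A) = transpose (matrix_inv A) ** (A ** matrix_inv A)"
    by (simp add: inv)
  also have "\<dots> = transpose (A ** matrix_inv A) ** matrix_inv A"
    by (simp add: matrix_mul_assoc matrix_transpose_mul tr)
  also have "\<dots> = matrix_inv A"
    by (simp add: inv transpose_mat)
  finally have sym: "transpose (matrix_inv A) = matrix_inv A" .
  have "0 < v \<bullet> (matrix_inv A *v v)" if "v \<noteq> 0" for v
  proof -
    let ?u = "matrix_inv A *v v"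
    have v: "v = A *v ?u"
      by (simp add: matrix_vector_mul_assoc inv)
    then have "?u \<noteq> 0"
      using that by auto
    then show ?thesis
      using pos[of ?u] v by (metis inner_commute)
  qed
  then show "matrix_inv A \<in> Gamma_plus"
    using sym by (simp add: Gamma_plus_def)
qed

text \<open>With \<open>C = (1 - l) A1\<inverse> + l A2\<inverse>\<close>, testing the hypothesis on \<open>A1\<inverse> \<eta>\<close> and \<open>A2\<inverse> \<eta>\<close> where
  \<open>\<eta> = C\<inverse> \<zeta>\<close> gives \<open>A0 \<le> C\<inverse>\<close>.\<close>

lemma inverse_concave_comparison:
  fixes A0 A1 A2 :: "real^'n^'n" and f :: "real^'m \<Rightarrow> real^'n^'n \<Rightarrow> real"
  assumes f: "admissible_speed f" and p: "p \<in> sphere 0 1"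
    and A: "A0 \<in> Gamma_plus" "A1 \<in> Gamma_plus" "A2 \<in> Gamma_plus" and l: "0 \<le> l" "l \<le> 1"
    and le: "\<And>\<xi> \<eta>. ((1 - l) *\<^sub>R \<xi> + l *\<^sub>R \<eta>) \<bullet> (A0 *v ((1 - l) *\<^sub>R \<xi> + l *\<^sub>R \<eta>)) \<le>
        (1 - l) * (\<xi> \<bullet> (A1 *v \<xi>)) + l * (\<eta> \<bullet> (A2 *v \<eta>))"
  shows "(1 - l) / f p A1 + l / f p A2 \<le> 1 / f p A0"
proof -
  have conc: "concave_on Gamma_plus (\<lambda>r. 1 / f p (matrix_inv r))"
    and mono: "\<And>r s. r \<in> Gamma_plus \<Longrightarrow> s \<in> Gamma_plus \<Longrightarrow> pos_semidef (r - s) \<Longrightarrow> f p s \<le> f p r"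
    and pos: "\<And>r. r \<in> Gamma_plus \<Longrightarrow> 0 < f p r"
    using f p unfolding admissible_speed_def inverse_concave_def monotone_snd_def by blast+
  define B1 B2 where "B1 = matrix_inv A1" and "B2 = matrix_inv A2"
  define C where "C = (1 - l) *\<^sub>R B1 + l *\<^sub>R B2"
  have B: "B1 \<in> Gamma_plus" "B2 \<in> Gamma_plus"
    unfolding B1_def B2_def using A Gamma_plus_inverse(3) by auto
  have C: "C \<in> Gamma_plus"
    unfolding C_def using concave_on_imp_convex[OF conc] B l by (intro convexD) auto
  have "\<zeta> \<bullet> (A0 *v \<zeta>) \<le> \<zeta> \<bullet> (matrix_inv C *v \<zeta>)" for \<zeta>
  proof -
    define \<eta> where "\<eta> = matrix_inv C *v \<zeta>"
    have z: "\<zeta> = C *v \<eta>"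
      by (simp add: \<eta>_def matrix_vector_mul_assoc Gamma_plus_inverse[OF C])
    have z2: "\<zeta> = (1 - l) *\<^sub>R (B1 *v \<eta>) + l *\<^sub>R (B2 *v \<eta>)"
      by (simp add: z C_def matrix_vector_mult_add_rdistrib scaleR_matrix_vector_assoc)
    have i: "A1 *v (B1 *v \<eta>) = \<eta>" "A2 *v (B2 *v \<eta>) = \<eta>"
      by (simp_all add: B1_def B2_def matrix_vector_mul_assoc Gamma_plus_inverse[OF A(2)]
          Gamma_plus_inverse[OF A(3)])
    have "\<zeta> \<bullet> (A0 *v \<zeta>) \<le> (1 - l) * ((B1 *v \<eta>) \<bullet> \<eta>) + l * ((B2 *v \<eta>) \<bullet> \<eta>)"
      using le[of "B1 *v \<eta>" "B2 *v \<eta>"] unfolding z2[symmetric] i .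
    also have "\<dots> = \<zeta> \<bullet> \<eta>"
      by (simp add: z2 inner_add_left)
    finally show ?thesis
      by (simp add: \<eta>_def)
  qed
  moreover have "transpose (matrix_inv C - A0) = matrix_inv C - A0"
    using Gamma_plus_inverse(3)[OF C] A(1) by (simp add: Gamma_plus_def transpose_def vec_eq_iff)
  ultimately have "pos_semidef (matrix_inv C - A0)"
    by (simp add: pos_semidef_def matrix_vector_mult_diff_rdistrib inner_diff_right)
  then have "f p A0 \<le> f p (matrix_inv C)"
    by (rule mono[OF Gamma_plus_inverse(3)[OF C] A(1)])
  then have "1 / f p (matrix_inv C) \<le> 1 / f p A0"
    using pos[OF A(1)] by (intro divide_left_mono) auto
  moreover have "(1 - l) * (1 / f p (matrix_inv B1)) + l * (1 / f p (matrix_inv B2)) \<le> 1 / f p (matrix_inv C)"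
    unfolding C_def using concave_onD[OF conc l B] .
  ultimately show ?thesis
    by (simp add: B1_def B2_def Gamma_plus_inverse(4) A)
qed

lemma orthonormal_frame_exists:
  fixes \<nu> :: "real^'m"
  assumes "norm \<nu> = 1" "CARD('m) = CARD('n) + 1"
  obtains e :: "'n::finite \<Rightarrow> real^'m" where "\<And>i. \<nu> \<bullet> e i = 0"
    "\<And>i j. e i \<bullet> e j = (if i = j then 1 else 0)"
proof -
  have "\<nu> \<noteq> 0" using assms by auto
  obtain B where B: "B \<subseteq> {x. \<nu> \<bullet> x = 0}" "pairwise orthogonal B" "\<And>x. x \<in> B \<Longrightarrow> norm x = 1"
    "independent B" "card B = dim {x. \<nu> \<bullet> x = 0}"
    using orthonormal_basis_subspace[OF subspace_hyperplane[of \<nu>]] by metis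
  have "card B = CARD('n)"
    using B(5) dim_hyperplane[OF \<open>\<nu> \<noteq> 0\<close>] assms(2) by simp
  moreover have "finite B"
    using B(4) independent_imp_finite by blast
  ultimately obtain e :: "'n \<Rightarrow> real^'m" where e: "bij_betw e UNIV B"
    by (metis finite finite_same_card_bij)
  show ?thesis
  proof (rule that[of e])
    fix i j
    have "e i \<in> B" "e j \<in> B"
      using e by (auto simp: bij_betw_def)
    moreover have "i \<noteq> j \<Longrightarrow> e i \<noteq> e j"
      using e by (auto simp: bij_betw_def inj_on_def)
    ultimately show "\<nu> \<bullet> e i = 0" "e i \<bullet> e j = (if i = j then 1 else 0)"
      using B(1-3) by (auto simp: pairwise_def orthogonal_def dot_square_norm)
  qed
qed

lemma second_ff_frame:
  assumes "linear (along (frontier K) (outward_normal K) x)"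
  shows "second_ff K x (\<Sum>i\<in>UNIV. \<xi> $ i *\<^sub>R e i) (\<Sum>i\<in>UNIV. \<xi> $ i *\<^sub>R e i) =
    \<xi> \<bullet> (second_ff_matrix K x e *v \<xi>)"
proof -
  have "second_ff K x (\<Sum>i\<in>UNIV. \<xi> $ i *\<^sub>R e i) (\<Sum>i\<in>UNIV. \<xi> $ i *\<^sub>R e i) =
    (\<Sum>i\<in>UNIV. \<Sum>j\<in>UNIV. \<xi> $ i * (\<xi> $ j * second_ff K x (e i) (e j)))"
    unfolding second_ff_def linear_sum[OF assms] linear_scale[OF assms]
    by (simp add: inner_sum_left inner_sum_right sum_distrib_left)
      (subst sum.swap, simp add: mult.left_commute)
  also have "\<dots> = \<xi> \<bullet> (second_ff_matrix K x e *v \<xi>)"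
    by (simp add: second_ff_matrix_def inner_vec_def matrix_vector_mult_def sum_distrib_left mult_ac)
  finally show ?thesis .
qed


section \<open>Calculus\<close>

lemma smooth_on_local:
  assumes "smooth_on S g" "x \<in> S"
  obtains U h h' where "open U" "x \<in> U"
    "\<And>y. y \<in> U \<Longrightarrow> (h has_derivative h' y) (at y)"
    "\<And>y v. y \<in> U \<Longrightarrow> (\<lambda>y. h' y v) differentiable (at y)"
    "\<And>y. y \<in> S \<Longrightarrow> y \<in> U \<Longrightarrow> h y = g y"
proof -
  obtain U h where U: "open U" "x \<in> U" and h: "\<forall>k. C_k_on k U h" "\<forall>y\<in>S \<inter> U. h y = g y"
    using assms unfolding smooth_on_def by meson
  have "C_k_on (Suc (Suc 0)) U h"
    using h(1) by blast
  then obtain h' where h': "\<forall>y\<in>U. (h has_derivative h' y) (at y)"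
      "\<forall>v. C_k_on (Suc 0) U (\<lambda>y. h' y v)"
    unfolding C_k_on.simps(2)[of "Suc 0"] by auto
  have "(\<lambda>y. h' y v) differentiable (at y)" if "y \<in> U" for y v
    using h'(2) that unfolding C_k_on.simps(2) differentiable_def by meson
  then show ?thesis
    using that[OF U, of h h'] h'(1) h(2) by blast
qed

lemma has_derivative_inner_vanishing:
  fixes c g :: "'a::real_normed_vector \<Rightarrow> 'b::real_inner"
  assumes c: "continuous (at x within S) c" and g: "(g has_derivative g') (at x within S)"
    and "g x = 0" "x \<in> S"
  shows "((\<lambda>y. c y \<bullet> g y) has_derivative (\<lambda>v. c x \<bullet> g' v)) (at x within S)"
proof -
  have bl: "bounded_linear g'"
    using g has_derivative_bounded_linear by blast
  have "((\<lambda>y. (c y - c x) \<bullet> g y) has_derivative (\<lambda>v. 0)) (at x within S)"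
    unfolding has_derivative_within_alt
  proof (intro conjI allI impI)
    show "bounded_linear (\<lambda>v. 0)" by (rule bounded_linear_zero)
    fix e :: real assume e: "e > 0"
    obtain B where B: "B > 0" "\<And>v. norm (g' v) \<le> norm v * B"
      using bounded_linear.pos_bounded[OF bl] by blast
    obtain d1 where d1: "d1 > 0" "\<And>y. y \<in> S \<Longrightarrow> norm (y - x) < d1 \<Longrightarrow>
        norm (g y - g x - g' (y - x)) \<le> 1 * norm (y - x)"
      using g unfolding has_derivative_within_alt by (metis zero_less_one)
    have "e / (B + 1) > 0"
      using e B by simp
    then obtain d2 where d2: "d2 > 0" "\<And>y. y \<in> S \<Longrightarrow> dist y x < d2 \<Longrightarrow> dist (c y) (c x) < e / (B + 1)"
      using c unfolding continuous_within_eps_delta by blast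
    show "\<exists>d>0. \<forall>y\<in>S. norm (y - x) < d \<longrightarrow>
        norm ((c y - c x) \<bullet> g y - (c x - c x) \<bullet> g x - 0) \<le> e * norm (y - x)"
    proof (intro exI[of _ "min d1 d2"] conjI ballI impI)
      show "min d1 d2 > 0" using d1 d2 by simp
      fix y assume y: "y \<in> S" "norm (y - x) < min d1 d2"
      have "norm (g y) \<le> norm (g y - g' (y - x)) + norm (g' (y - x))"
        by (metis diff_add_cancel norm_triangle_ineq)
      also have "\<dots> \<le> (B + 1) * norm (y - x)"
        using d1(2)[OF y(1)] y(2) B(2)[of "y - x"] \<open>g x = 0\<close> by (simp add: algebra_simps)
      finally have 1: "norm (g y) \<le> (B + 1) * norm (y - x)" .
      have "norm ((c y - c x) \<bullet> g y) \<le> norm (c y - c x) * norm (g y)"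
        using Cauchy_Schwarz_ineq2 by (simp add: real_norm_def)
      also have "\<dots> \<le> e / (B + 1) * ((B + 1) * norm (y - x))"
        using d2(2)[OF y(1)] y(2) 1 e B(1) by (intro mult_mono) (auto simp: dist_norm)
      also have "\<dots> = e * norm (y - x)"
        using B(1) by simp
      finally show "norm ((c y - c x) \<bullet> g y - (c x - c x) \<bullet> g x - 0) \<le> e * norm (y - x)"
        by simp
    qed
  qed
  from has_derivative_add[OF this has_derivative_inner_right[OF g, of "c x"]]
  show ?thesis
    by (simp add: inner_diff_left)
qed

text \<open>Normalising a unit normal field \<open>n\<close> by \<open>n \<bullet> n x = 1\<close>, the directions in which the
  normalised field has a differentiable component form a subspace. It contains the tangent
  directions \<open>k b x\<close> since \<open>n y \<bullet> k b x = - n y \<bullet> (k b y - k b x)\<close>.\<close>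

lemma unit_normal_differentiable:
  fixes n :: "'a::real_normed_vector \<Rightarrow> 'b::euclidean_space"
  assumes cont: "continuous (at x within S) n" and x: "x \<in> S"
    and unit: "\<And>y. y \<in> S \<Longrightarrow> norm (n y) = 1"
    and diff: "\<And>b. b \<in> B \<Longrightarrow> k b differentiable (at x within S)"
    and orth: "\<And>b. b \<in> B \<Longrightarrow> \<forall>\<^sub>F y in at x within S. n y \<bullet> k b y = 0"
    and orth_x: "\<And>b. b \<in> B \<Longrightarrow> n x \<bullet> k b x = 0"
    and span: "span (insert (n x) ((\<lambda>b. k b x) ` B)) = UNIV"
  shows "n differentiable (at x within S)"
proof -
  define m where "m y = n y /\<^sub>R (n y \<bullet> n x)" for y
  have nx: "n x \<bullet> n x = 1"
    using unit[OF x] by (simp add: dot_square_norm)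
  have "continuous (at x within S) (\<lambda>y. n y \<bullet> n x)"
    by (intro continuous_intros cont)
  then have "((\<lambda>y. n y \<bullet> n x) \<longlongrightarrow> 1) (at x within S)"
    using nx by (simp add: continuous_within)
  then have pos: "\<forall>\<^sub>F y in at x within S. n y \<bullet> n x > 0"
    by (rule order_tendstoD) simp
  have mx: "m x = n x"
    by (simp add: m_def nx)
  have m_cont: "continuous (at x within S) m"
    unfolding m_def [abs_def] by (intro continuous_intros cont) (simp add: nx)
  define W where "W = {e. (\<lambda>y. m y \<bullet> e) differentiable (at x within S)}"
  have "subspace W"
    unfolding W_def by (intro subspaceI) (auto simp: inner_add_right)
  moreover have "n x \<in> W"
  proof -
    have "\<forall>\<^sub>F y in at x within S. 1 = m y \<bullet> n x"
      using pos by eventually_elim (simp add: m_def)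
    then have "((\<lambda>y. m y \<bullet> n x) has_derivative (\<lambda>v. 0)) (at x within S)"
      by (intro has_derivative_transform_eventually[OF has_derivative_const]) (auto simp: mx nx x)
    then show ?thesis
      unfolding W_def differentiable_def by blast
  qed
  moreover have "k b x \<in> W" if b: "b \<in> B" for b
  proof -
    obtain k' where k': "(k b has_derivative k') (at x within S)"
      using diff[OF b] by (auto simp: differentiable_def)
    have "((\<lambda>y. k b y - k b x) has_derivative k') (at x within S)"
      using has_derivative_diff[OF k' has_derivative_const[of "k b x"]] by simp
    from has_derivative_minus[OF has_derivative_inner_vanishing[OF m_cont this _ x]]
    have *: "((\<lambda>y. - (m y \<bullet> (k b y - k b x))) has_derivative (\<lambda>v. - (m x \<bullet> k' v))) (at x within S)"
      by simp
    have "\<forall>\<^sub>F y in at x within S. - (m y \<bullet> (k b y - k b x)) = m y \<bullet> k b x"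
      using orth[OF b] by eventually_elim (simp add: m_def inner_diff_right)
    then have "((\<lambda>y. m y \<bullet> k b x) has_derivative (\<lambda>v. - (m x \<bullet> k' v))) (at x within S)"
      by (intro has_derivative_transform_eventually[OF *]) (auto simp: x mx orth_x b)
    then show ?thesis
      unfolding W_def differentiable_def by blast
  qed
  ultimately have "span (insert (n x) ((\<lambda>b. k b x) ` B)) \<subseteq> W"
    by (intro span_minimal) auto
  then have "m differentiable (at x within S)"
    unfolding differentiable_componentwise_within[of m] using span W_def by blast
  moreover have "m x \<noteq> 0"
    using mx nx by auto
  moreover have "(\<lambda>y. norm (m y)) differentiable (at x within S)"
    using differentiable_chain_within[OF calculation(1), of norm] calculation(2)
    by (simp add: comp_def differentiable_at_withinI differentiable_norm_at)
  ultimately have "(\<lambda>y. m y /\<^sub>R norm (m y)) differentiable (at x within S)"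
    by (intro differentiable_scaleR differentiable_inverse) auto
  then obtain m' where m': "((\<lambda>y. m y /\<^sub>R norm (m y)) has_derivative m') (at x within S)"
    by (auto simp: differentiable_def)
  have "\<forall>\<^sub>F y in at x within S. y \<in> S"
    by (simp add: eventually_at_filter)
  then have "\<forall>\<^sub>F y in at x within S. m y /\<^sub>R norm (m y) = n y"
    using pos by eventually_elim (simp add: m_def unit)
  then have "(n has_derivative m') (at x within S)"
    by (intro has_derivative_transform_eventually[OF m']) (auto simp: x mx unit)
  then show ?thesis
    by (auto simp: differentiable_def)
qed

lemma sphere_curve_velocity_orthogonal:
  fixes p :: "'a::euclidean_space"
  assumes "p \<in> sphere 0 1" "p \<bullet> v = 0"
  shows "sphere_curve p v s \<bullet> sphere_curve_velocity p v s = 0"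
proof -
  let ?c = "sphere_curve p v"
  note d = sphere_curve_has_vector_derivative[of p v s]
  have "((\<lambda>s. ?c s \<bullet> ?c s) has_vector_derivative 2 * (?c s \<bullet> sphere_curve_velocity p v s)) (at s)"
    using bounded_bilinear.has_vector_derivative[OF bounded_bilinear_inner d d]
    by (simp add: inner_commute)
  moreover have "(\<lambda>s. ?c s \<bullet> ?c s) = (\<lambda>s. 1)"
    using sphere_curve_in_sphere[OF assms] by (auto simp: dot_square_norm)
  ultimately have "((\<lambda>s. 1) has_vector_derivative 2 * (?c s \<bullet> sphere_curve_velocity p v s)) (at s)"
    by simp
  then show ?thesis
    using vector_derivative_unique_at[OF _ has_vector_derivative_const] by fastforce
qed

lemma at_within_Ico_neq_bot:
  fixes a b t :: real
  assumes "t \<in> {a..<b}"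
  shows "at t within {a..<b} \<noteq> bot"
proof -
  have "t islimpt {a..<b}"
    using islimpt_subset[OF islimpt_greaterThanLessThan1[of t b], of "{a..<b}"] assms by auto
  then show ?thesis
    using trivial_limit_within by blast
qed

lemma has_vector_derivative_at_0_tendsto:
  fixes g :: "real \<Rightarrow> 'a::real_normed_vector"
  assumes "(g has_vector_derivative w) (at 0)"
  shows "((\<lambda>s. (g s - g 0) /\<^sub>R s) \<longlongrightarrow> w) (at 0)"
proof -
  have "((\<lambda>s. norm (g (0 + s) - g 0 - s *\<^sub>R w) / norm s) \<longlongrightarrow> 0) (at 0)"
    using assms unfolding has_vector_derivative_def has_derivative_at by blast
  then have "((\<lambda>s. norm ((g s - g 0 - s *\<^sub>R w) /\<^sub>R s)) \<longlongrightarrow> 0) (at 0)"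
    by (simp add: divide_inverse_commute)
  then have "((\<lambda>s. (g s - g 0 - s *\<^sub>R w) /\<^sub>R s) \<longlongrightarrow> 0) (at 0)"
    by (rule tendsto_norm_zero_cancel)
  from tendsto_add[OF this tendsto_const[of w]]
  have lim: "((\<lambda>s. (g s - g 0 - s *\<^sub>R w) /\<^sub>R s + w) \<longlongrightarrow> w) (at 0)"
    by simp
  have "\<forall>\<^sub>F s in at 0. (g s - g 0 - s *\<^sub>R w) /\<^sub>R s + w = (g s - g 0) /\<^sub>R s"
    by (auto simp: eventually_at_filter scaleR_diff_right)
  then show ?thesis
    by (rule Lim_transform_eventually[OF lim])
qed

lemma touching_first_order:
  fixes n e :: "real \<Rightarrow> 'a::real_inner"
  assumes "r > 0" and n: "(n \<longlongrightarrow> \<nu>) (at 0 within {0..r})"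
    and e: "(e has_vector_derivative w) (at 0 within {0..r})" "e 0 = 0"
    and le: "\<And>s. 0 < s \<Longrightarrow> s \<le> r \<Longrightarrow> n s \<bullet> e s \<le> 0"
  shows "\<nu> \<bullet> w \<le> 0"
proof -
  let ?A = "at 0 within {0..r}"
  have pos: "\<forall>\<^sub>F s in ?A. 0 < s \<and> s \<le> r"
    by (auto simp: eventually_at_filter)
  have "((\<lambda>s. (e s - e 0 - (s - 0) *\<^sub>R w) /\<^sub>R norm (s - 0)) \<longlongrightarrow> 0) ?A"
    using e(1) unfolding has_vector_derivative_def has_derivative_at_within by blast
  from tendsto_add[OF this tendsto_const[of w]]
  have lim: "((\<lambda>s. (e s - e 0 - (s - 0) *\<^sub>R w) /\<^sub>R norm (s - 0) + w) \<longlongrightarrow> w) ?A"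
    by simp
  have "\<forall>\<^sub>F s in ?A. (e s - e 0 - (s - 0) *\<^sub>R w) /\<^sub>R norm (s - 0) + w = e s /\<^sub>R s"
    using pos by eventually_elim (simp add: e(2) algebra_simps)
  then have "((\<lambda>s. e s /\<^sub>R s) \<longlongrightarrow> w) ?A"
    by (rule Lim_transform_eventually[OF lim])
  then have "((\<lambda>s. n s \<bullet> (e s /\<^sub>R s)) \<longlongrightarrow> \<nu> \<bullet> w) ?A"
    by (intro tendsto_inner n)
  moreover have "\<forall>\<^sub>F s in ?A. n s \<bullet> (e s /\<^sub>R s) \<le> 0"
    using pos by eventually_elim (use le in \<open>simp add: divide_le_0_iff mult_le_0_iff\<close>)
  moreover have "?A \<noteq> bot"
    using \<open>r > 0\<close> by (simp add: at_within_Icc_at_right trivial_limit_at_right_real)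
  ultimately show ?thesis
    using tendsto_upperbound by blast
qed


section \<open>Regularity of the flow\<close>

locale smooth_convex_flow =
  fixes f :: "real^'m \<Rightarrow> real^'n^'n \<Rightarrow> real" and \<alpha> t\<^sub>0 T :: real
    and \<Omega> :: "real \<Rightarrow> (real^'m) set" and X :: "real^'m \<Rightarrow> real \<Rightarrow> real^'m"
    and F :: "real^'m \<Rightarrow> real \<Rightarrow> real"
  assumes dim: "CARD('m) = CARD('n) + 1" and alpha: "\<alpha> > 0" and speed: "admissible_speed f"
    and before: "t\<^sub>0 < T" and flow: "convex_flow f \<alpha> {t\<^sub>0..<T} \<Omega> X F"
begin

abbreviation J :: "real set" where "J \<equiv> {t\<^sub>0..<T}"

abbreviation S :: "(real^'m) set" where "S \<equiv> sphere 0 1"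

abbreviation N :: "real^'m \<Rightarrow> real \<Rightarrow> real^'m" where "N p t \<equiv> outward_normal (\<Omega> t) (X p t)"

definition D :: "real \<Rightarrow> real^'m \<Rightarrow> real^'m \<Rightarrow> real^'m" where
  "D t p = frechet_derivative (\<lambda>q. X q t) (at p within S)"

lemma S_nonempty: "S \<noteq> {}"
proof -
  have "(SOME i. i \<in> Basis) \<in> S"
    using norm_Basis[OF SOME_Basis] by simp
  then show ?thesis by blast
qed

lemma flow_facts:
  shows body: "t \<in> J \<Longrightarrow> convex_body (\<Omega> t)"
    and smooth: "smooth_on (S \<times> J) (\<lambda>(p, t). X p t)"
    and motion: "t \<in> J \<Longrightarrow> p \<in> S \<Longrightarrow> (X p has_vector_derivative - F (X p t) t *\<^sub>R N p t) (at t within J)"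
  using flow unfolding convex_flow_def by blast+

lemma speed_frame:
  fixes e :: "'n \<Rightarrow> real^'m"
  assumes "t \<in> J" "x \<in> frontier (\<Omega> t)" "orthonormal_frame (frontier (\<Omega> t)) x e"
  shows "second_ff_matrix (\<Omega> t) x e \<in> Gamma_plus"
    and "F x t = f (outward_normal (\<Omega> t) x) (second_ff_matrix (\<Omega> t) x e) powr \<alpha>"
  using assms flow unfolding convex_flow_def by blast+

lemma local_extension:
  assumes "p \<in> S" "t \<in> J"
  obtains U h h' where "open U" "(p, t) \<in> U"
    "\<And>y. y \<in> U \<Longrightarrow> (h has_derivative h' y) (at y)"
    "\<And>y v. y \<in> U \<Longrightarrow> (\<lambda>y. h' y v) differentiable (at y)"
    "\<And>q s. q \<in> S \<Longrightarrow> s \<in> J \<Longrightarrow> (q, s) \<in> U \<Longrightarrow> h (q, s) = X q s"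
proof (rule smooth_on_local[OF smooth, of "(p, t)"])
  show "(p, t) \<in> S \<times> J"
    using assms by simp
next
  fix U h h'
  assume U: "open U" "(p, t) \<in> U"
    and h: "\<And>y. y \<in> U \<Longrightarrow> (h has_derivative h' y) (at y)"
    "\<And>y v. y \<in> U \<Longrightarrow> (\<lambda>y. h' y v) differentiable (at y)"
    and eq: "\<And>y. y \<in> S \<times> J \<Longrightarrow> y \<in> U \<Longrightarrow> h y = (case y of (p, t) \<Rightarrow> X p t)"
  have "h (q, s) = X q s" if "q \<in> S" "s \<in> J" "(q, s) \<in> U" for q s
    using eq[of "(q, s)"] that by simp
  with that[OF U h] show thesis by blast
qed

lemma slice_derivative:
  assumes U: "open U" "(p, t) \<in> U" and h: "(h has_derivative h') (at (p, t))"
    and eq: "\<And>q s. q \<in> S \<Longrightarrow> s \<in> J \<Longrightarrow> (q, s) \<in> U \<Longrightarrow> h (q, s) = X q s"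
    and p: "p \<in> S" and t: "t \<in> J"
  shows "((\<lambda>q. X q t) has_derivative (\<lambda>v. h' (v, 0))) (at p within S)"
    and "(X p has_vector_derivative h' (0, 1)) (at t within J)"
proof -
  have 1: "((\<lambda>q. (q, t)) has_derivative (\<lambda>v. (v, 0))) (at p within S)"
    by (auto intro!: derivative_eq_intros)
  have a: "((\<lambda>q. h (q, t)) has_derivative (\<lambda>v. h' (v, 0))) (at p within S)"
    using has_derivative_compose[OF 1, of h h'] h by (simp add: has_derivative_at_withinI)
  have "((\<lambda>q. (q, t)) \<longlongrightarrow> (p, t)) (at p within S)"
    by (intro tendsto_intros)
  then have "\<forall>\<^sub>F q in at p within S. (q, t) \<in> U"
    using U by (rule topological_tendstoD)
  moreover have "\<forall>\<^sub>F q in at p within S. q \<in> S"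
    by (simp add: eventually_at_filter)
  ultimately have "\<forall>\<^sub>F q in at p within S. h (q, t) = X q t"
    by eventually_elim (use eq t in auto)
  then show "((\<lambda>q. X q t) has_derivative (\<lambda>v. h' (v, 0))) (at p within S)"
    by (intro has_derivative_transform_eventually[OF a]) (use eq p t U in auto)
  have 2: "((\<lambda>s. (p, s)) has_derivative (\<lambda>s. (0, s))) (at t within J)"
    by (auto intro!: derivative_eq_intros)
  have b: "((\<lambda>s. h (p, s)) has_derivative (\<lambda>s. h' (0, s))) (at t within J)"
    using has_derivative_compose[OF 2, of h h'] h by (simp add: has_derivative_at_withinI)
  have "((\<lambda>s. (p, s)) \<longlongrightarrow> (p, t)) (at t within J)"
    by (intro tendsto_intros)
  then have "\<forall>\<^sub>F s in at t within J. (p, s) \<in> U"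
    using U by (rule topological_tendstoD)
  moreover have "\<forall>\<^sub>F s in at t within J. s \<in> J"
    by (simp add: eventually_at_filter)
  ultimately have "\<forall>\<^sub>F s in at t within J. h (p, s) = X p s"
    by eventually_elim (use eq p in auto)
  then have "(X p has_derivative (\<lambda>s. h' (0, s))) (at t within J)"
    by (intro has_derivative_transform_eventually[OF b]) (use eq p t U in auto)
  moreover have "(\<lambda>s. h' (0, s)) = (\<lambda>s. s *\<^sub>R h' (0, 1))"
  proof
    show "h' (0, s) = s *\<^sub>R h' (0, 1)" for s
      using linear_scale[OF has_derivative_linear[OF h], of s "(0, 1)"] by simp
  qed
  ultimately show "(X p has_vector_derivative h' (0, 1)) (at t within J)"
    unfolding has_vector_derivative_def by simp
qed

lemma embedding:
  assumes t: "t \<in> J"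
  shows "convex_embedding (\<Omega> t) (\<lambda>p. X p t) (D t)"
proof
  show "convex_body (\<Omega> t)" by (rule body[OF t])
  show "bij_betw (\<lambda>p. X p t) S (frontier (\<Omega> t))"
    using flow t unfolding convex_flow_def by blast
  fix p :: "real^'m" assume p: "p \<in> S"
  show "inj_on (along S (\<lambda>q. X q t) p) (tangent_space S p)"
    using flow t p unfolding convex_flow_def by blast
  obtain U h h' where "open U" "(p, t) \<in> U"
    "\<And>y. y \<in> U \<Longrightarrow> (h has_derivative h' y) (at y)"
    "\<And>q s. q \<in> S \<Longrightarrow> s \<in> J \<Longrightarrow> (q, s) \<in> U \<Longrightarrow> h (q, s) = X q s"
    using local_extension[OF p t] by metis
  from slice_derivative(1)[OF this(1,2) this(3)[OF this(2)] this(4) p t]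
  show "((\<lambda>q. X q t) has_derivative D t p) (at p within S)"
    unfolding D_def using frechet_derivative_works differentiable_def by blast
qed

lemma D_extension:
  assumes "((\<lambda>q. X q t) has_derivative g') (at p within S)" "p \<in> S" "p \<bullet> v = 0"
  shows "D t p v = g' v"
  using along_eq[OF assms(1)] tangent_space_sphere[OF assms(2)] assms(3)
  unfolding along_def D_def by simp

lemma X_continuous: "continuous_on (S \<times> J) (\<lambda>(p, t). X p t)"
proof -
  have "continuous (at (p, t) within S \<times> J) (\<lambda>(p, t). X p t)" if p: "p \<in> S" and t: "t \<in> J" for p t
  proof -
    obtain U h h' where U: "open U" "(p, t) \<in> U"
      and h: "\<And>y. y \<in> U \<Longrightarrow> (h has_derivative h' y) (at y)"
      and eq: "\<And>q s. q \<in> S \<Longrightarrow> s \<in> J \<Longrightarrow> (q, s) \<in> U \<Longrightarrow> h (q, s) = X q s"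
      using local_extension[OF p t] by metis
    have "continuous (at (p, t)) h"
      using has_derivative_continuous[OF h[OF U(2)]] .
    then have lim: "(h \<longlongrightarrow> X p t) (at (p, t) within S \<times> J)"
      using eq[OF p t U(2)] continuous_at_imp_continuous_at_within unfolding continuous_within by metis
    have "\<forall>\<^sub>F y in at (p, t) within S \<times> J. y \<in> U"
      by (rule topological_tendstoD[OF tendsto_ident_at U])
    moreover have "\<forall>\<^sub>F y in at (p, t) within S \<times> J. y \<in> S \<times> J"
      by (simp add: eventually_at_filter)
    ultimately have "\<forall>\<^sub>F y in at (p, t) within S \<times> J. h y = (case y of (p, t) \<Rightarrow> X p t)"
      by eventually_elim (use eq in auto)
    then show ?thesis
      unfolding continuous_within using Lim_transform_eventually[OF lim] by simp
  qed
  then show ?thesis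
    unfolding continuous_on_eq_continuous_within by auto
qed

lemma continuous_on_X [continuous_intros]:
  assumes "continuous_on A a" "continuous_on A b" "\<And>x. x \<in> A \<Longrightarrow> a x \<in> S" "\<And>x. x \<in> A \<Longrightarrow> b x \<in> J"
  shows "continuous_on A (\<lambda>x. X (a x) (b x))"
proof -
  have "(\<lambda>x. (a x, b x)) ` A \<subseteq> S \<times> J"
    using assms(3,4) by blast
  from continuous_on_compose2[OF X_continuous continuous_on_Pair[OF assms(1,2)] this]
  show ?thesis by simp
qed

lemma normal_continuous: "continuous_on (S \<times> J) (\<lambda>(p, t). N p t)"
proof -
  let ?G = "(\<lambda>x. (x, case x of (p, t) \<Rightarrow> N p t)) ` (S \<times> J)"
  let ?R = "(S \<times> J) \<times> S"
  let ?\<phi> = "\<lambda>q z. snd z \<bullet> X q (snd (fst z)) - snd z \<bullet> X (fst (fst z)) (snd (fst z))"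
  have G: "?G = (\<Inter>q\<in>S. ?R \<inter> ?\<phi> q -` {..0})"
  proof (intro set_eqI iffI)
    fix z assume "z \<in> ?G"
    then obtain p t where z: "z = ((p, t), N p t)" "p \<in> S" "t \<in> J" by auto
    interpret E: convex_embedding "\<Omega> t" "\<lambda>p. X p t" "D t" using embedding z by blast
    show "z \<in> (\<Inter>q\<in>S. ?R \<inter> ?\<phi> q -` {..0})"
    proof -
      have "X q t \<in> \<Omega> t" if "q \<in> S" for q
        using E.Y_frontier[OF that] E.K_facts(5) by blast
      then show ?thesis
        using z E.normal_support[OF z(2)] by auto
    qed
  next
    fix z assume z: "z \<in> (\<Inter>q\<in>S. ?R \<inter> ?\<phi> q -` {..0})"
    obtain p t n where zeq: "z = ((p, t), n)" by (metis prod.exhaust)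
    have pt: "p \<in> S" "t \<in> J" "norm n = 1" "\<And>q. q \<in> S \<Longrightarrow> n \<bullet> X q t \<le> n \<bullet> X p t"
      using z S_nonempty unfolding zeq by auto
    interpret E: convex_embedding "\<Omega> t" "\<lambda>p. X p t" "D t" using embedding pt by blast
    have "N p t = n" using E.normal_eqI pt by blast
    then show "z \<in> ?G" using pt zeq by auto
  qed
  have "closedin (top_of_set ?R) (\<Inter>q\<in>S. ?R \<inter> ?\<phi> q -` {..0})"
  proof (intro closedin_INT continuous_closedin_preimage continuous_intros)
  qed (auto simp: S_nonempty)
  then have "closedin (top_of_set ((S \<times> J) \<times> S)) ?G"
    unfolding G .
  moreover have "(\<lambda>(p, t). N p t) \<in> S \<times> J \<rightarrow> S"
  proof clarify
    fix p t assume "p \<in> S" "t \<in> J"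
    then interpret E: convex_embedding "\<Omega> t" "\<lambda>p. X p t" "D t" using embedding by blast
    show "N p t \<in> S" using E.normal_support(1)[OF \<open>p \<in> S\<close>] by simp
  qed
  ultimately show ?thesis
    using continuous_closed_graph_eq[OF compact_sphere] by blast
qed

lemma normal_speed_differentiable:
  assumes p: "p \<in> S" and t: "t \<in> J"
  shows "(\<lambda>(q, s). N q s) differentiable (at (p, t) within S \<times> J)"
    and "(\<lambda>(q, s). F (X q s) s) differentiable (at (p, t) within S \<times> J)"
proof -
  obtain U h h' where U: "open U" "(p, t) \<in> U"
    and h: "\<And>y. y \<in> U \<Longrightarrow> (h has_derivative h' y) (at y)"
    and h2: "\<And>y v. y \<in> U \<Longrightarrow> (\<lambda>y. h' y v) differentiable (at y)"
    and eq: "\<And>q s. q \<in> S \<Longrightarrow> s \<in> J \<Longrightarrow> (q, s) \<in> U \<Longrightarrow> h (q, s) = X q s"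
    using local_extension[OF p t] by metis
  let ?x = "(p, t)" and ?A = "S \<times> J"
  define k where "k b y = h' y (b, 0) - (fst y \<bullet> b) *\<^sub>R (\<Sum>j\<in>Basis. (fst y \<bullet> j) *\<^sub>R h' y (j, 0))"
    for b :: "real^'m" and y
  have lin: "linear (\<lambda>v. h' y (v, 0))" if "y \<in> U" for y
  proof -
    have "linear (h' y)" using h[OF that] has_derivative_linear by blast
    then have "linear (h' y \<circ> (\<lambda>v. (v, 0)))"
      by (intro linear_compose) (auto intro!: linearI)
    then show ?thesis by (simp add: comp_def)
  qed
  have slice: "((\<lambda>q. X q s) has_derivative (\<lambda>v. h' (q, s) (v, 0))) (at q within S)"
      "(X q has_vector_derivative h' (q, s) (0, 1)) (at s within J)"
    if "q \<in> S" "s \<in> J" "(q, s) \<in> U" for q s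
    using slice_derivative[OF U(1) that(3) h[OF that(3)] eq that(1,2)] by blast+
  have k_eq: "k b (q, s) = D s q (b - (q \<bullet> b) *\<^sub>R q)" if q: "q \<in> S" "s \<in> J" "(q, s) \<in> U" for b q s
  proof -
    have "q \<bullet> q = 1"
      using q(1) by (simp add: dot_square_norm)
    then have "D s q (b - (q \<bullet> b) *\<^sub>R q) = h' (q, s) (b - (q \<bullet> b) *\<^sub>R q, 0)"
      by (intro D_extension[OF slice(1)[OF q] q(1)]) (simp add: inner_diff_right)
    also have "\<dots> = h' (q, s) (b, 0) - (q \<bullet> b) *\<^sub>R h' (q, s) (q, 0)"
      using linear_diff[OF lin[OF q(3)]] linear_scale[OF lin[OF q(3)]] by simp
    also have "h' (q, s) (q, 0) = (\<Sum>j\<in>Basis. (q \<bullet> j) *\<^sub>R h' (q, s) (j, 0))"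
      using linear_sum[OF lin[OF q(3)], of "\<lambda>j. (q \<bullet> j) *\<^sub>R j" Basis]
      by (simp add: euclidean_representation linear_scale[OF lin[OF q(3)]])
    finally show ?thesis
      by (simp add: k_def)
  qed
  have N_unit: "norm (N q s) = 1" if "q \<in> S" "s \<in> J" for q s
    using convex_embedding.normal_support(1)[OF embedding] that by blast
  have orth: "N q s \<bullet> k b (q, s) = 0" if q: "q \<in> S" "s \<in> J" "(q, s) \<in> U" for b q s
  proof -
    interpret E: convex_embedding "\<Omega> s" "\<lambda>p. X p s" "D s" using embedding q by blast
    have "q \<bullet> q = 1"
      using q(1) by (simp add: dot_square_norm)
    then have "D s q (b - (q \<bullet> b) *\<^sub>R q) \<in> D s q ` {v. q \<bullet> v = 0}"
      by (intro imageI) (simp add: inner_diff_right)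
    then show ?thesis
      unfolding k_eq[OF q] using E.tangent_eq(2)[OF q(1)] by blast
  qed
  have ev: "\<forall>\<^sub>F y in at ?x within ?A. y \<in> U \<and> y \<in> ?A"
  proof (rule eventually_conj)
    show "\<forall>\<^sub>F y in at ?x within ?A. y \<in> U"
      by (rule topological_tendstoD[OF tendsto_ident_at U])
  qed (simp add: eventually_at_filter)
  have h2': "(\<lambda>y. h' y v) differentiable (at ?x within ?A)" for v
    using h2[OF U(2)] differentiable_at_withinI by blast
  have fst_diff: "(\<lambda>y. fst y \<bullet> b) differentiable (at ?x within ?A)" for b
    by (auto simp: differentiable_def intro!: derivative_eq_intros exI)
  let ?n = "\<lambda>(q, s). N q s"
  show N_diff: "?n differentiable (at ?x within ?A)"
  proof (rule unit_normal_differentiable[where B = Basis and k = k])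
    show "continuous (at ?x within ?A) ?n"
      using normal_continuous p t by (simp add: continuous_on_eq_continuous_within)
    show "?x \<in> ?A" using p t by simp
    show "norm (?n y) = 1" if "y \<in> ?A" for y
      using N_unit that by auto
    fix b :: "real^'m" assume "b \<in> Basis"
    show "k b differentiable (at ?x within ?A)"
      unfolding k_def [abs_def]
      by (intro differentiable_diff differentiable_scaleR differentiable_sum ballI h2' fst_diff) simp
    show "\<forall>\<^sub>F y in at ?x within ?A. ?n y \<bullet> k b y = 0"
      using ev by eventually_elim (use orth in auto)
    show "?n ?x \<bullet> k b ?x = 0"
      using orth p t U by simp
  next
    interpret E: convex_embedding "\<Omega> t" "\<lambda>p. X p t" "D t" using embedding t by blast
    let ?V = "span (insert (?n ?x) ((\<lambda>b. k b ?x) ` Basis))"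
    have pp: "p \<bullet> p = 1" "N p t \<bullet> N p t = 1"
      using p N_unit[OF p t] by (simp_all add: dot_square_norm)
    have D_in: "D t p v \<in> ?V" if v: "p \<bullet> v = 0" for v
    proof -
      have "v = (\<Sum>b\<in>Basis. (v \<bullet> b) *\<^sub>R b)"
        by (simp add: euclidean_representation)
      also have "\<dots> = (\<Sum>b\<in>Basis. (v \<bullet> b) *\<^sub>R (b - (p \<bullet> b) *\<^sub>R p)) + (\<Sum>b\<in>Basis. ((v \<bullet> b) * (p \<bullet> b)) *\<^sub>R p)"
        by (simp add: scaleR_diff_right sum_subtractf)
      also have "(\<Sum>b\<in>Basis. ((v \<bullet> b) * (p \<bullet> b)) *\<^sub>R p) = (v \<bullet> p) *\<^sub>R p"
        by (simp add: euclidean_inner[of v p] scaleR_left.sum)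
      finally have "v = (\<Sum>b\<in>Basis. (v \<bullet> b) *\<^sub>R (b - (p \<bullet> b) *\<^sub>R p))"
        using v by (simp add: inner_commute)
      then have "D t p v = D t p (\<Sum>b\<in>Basis. (v \<bullet> b) *\<^sub>R (b - (p \<bullet> b) *\<^sub>R p))"
        by simp
      also have "\<dots> = (\<Sum>b\<in>Basis. (v \<bullet> b) *\<^sub>R k b ?x)"
        by (simp add: linear_sum[OF E.linear_D[OF p]] linear_scale[OF E.linear_D[OF p]] k_eq[OF p t U(2)])
      finally have eq: "D t p v = (\<Sum>b\<in>Basis. (v \<bullet> b) *\<^sub>R k b ?x)" .
      show ?thesis
        unfolding eq by (intro span_sum span_scale span_base) auto
    qed
    have "y \<in> ?V" for y
    proof -
      have "y - (N p t \<bullet> y) *\<^sub>R N p t \<in> {v. N p t \<bullet> v = 0}"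
        by (simp add: inner_diff_right pp)
      then have "y - (N p t \<bullet> y) *\<^sub>R N p t \<in> D t p ` {v. p \<bullet> v = 0}"
        using E.tangent_eq(2)[OF p] by blast
      then have "y - (N p t \<bullet> y) *\<^sub>R N p t \<in> ?V"
        using D_in by (elim imageE) simp
      then have "(y - (N p t \<bullet> y) *\<^sub>R N p t) + (N p t \<bullet> y) *\<^sub>R ?n ?x \<in> ?V"
        by (intro span_add span_scale) (auto intro: span_base)
      then show ?thesis by simp
    qed
    then show "?V = UNIV" by blast
  qed
  have F_eq: "F (X q s) s = - (N q s \<bullet> h' (q, s) (0, 1))"
    if q: "q \<in> S" "s \<in> J" "(q, s) \<in> U" for q s
  proof -
    have "h' (q, s) (0, 1) = - F (X q s) s *\<^sub>R N q s"
      using vector_derivative_unique_within[OF at_within_Ico_neq_bot[OF q(2)] slice(2)[OF q] motion[OF q(2,1)]] .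
    then show ?thesis
      using N_unit[OF q(1,2)] by (simp add: dot_square_norm)
  qed
  obtain a b where ab: "(?n has_derivative a) (at ?x within ?A)"
    "((\<lambda>y. h' y (0, 1)) has_derivative b) (at ?x within ?A)"
    using N_diff h2'[of "(0, 1)"] unfolding differentiable_def by blast
  have *: "\<forall>\<^sub>F y in at ?x within ?A. - (?n y \<bullet> h' y (0, 1)) = (case y of (q, s) \<Rightarrow> F (X q s) s)"
    using ev by eventually_elim (use F_eq in auto)
  show "(\<lambda>(q, s). F (X q s) s) differentiable (at ?x within ?A)"
    using has_derivative_transform_eventually[OF has_derivative_minus[OF has_derivative_inner[OF ab]] *]
      F_eq[OF p t U(2)] p t by (auto simp: differentiable_def)
qed

lemma sphere_slice:
  assumes "((\<lambda>(q, s). g q s) has_derivative g') (at (p, t) within S \<times> J)" "t \<in> J"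
  shows "((\<lambda>q. g q t) has_derivative (\<lambda>v. g' (v, 0))) (at p within S)"
proof -
  have 1: "((\<lambda>q. (q, t)) has_derivative (\<lambda>v. (v, 0))) (at p within S)"
    by (auto intro!: derivative_eq_intros)
  have "((\<lambda>(q, s). g q s) has_derivative g') (at (p, t) within (\<lambda>q. (q, t)) ` S)"
    using assms by (auto intro: has_derivative_subset)
  from diff_chain_within[OF 1 this] show ?thesis
    by (simp add: comp_def)
qed

lemma along_slice:
  assumes g: "((\<lambda>(q, s). \<phi> s (X q s)) has_derivative g') (at (p, t) within S \<times> J)"
    and p: "p \<in> S" and t: "t \<in> J"
  shows "\<phi> t differentiable (at (X p t) within frontier (\<Omega> t))"
    and "p \<bullet> v = 0 \<Longrightarrow> along (frontier (\<Omega> t)) (\<phi> t) (X p t) (D t p v) = g' (v, 0)"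
  using convex_embedding.along_frontier[OF embedding[OF t] p sphere_slice[OF g t]] by blast+

definition curve :: "real \<Rightarrow> real^'m \<Rightarrow> real^'m \<Rightarrow> real \<Rightarrow> real^'m" where
  "curve t p v s = X (sphere_curve p v s) t"

definition curve_velocity :: "real \<Rightarrow> real^'m \<Rightarrow> real^'m \<Rightarrow> real \<Rightarrow> real^'m" where
  "curve_velocity t p v s = D t (sphere_curve p v s) (sphere_curve_velocity p v s)"

lemma curve_has_vector_derivative:
  assumes "p \<in> S" "t \<in> J" "p \<bullet> v = 0"
  shows "(curve t p v has_vector_derivative curve_velocity t p v s) (at s)"
proof -
  interpret E: convex_embedding "\<Omega> t" "\<lambda>p. X p t" "D t" using embedding assms by blast
  have "((\<lambda>q. X q t) has_derivative D t (sphere_curve p v s))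
      (at (sphere_curve p v s) within range (sphere_curve p v))"
    by (rule has_derivative_subset[OF E.deriv]) (use sphere_curve_in_sphere[OF assms(1,3)] in auto)
  from vector_derivative_diff_chain_within[OF sphere_curve_has_vector_derivative this]
  show ?thesis
    by (simp add: comp_def curve_def[abs_def] curve_velocity_def)
qed

lemma curve_velocity_tendsto:
  assumes p: "p \<in> S" and t: "t \<in> J" and v: "p \<bullet> v = 0"
  shows "(curve_velocity t p v \<longlongrightarrow> D t p v) (at 0)"
proof -
  let ?c = "sphere_curve p v" and ?c' = "sphere_curve_velocity p v"
  obtain U h h' where U: "open U" "(p, t) \<in> U"
    and h: "\<And>y. y \<in> U \<Longrightarrow> (h has_derivative h' y) (at y)"
    and h2: "\<And>y v. y \<in> U \<Longrightarrow> (\<lambda>y. h' y v) differentiable (at y)"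
    and eq: "\<And>q s. q \<in> S \<Longrightarrow> s \<in> J \<Longrightarrow> (q, s) \<in> U \<Longrightarrow> h (q, s) = X q s"
    using local_extension[OF p t] by metis
  have *: "D t (?c s) (?c' s) = (\<Sum>j\<in>Basis. (?c' s \<bullet> j) *\<^sub>R h' (?c s, t) (j, 0))" if "(?c s, t) \<in> U" for s
  proof -
    have c: "?c s \<in> S" by (rule sphere_curve_in_sphere[OF p v])
    note sl = slice_derivative(1)[OF U(1) that h[OF that] eq c t]
    have lin: "linear (\<lambda>w. h' (?c s, t) (w, 0))"
      using has_derivative_linear[OF sl] .
    have "D t (?c s) (?c' s) = h' (?c s, t) (?c' s, 0)"
      by (rule D_extension[OF sl c sphere_curve_velocity_orthogonal[OF p v]])
    also have "\<dots> = (\<Sum>j\<in>Basis. (?c' s \<bullet> j) *\<^sub>R h' (?c s, t) (j, 0))"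
      using linear_sum[OF lin, of "\<lambda>j. (?c' s \<bullet> j) *\<^sub>R j" Basis]
      by (simp add: euclidean_representation linear_scale[OF lin])
    finally show ?thesis .
  qed
  have c_lim: "(?c \<longlongrightarrow> p) (at 0)" "(?c' \<longlongrightarrow> v) (at 0)"
    using continuous_sphere_curve[of p v] continuous_sphere_curve_velocity[of p v]
    unfolding continuous_on_def by (metis UNIV_I sphere_curve_0 sphere_curve_velocity_0)+
  have pair: "((\<lambda>s. (?c s, t)) \<longlongrightarrow> (p, t)) (at 0)"
    by (intro tendsto_intros c_lim)
  have "((\<lambda>s. h' (?c s, t) (j, 0)) \<longlongrightarrow> h' (p, t) (j, 0)) (at 0)" for j
  proof -
    have "isCont (\<lambda>y. h' y (j, 0)) (p, t)"
      using differentiable_imp_continuous_within[OF h2[OF U(2), of "(j, 0)"]] by simp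
    from isCont_tendsto_compose[OF this pair] show ?thesis .
  qed
  then have "((\<lambda>s. \<Sum>j\<in>Basis. (?c' s \<bullet> j) *\<^sub>R h' (?c s, t) (j, 0)) \<longlongrightarrow>
      (\<Sum>j\<in>Basis. (v \<bullet> j) *\<^sub>R h' (p, t) (j, 0))) (at 0)"
    by (intro tendsto_intros c_lim)
  moreover have "(\<Sum>j\<in>Basis. (v \<bullet> j) *\<^sub>R h' (p, t) (j, 0)) = D t p v"
    using *[of 0] U(2) by simp
  moreover have "\<forall>\<^sub>F s in at 0. (?c s, t) \<in> U"
    by (rule topological_tendstoD[OF pair U])
  then have "\<forall>\<^sub>F s in at 0. (\<Sum>j\<in>Basis. (?c' s \<bullet> j) *\<^sub>R h' (?c s, t) (j, 0)) = curve_velocity t p v s"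
    by eventually_elim (simp add: * curve_velocity_def)
  ultimately show ?thesis
    using Lim_transform_eventually by fastforce
qed

lemma curve_normal:
  assumes p: "p \<in> S" and t: "t \<in> J" and v: "p \<bullet> v = 0"
  shows "N (sphere_curve p v s) t \<bullet> curve_velocity t p v s = 0"
    and "((\<lambda>s. N (sphere_curve p v s) t) has_vector_derivative
      along (frontier (\<Omega> t)) (outward_normal (\<Omega> t)) (X p t) (D t p v)) (at 0)"
proof -
  interpret E: convex_embedding "\<Omega> t" "\<lambda>p. X p t" "D t" using embedding t by blast
  show "N (sphere_curve p v s) t \<bullet> curve_velocity t p v s = 0"
    using E.tangent_eq(2)[OF sphere_curve_in_sphere[OF p v, of s]]
      sphere_curve_velocity_orthogonal[OF p v, of s]
    unfolding curve_velocity_def by blast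
  obtain g' where g': "((\<lambda>(q, s). N q s) has_derivative g') (at (p, t) within S \<times> J)"
    using normal_speed_differentiable(1)[OF p t] by (auto simp: differentiable_def)
  have "((\<lambda>q. N q t) has_derivative (\<lambda>v. g' (v, 0))) (at (sphere_curve p v 0) within range (sphere_curve p v))"
    unfolding sphere_curve_0
    by (rule has_derivative_subset[OF sphere_slice[OF g' t]])
      (use sphere_curve_in_sphere[OF p v] in auto)
  from vector_derivative_diff_chain_within[OF sphere_curve_has_vector_derivative this]
  have "((\<lambda>s. N (sphere_curve p v s) t) has_vector_derivative g' (v, 0)) (at 0)"
    by (simp add: comp_def)
  then show "((\<lambda>s. N (sphere_curve p v s) t) has_vector_derivative
      along (frontier (\<Omega> t)) (outward_normal (\<Omega> t)) (X p t) (D t p v)) (at 0)"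
    using along_slice(2)[OF g' p t v] by simp
qed

text \<open>Since \<open>N \<bullet> curve_velocity = 0\<close> along the curve, the derivative of the height over the
  tangent plane is \<open>(N p t - N (c s) t) \<bullet> curve_velocity t p v s\<close>, which is known to first order.\<close>

lemma curve_second_order:
  assumes p: "p \<in> S" and t: "t \<in> J" and v: "p \<bullet> v = 0"
  shows "((\<lambda>s. (N p t \<bullet> (curve t p v s - X p t)) / s\<^sup>2) \<longlongrightarrow>
    - second_ff (\<Omega> t) (X p t) (D t p v) (D t p v) / 2) (at 0)"
proof (rule lhopital)
  let ?n = "\<lambda>s. N (sphere_curve p v s) t"
  let ?f' = "\<lambda>s. N p t \<bullet> curve_velocity t p v s"
  have c_cont: "(curve t p v \<longlongrightarrow> X p t) (at 0)"
    using has_vector_derivative_continuous[OF curve_has_vector_derivative[OF p t v, of 0]]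
    by (simp add: isCont_def curve_def)
  show "((\<lambda>s. N p t \<bullet> (curve t p v s - X p t)) \<longlongrightarrow> 0) (at 0)"
    using tendsto_inner[OF tendsto_const[of "N p t"] tendsto_diff[OF c_cont tendsto_const[of "X p t"]]] by simp
  show "((\<lambda>s::real. s\<^sup>2) \<longlongrightarrow> 0) (at 0)"
    by (auto intro!: tendsto_eq_intros)
  show "\<forall>\<^sub>F s::real in at 0. s\<^sup>2 \<noteq> 0" "\<forall>\<^sub>F s::real in at 0. 2 * s \<noteq> 0"
    by (auto simp: eventually_at_filter)
  show "\<forall>\<^sub>F s in at 0. ((\<lambda>s. N p t \<bullet> (curve t p v s - X p t)) has_real_derivative ?f' s) (at s)"
  proof (intro always_eventually allI)
    fix s
    have "((\<lambda>s. curve t p v s - X p t) has_vector_derivative curve_velocity t p v s) (at s)"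
      using has_vector_derivative_diff[OF curve_has_vector_derivative[OF p t v, of s] has_vector_derivative_const]
      by simp
    from bounded_bilinear.has_vector_derivative[OF bounded_bilinear_inner has_vector_derivative_const this]
    show "((\<lambda>s. N p t \<bullet> (curve t p v s - X p t)) has_real_derivative ?f' s) (at s)"
      by (simp add: has_real_derivative_iff_has_vector_derivative)
  qed
  show "\<forall>\<^sub>F s in at 0. ((\<lambda>s::real. s\<^sup>2) has_real_derivative 2 * s) (at s)"
    by (auto intro!: always_eventually derivative_eq_intros)
  have "((\<lambda>s. (?n s - N p t) /\<^sub>R s) \<longlongrightarrow>
      along (frontier (\<Omega> t)) (outward_normal (\<Omega> t)) (X p t) (D t p v)) (at 0)"
    using has_vector_derivative_at_0_tendsto[OF curve_normal(2)[OF p t v]] by simp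
  then have "((\<lambda>s. - (((?n s - N p t) /\<^sub>R s) \<bullet> curve_velocity t p v s) / 2) \<longlongrightarrow>
      - (along (frontier (\<Omega> t)) (outward_normal (\<Omega> t)) (X p t) (D t p v) \<bullet> D t p v) / 2) (at 0)"
    by (intro tendsto_intros curve_velocity_tendsto[OF p t v]) simp_all
  moreover have "- (((?n s - N p t) /\<^sub>R s) \<bullet> curve_velocity t p v s) / 2 = ?f' s / (2 * s)" for s
    using curve_normal(1)[OF p t v, of s] by (simp add: inner_diff_left divide_simps)
  ultimately show "((\<lambda>s. ?f' s / (2 * s)) \<longlongrightarrow>
      - second_ff (\<Omega> t) (X p t) (D t p v) (D t p v) / 2) (at 0)"
    by (simp add: second_ff_def)
qed

lemma tangent_preimage:
  assumes "p \<in> S" "t \<in> J" "N p t \<bullet> \<xi> = 0"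
  obtains v where "p \<bullet> v = 0" "D t p v = \<xi>"
proof -
  interpret E: convex_embedding "\<Omega> t" "\<lambda>p. X p t" "D t" using embedding assms by blast
  have "\<xi> \<in> D t p ` {v. p \<bullet> v = 0}"
    using E.tangent_eq(2)[OF assms(1)] assms(3) by blast
  then show ?thesis using that by blast
qed

text \<open>The supporting half-spaces of \<open>\<Omega> d\<close> at the points of a boundary curve contain the
  combinations of boundary curves of \<open>\<Omega> a\<close> and \<open>\<Omega> b\<close>. When the three curves agree to
  first order, this compares their second order terms.\<close>

lemma second_ff_comparison:
  assumes p: "p0 \<in> S" "p1 \<in> S" "p2 \<in> S" and t: "d \<in> J" "a \<in> J" "b \<in> J"
    and normal: "N p1 a = N p0 d" "N p2 b = N p0 d"
    and pos: "X p0 d = (1 - l) *\<^sub>R X p1 a + l *\<^sub>R X p2 b"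
    and incl: "\<And>x y. x \<in> \<Omega> a \<Longrightarrow> y \<in> \<Omega> b \<Longrightarrow> (1 - l) *\<^sub>R x + l *\<^sub>R y \<in> \<Omega> d"
    and \<xi>: "N p0 d \<bullet> \<xi> = 0" "N p0 d \<bullet> \<eta> = 0"
  shows "second_ff (\<Omega> d) (X p0 d) ((1 - l) *\<^sub>R \<xi> + l *\<^sub>R \<eta>) ((1 - l) *\<^sub>R \<xi> + l *\<^sub>R \<eta>) \<le>
    (1 - l) * second_ff (\<Omega> a) (X p1 a) \<xi> \<xi> + l * second_ff (\<Omega> b) (X p2 b) \<eta> \<eta>"
proof -
  have "N p0 d \<bullet> ((1 - l) *\<^sub>R \<xi> + l *\<^sub>R \<eta>) = 0"
    by (simp add: \<xi> inner_add_right)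
  then obtain v0 where v0: "p0 \<bullet> v0 = 0" "D d p0 v0 = (1 - l) *\<^sub>R \<xi> + l *\<^sub>R \<eta>"
    using tangent_preimage[OF p(1) t(1)] by blast
  obtain v1 where v1: "p1 \<bullet> v1 = 0" "D a p1 v1 = \<xi>"
    using tangent_preimage[OF p(2) t(2)] \<xi> normal by metis
  obtain v2 where v2: "p2 \<bullet> v2 = 0" "D b p2 v2 = \<eta>"
    using tangent_preimage[OF p(3) t(3)] \<xi> normal by metis
  interpret E: convex_embedding "\<Omega> d" "\<lambda>p. X p d" "D d" using embedding t by blast
  interpret E1: convex_embedding "\<Omega> a" "\<lambda>p. X p a" "D a" using embedding t by blast
  interpret E2: convex_embedding "\<Omega> b" "\<lambda>p. X p b" "D b" using embedding t by blast
  let ?\<nu> = "N p0 d" and ?n = "\<lambda>s. N (sphere_curve p0 v0 s) d"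
  define e where "e s = (1 - l) *\<^sub>R curve a p1 v1 s + l *\<^sub>R curve b p2 v2 s - curve d p0 v0 s" for s
  define Q where "Q = ((1 - l) * second_ff (\<Omega> a) (X p1 a) \<xi> \<xi> + l * second_ff (\<Omega> b) (X p2 b) \<eta> \<eta>
      - second_ff (\<Omega> d) (X p0 d) (D d p0 v0) (D d p0 v0)) / 2"
  note s0 = curve_second_order[OF p(1) t(1) v0(1)]
  note s1 = curve_second_order[OF p(2) t(2) v1(1), unfolded normal v1]
  note s2 = curve_second_order[OF p(3) t(3) v2(1), unfolded normal v2]
  have "((\<lambda>s. (1 - l) * ((?\<nu> \<bullet> (curve a p1 v1 s - X p1 a)) / s\<^sup>2)
        + l * ((?\<nu> \<bullet> (curve b p2 v2 s - X p2 b)) / s\<^sup>2)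
        - (?\<nu> \<bullet> (curve d p0 v0 s - X p0 d)) / s\<^sup>2) \<longlongrightarrow>
      (1 - l) * (- second_ff (\<Omega> a) (X p1 a) \<xi> \<xi> / 2) + l * (- second_ff (\<Omega> b) (X p2 b) \<eta> \<eta> / 2)
        - (- second_ff (\<Omega> d) (X p0 d) (D d p0 v0) (D d p0 v0) / 2)) (at 0)"
    by (intro tendsto_intros s0 s1 s2)
  moreover have "(1 - l) * ((?\<nu> \<bullet> (curve a p1 v1 s - X p1 a)) / s\<^sup>2)
        + l * ((?\<nu> \<bullet> (curve b p2 v2 s - X p2 b)) / s\<^sup>2)
        - (?\<nu> \<bullet> (curve d p0 v0 s - X p0 d)) / s\<^sup>2 = (?\<nu> \<bullet> e s) / s\<^sup>2" for s
    unfolding e_def pos by (simp add: inner_add_right inner_diff_right add_divide_distrib diff_divide_distrib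
        algebra_simps)
  moreover have "(1 - l) * (- second_ff (\<Omega> a) (X p1 a) \<xi> \<xi> / 2) + l * (- second_ff (\<Omega> b) (X p2 b) \<eta> \<eta> / 2)
        - (- second_ff (\<Omega> d) (X p0 d) (D d p0 v0) (D d p0 v0) / 2) = - Q"
    by (simp add: Q_def field_simps)
  ultimately have lim1: "((\<lambda>s. (?\<nu> \<bullet> e s) / s\<^sup>2) \<longlongrightarrow> - Q) (at 0)"
    by simp
  have e0: "e 0 = 0"
    by (simp add: e_def curve_def pos)
  have "(e has_vector_derivative (1 - l) *\<^sub>R curve_velocity a p1 v1 0 + l *\<^sub>R curve_velocity b p2 v2 0
      - curve_velocity d p0 v0 0) (at 0)"
    unfolding e_def [abs_def]
    by (intro has_vector_derivative_diff has_vector_derivative_add curve_has_vector_derivative p t v0 v1 v2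
        bounded_linear.has_vector_derivative[OF bounded_linear_scaleR_right])
  then have "(e has_vector_derivative 0) (at 0)"
    by (simp add: curve_velocity_def v0 v1 v2)
  then have lim2: "((\<lambda>s. (e s - e 0) /\<^sub>R s) \<longlongrightarrow> 0) (at 0)"
    by (rule has_vector_derivative_at_0_tendsto)
  have lim3: "((\<lambda>s. (?n s - ?\<nu>) /\<^sub>R s) \<longlongrightarrow>
      along (frontier (\<Omega> d)) (outward_normal (\<Omega> d)) (X p0 d) (D d p0 v0)) (at 0)"
    using has_vector_derivative_at_0_tendsto[OF curve_normal(2)[OF p(1) t(1) v0(1)]] by simp
  have lim: "((\<lambda>s. (?\<nu> \<bullet> e s) / s\<^sup>2 + ((?n s - ?\<nu>) /\<^sub>R s) \<bullet> ((e s - e 0) /\<^sub>R s)) \<longlongrightarrow> - Q) (at 0)"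
    using tendsto_add[OF lim1 tendsto_inner[OF lim3 lim2]] by simp
  have eq: "(?\<nu> \<bullet> e s) / s\<^sup>2 + ((?n s - ?\<nu>) /\<^sub>R s) \<bullet> ((e s - e 0) /\<^sub>R s) = (?n s \<bullet> e s) / s\<^sup>2" for s
    by (simp add: e0 inner_diff_left power2_eq_square divide_inverse algebra_simps)
  have "?n s \<bullet> e s \<le> 0" for s
  proof -
    have c: "sphere_curve p0 v0 s \<in> S" "sphere_curve p1 v1 s \<in> S" "sphere_curve p2 v2 s \<in> S"
      using sphere_curve_in_sphere p v0 v1 v2 by blast+
    have "curve a p1 v1 s \<in> \<Omega> a" "curve b p2 v2 s \<in> \<Omega> b"
      using E1.Y_frontier[OF c(2)] E1.K_facts(5) E2.Y_frontier[OF c(3)] E2.K_facts(5)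
      by (auto simp: curve_def)
    from E.normal_support(2)[OF c(1) incl[OF this]]
    show ?thesis
      by (simp add: e_def curve_def inner_diff_right)
  qed
  then have "(?\<nu> \<bullet> e s) / s\<^sup>2 + ((?n s - ?\<nu>) /\<^sub>R s) \<bullet> ((e s - e 0) /\<^sub>R s) \<le> 0" for s
    unfolding eq by (simp add: divide_le_0_iff)
  then have "- Q \<le> 0"
    by (intro tendsto_upperbound[OF lim]) auto
  then show ?thesis
    by (simp add: Q_def v0)
qed

lemma speed_pos:
  assumes "p \<in> S" "t \<in> J"
  shows "0 < F (X p t) t"
proof -
  interpret E: convex_embedding "\<Omega> t" "\<lambda>p. X p t" "D t" using embedding assms by blast
  obtain e :: "'n \<Rightarrow> real^'m" where e: "\<And>i. N p t \<bullet> e i = 0" "\<And>i j. e i \<bullet> e j = (if i = j then 1 else 0)"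
    using orthonormal_frame_exists[OF E.normal_support(1)[OF assms(1)] dim] by metis
  then have fr: "orthonormal_frame (frontier (\<Omega> t)) (X p t) e"
    using E.tangent_eq(1)[OF assms(1)] unfolding orthonormal_frame_def by blast
  have "0 < f (N p t) (second_ff_matrix (\<Omega> t) (X p t) e)"
    using speed speed_frame(1)[OF assms(2) E.Y_frontier[OF assms(1)] fr] E.normal_support(1)[OF assms(1)]
    unfolding admissible_speed_def by auto
  then show ?thesis
    using speed_frame(2)[OF assms(2) E.Y_frontier[OF assms(1)] fr] by simp
qed

lemma touching_speeds:
  assumes p: "p0 \<in> S" "p1 \<in> S" "p2 \<in> S" and t: "d \<in> J" "a \<in> J" "b \<in> J"
    and normal: "N p1 a = N p0 d" "N p2 b = N p0 d"
    and pos: "X p0 d = (1 - l) *\<^sub>R X p1 a + l *\<^sub>R X p2 b" and l: "0 \<le> l" "l \<le> 1"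
    and incl: "\<And>x y. x \<in> \<Omega> a \<Longrightarrow> y \<in> \<Omega> b \<Longrightarrow> (1 - l) *\<^sub>R x + l *\<^sub>R y \<in> \<Omega> d"
  shows "(1 - l) * F (X p1 a) a powr (- 1 / \<alpha>) + l * F (X p2 b) b powr (- 1 / \<alpha>) \<le>
    F (X p0 d) d powr (- 1 / \<alpha>)"
proof -
  interpret E: convex_embedding "\<Omega> d" "\<lambda>p. X p d" "D d" using embedding t by blast
  let ?\<nu> = "N p0 d"
  obtain e :: "'n \<Rightarrow> real^'m" where e: "\<And>i. ?\<nu> \<bullet> e i = 0" "\<And>i j. e i \<bullet> e j = (if i = j then 1 else 0)"
    using orthonormal_frame_exists[OF E.normal_support(1)[OF p(1)] dim] by metis
  define A where "A q s = second_ff_matrix (\<Omega> s) (X q s) e" for q s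
  have nu: "?\<nu> \<in> S"
    using E.normal_support(1)[OF p(1)] by simp
  have *: "A q s \<in> Gamma_plus" "F (X q s) s powr (- 1 / \<alpha>) = 1 / f ?\<nu> (A q s)"
      "second_ff (\<Omega> s) (X q s) (\<Sum>i\<in>UNIV. \<xi> $ i *\<^sub>R e i) (\<Sum>i\<in>UNIV. \<xi> $ i *\<^sub>R e i) = \<xi> \<bullet> (A q s *v \<xi>)"
    if q: "q \<in> S" "s \<in> J" "N q s = ?\<nu>" for q s \<xi>
  proof -
    interpret E1: convex_embedding "\<Omega> s" "\<lambda>p. X p s" "D s" using embedding q by blast
    have fr: "orthonormal_frame (frontier (\<Omega> s)) (X q s) e"
      using E1.tangent_eq(1)[OF q(1)] e unfolding orthonormal_frame_def q(3) by blast
    show G: "A q s \<in> Gamma_plus"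
      unfolding A_def by (rule speed_frame(1)[OF q(2) E1.Y_frontier[OF q(1)] fr])
    have "0 < f ?\<nu> (A q s)"
      using speed G nu unfolding admissible_speed_def by blast
    moreover have "F (X q s) s = f ?\<nu> (A q s) powr \<alpha>"
      using speed_frame(2)[OF q(2) E1.Y_frontier[OF q(1)] fr] by (simp add: A_def q(3))
    ultimately show "F (X q s) s powr (- 1 / \<alpha>) = 1 / f ?\<nu> (A q s)"
      using alpha by (simp add: powr_powr powr_minus_divide)
    obtain g' where "((\<lambda>(q, s). N q s) has_derivative g') (at (q, s) within S \<times> J)"
      using normal_speed_differentiable(1)[OF q(1,2)] by (auto simp: differentiable_def)
    from along_slice(1)[OF this q(1,2)]
    have "linear (along (frontier (\<Omega> s)) (outward_normal (\<Omega> s)) (X q s))"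
      unfolding along_def [abs_def] by (rule linear_frechet_derivative)
    from second_ff_frame[OF this]
    show "second_ff (\<Omega> s) (X q s) (\<Sum>i\<in>UNIV. \<xi> $ i *\<^sub>R e i) (\<Sum>i\<in>UNIV. \<xi> $ i *\<^sub>R e i) = \<xi> \<bullet> (A q s *v \<xi>)"
      by (simp add: A_def)
  qed
  have "((1 - l) *\<^sub>R \<xi> + l *\<^sub>R \<eta>) \<bullet> (A p0 d *v ((1 - l) *\<^sub>R \<xi> + l *\<^sub>R \<eta>)) \<le>
        (1 - l) * (\<xi> \<bullet> (A p1 a *v \<xi>)) + l * (\<eta> \<bullet> (A p2 b *v \<eta>))" for \<xi> \<eta>
  proof -
    let ?c = "\<lambda>\<xi>. \<Sum>i\<in>UNIV. \<xi> $ i *\<^sub>R e i"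
    have orth: "?\<nu> \<bullet> ?c \<xi> = 0" for \<xi>
      by (simp add: inner_sum_right e)
    have "?c ((1 - l) *\<^sub>R \<xi> + l *\<^sub>R \<eta>) = (1 - l) *\<^sub>R ?c \<xi> + l *\<^sub>R ?c \<eta>"
      by (simp add: scaleR_sum_right scaleR_add_left sum.distrib)
    then show ?thesis
      using second_ff_comparison[OF p t normal pos incl orth orth, of \<xi> \<eta>]
        *(3)[OF p(1) t(1) refl, of "(1 - l) *\<^sub>R \<xi> + l *\<^sub>R \<eta>"]
        *(3)[OF p(2) t(2) normal(1), of \<xi>] *(3)[OF p(3) t(3) normal(2), of \<eta>] by simp
  qed
  from inverse_concave_comparison[OF speed nu *(1)[OF p(1) t(1) refl] *(1)[OF p(2) t(2) normal(1)]
      *(1)[OF p(3) t(3) normal(2)] l this]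
  show ?thesis
    using *(2)[OF p(1) t(1) refl] *(2)[OF p(2) t(2) normal(1)] *(2)[OF p(3) t(3) normal(2)] by simp
qed

lemma time_derivative:
  assumes g: "((\<lambda>(q, s). g q s :: real) has_derivative g') (at (p, t) within S \<times> J)"
    and p: "p \<in> S" and t: "t\<^sub>0 < t" "t < T"
  shows "((\<lambda>s. g p s) has_real_derivative g' (0, 1)) (at t)"
proof -
  have 1: "((\<lambda>s. (p, s)) has_derivative (\<lambda>s. (0, s))) (at t within {t\<^sub>0<..<T})"
    by (auto intro!: derivative_eq_intros)
  have "((\<lambda>(q, s). g q s) has_derivative g') (at (p, t) within (\<lambda>s. (p, s)) ` {t\<^sub>0<..<T})"
    by (rule has_derivative_subset[OF g]) (use p in auto)
  from diff_chain_within[OF 1 this]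
  have "((\<lambda>s. g p s) has_derivative (\<lambda>s. g' (0, s))) (at t within {t\<^sub>0<..<T})"
    by (simp add: comp_def)
  moreover have "at t within {t\<^sub>0<..<T} = at t"
    by (rule at_within_open) (use t in auto)
  moreover have "g' (0, s) = g' (0, 1) * s" for s
    using linear_scale[OF has_derivative_linear[OF g], of s "(0, 1)"] by simp
  ultimately show ?thesis
    unfolding has_field_derivative_def by (metis (no_types, lifting) ext)
qed

lemma curve_pair_derivative:
  assumes g: "((\<lambda>(q, s). g q s) has_derivative g') (at (p, t) within S \<times> J)"
    and p: "p \<in> S" and t: "t\<^sub>0 < t" "t < T" and v: "p \<bullet> v = 0"
  shows "((\<lambda>x. g (sphere_curve p v (fst x)) (t + snd x)) has_derivative (\<lambda>h. g' (fst h *\<^sub>R v, snd h))) (at (0, 0))"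
proof -
  let ?B = "UNIV \<times> {t\<^sub>0 - t<..<T - t}"
  let ?M = "\<lambda>x. (sphere_curve p v (fst x), t + snd x)"
  have B: "open ?B" "(0, 0) \<in> ?B"
    using t by (auto intro: open_Times)
  have c: "(sphere_curve p v has_derivative (\<lambda>s. s *\<^sub>R v)) (at 0)"
    using sphere_curve_has_vector_derivative[of p v 0] by (simp add: has_vector_derivative_def)
  have "(fst has_derivative fst) (at (0 :: real, 0 :: real) within ?B)"
    using bounded_linear_fst by (rule bounded_linear_imp_has_derivative)
  from has_derivative_compose[OF this, of "sphere_curve p v" "\<lambda>s. s *\<^sub>R v"]
  have "((\<lambda>x. sphere_curve p v (fst x)) has_derivative (\<lambda>h. fst h *\<^sub>R v)) (at (0, 0) within ?B)"
    using c by simp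
  moreover have "((\<lambda>x. t + snd x) has_derivative snd) (at (0 :: real, 0 :: real) within ?B)"
    by (auto intro!: derivative_eq_intros)
  ultimately have M: "(?M has_derivative (\<lambda>h. (fst h *\<^sub>R v, snd h))) (at (0, 0) within ?B)"
    by (rule has_derivative_Pair)
  have "((\<lambda>(q, s). g q s) has_derivative g') (at (?M (0, 0)) within ?M ` ?B)"
    by (rule has_derivative_subset[of _ _ _ "S \<times> J"])
      (use g sphere_curve_in_sphere[OF p v] in auto)
  from diff_chain_within[OF M this] show ?thesis
    unfolding at_within_open[OF B(2,1)] by (simp add: comp_def)
qed

text \<open>The time variation of the height over the tangent plane is \<open>- F * (N p t \<bullet> N)\<close>, and
  \<open>N p t \<bullet> N\<close> is stationary at the base point.\<close>

lemma boundary_second_order: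
  assumes p: "p \<in> S" and t: "t\<^sub>0 < t" "t < T" and v: "p \<bullet> v = 0"
  shows "((\<lambda>r. (N p t \<bullet> (X (sphere_curve p v r) (t + r) - X p t) + r * F (X p t) t) / r\<^sup>2)
    \<longlongrightarrow> - Harnack_quantity \<Omega> X F p t (D t p v) / 2) (at 0)"
proof -
  have tJ: "t \<in> J" using t by simp
  let ?\<nu> = "N p t" and ?F0 = "F (X p t) t" and ?c = "sphere_curve p v"
  have c: "?c r \<in> S" for r
    by (rule sphere_curve_in_sphere[OF p v])
  have unit: "N q s \<bullet> N q s = 1" if "q \<in> S" "s \<in> J" for q s
    using convex_embedding.normal_support(1)[OF embedding[OF that(2)] that(1)] by (simp add: dot_square_norm)
  obtain n' where n': "((\<lambda>(q, s). N q s) has_derivative n') (at (p, t) within S \<times> J)"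
    using normal_speed_differentiable(1)[OF p tJ] by (auto simp: differentiable_def)
  obtain \<phi> where \<phi>: "((\<lambda>(q, s). F (X q s) s) has_derivative \<phi>) (at (p, t) within S \<times> J)"
    using normal_speed_differentiable(2)[OF p tJ] by (auto simp: differentiable_def)
  define f1 f2 where "f1 = \<phi> (v, 0)" and "f2 = \<phi> (0, 1)"
  have f1: "along (frontier (\<Omega> t)) (\<lambda>x. F x t) (X p t) (D t p v) = f1"
    using along_slice(2)[where \<phi> = "\<lambda>s x. F x s", OF \<phi> p tJ v] by (simp add: f1_def)
  have f2: "deriv (\<lambda>s. F (X p s) s) t = f2"
    using DERIV_imp_deriv[OF time_derivative[OF \<phi> p t]] by (simp add: f2_def)
  have n_diff: "((\<lambda>x. N (?c (fst x)) (t + snd x)) has_derivative (\<lambda>h. n' (fst h *\<^sub>R v, snd h))) (at (0, 0))"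
    by (rule curve_pair_derivative[OF n' p t v])
  have \<phi>_diff: "((\<lambda>x. F (X (?c (fst x)) (t + snd x)) (t + snd x)) has_derivative
      (\<lambda>h. \<phi> (fst h *\<^sub>R v, snd h))) (at (0, 0))"
    by (rule curve_pair_derivative[OF \<phi> p t v])
  have orth: "?\<nu> \<bullet> n' (\<theta> *\<^sub>R v, r) = 0" for \<theta> r
  proof -
    have d1: "((\<lambda>x. N (?c (fst x)) (t + snd x) \<bullet> N (?c (fst x)) (t + snd x)) has_derivative
        (\<lambda>h. 2 * (?\<nu> \<bullet> n' (fst h *\<^sub>R v, snd h)))) (at (0, 0))"
      using has_derivative_inner[OF n_diff n_diff] by (simp add: inner_commute)
    have "open (UNIV \<times> {t\<^sub>0 - t<..<T - t} :: (real \<times> real) set)"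
      by (intro open_Times) auto
    then have "((\<lambda>x. 1 :: real) has_derivative (\<lambda>h. 2 * (?\<nu> \<bullet> n' (fst h *\<^sub>R v, snd h)))) (at (0, 0))"
      by (rule has_derivative_transform_within_open[OF d1]) (use t unit[OF c] in auto)
    then have "(\<lambda>h. 2 * (?\<nu> \<bullet> n' (fst h *\<^sub>R v, snd h))) = (\<lambda>h. 0)"
      by (rule has_derivative_unique[OF _ has_derivative_const])
    from fun_cong[OF this, of "(\<theta>, r)"] show ?thesis
      by simp
  qed
  define \<Psi> where "\<Psi> x = F (X (?c (fst x)) (t + snd x)) (t + snd x) * (?\<nu> \<bullet> N (?c (fst x)) (t + snd x))" for x
  have lin: "\<phi> (\<theta> *\<^sub>R v, r) = \<theta> * f1 + r * f2" for \<theta> r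
  proof -
    have "linear \<phi>" using \<phi> has_derivative_linear by blast
    moreover have "(\<theta> *\<^sub>R v, r) = \<theta> *\<^sub>R (v, 0) + r *\<^sub>R (0, 1)" by simp
    ultimately show ?thesis
      unfolding f1_def f2_def by (simp only: linear_add linear_scale real_scaleR_def)
  qed
  have \<Psi>_diff: "(\<Psi> has_derivative (\<lambda>h. fst h * f1 + snd h * f2)) (at (0, 0))"
    unfolding \<Psi>_def [abs_def]
    using has_derivative_mult[OF \<phi>_diff has_derivative_inner_right[OF n_diff, of ?\<nu>]]
    by (simp add: orth lin unit[OF p tJ])
  have \<Psi>0: "\<Psi> (0, 0) = ?F0"
    by (simp add: \<Psi>_def unit[OF p tJ])
  define G where "G \<theta> r = ?\<nu> \<bullet> X (?c \<theta>) (t + r)" for \<theta> r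
  have G_deriv: "((\<lambda>r. G \<theta> r) has_real_derivative - \<Psi> (\<theta>, r)) (at r)"
    if r: "t\<^sub>0 < t + r" "t + r < T" for \<theta> r
  proof -
    have "(X (?c \<theta>) has_vector_derivative - F (X (?c \<theta>) (t + r)) (t + r) *\<^sub>R N (?c \<theta>) (t + r)) (at (t + r))"
      using motion[of "t + r" "?c \<theta>"] c r at_within_interior[of "t + r" J] by simp
    then have "((\<lambda>r. X (?c \<theta>) (t + r)) has_vector_derivative - F (X (?c \<theta>) (t + r)) (t + r) *\<^sub>R N (?c \<theta>) (t + r)) (at r)"
    proof -
      have "((\<lambda>r. t + r) has_vector_derivative 1) (at r)"
        unfolding has_real_derivative_iff_has_vector_derivative[symmetric]
        by (auto intro!: derivative_eq_intros)
      from vector_diff_chain_at[OF this, of "X (?c \<theta>)"] \<open>(X (?c \<theta>) has_vector_derivative _) _\<close>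
      show ?thesis by (simp add: comp_def)
    qed
    from bounded_bilinear.has_vector_derivative[OF bounded_bilinear_inner has_vector_derivative_const[of ?\<nu>] this]
    show ?thesis
      by (simp add: G_def \<Psi>_def has_real_derivative_iff_has_vector_derivative)
  qed
  have lim1: "((\<lambda>r. (G r r - G r 0 + r * ?F0) / r\<^sup>2) \<longlongrightarrow> - (f1 + f2 / 2)) (at 0)"
    unfolding tendsto_iff
  proof (intro allI impI)
    fix e :: real assume e: "e > 0"
    obtain d0 where d0: "d0 > 0" "\<And>y. norm (y - (0, 0)) < d0 \<Longrightarrow>
        norm (\<Psi> y - \<Psi> (0, 0) - (fst (y - (0, 0)) * f1 + snd (y - (0, 0)) * f2)) \<le> e / 4 * norm (y - (0, 0))"
      using \<Psi>_diff[unfolded has_derivative_at_alt, THEN conjunct2, rule_format, of "e / 4"] e by auto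
    define d where "d = min (d0 / 2) (min (t - t\<^sub>0) (T - t))"
    have d: "d > 0" using d0(1) t by (simp add: d_def)
    have "dist ((G r r - G r 0 + r * ?F0) / r\<^sup>2) (- (f1 + f2 / 2)) < e" if r: "r \<noteq> 0" "\<bar>r\<bar> < d" for r
    proof -
      define H where "H \<rho> = G r \<rho> - G r 0 + \<rho> * ?F0 + \<rho> * r * f1 + \<rho>\<^sup>2 / 2 * f2" for \<rho>
      have H': "(H has_real_derivative (- \<Psi> (r, \<rho>) + ?F0 + r * f1 + \<rho> * f2)) (at \<rho>)" if "\<bar>\<rho>\<bar> \<le> \<bar>r\<bar>" for \<rho>
      proof -
        have "(G r has_real_derivative - \<Psi> (r, \<rho>)) (at \<rho>)"
          by (rule G_deriv) (use that r in \<open>auto simp: d_def\<close>)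
        then show ?thesis
          unfolding H_def [abs_def] by (auto intro!: derivative_eq_intros)
      qed
      have bound: "\<bar>- \<Psi> (r, \<rho>) + ?F0 + r * f1 + \<rho> * f2\<bar> \<le> e / 2 * \<bar>r\<bar>" if "\<bar>\<rho>\<bar> \<le> \<bar>r\<bar>" for \<rho>
      proof -
        have nrm: "norm (r, \<rho>) \<le> 2 * \<bar>r\<bar>"
          using norm_Pair_le[of r \<rho>] that by simp
        then have "norm ((r, \<rho>) - (0, 0)) < d0"
          using r by (simp add: d_def)
        from d0(2)[OF this] have "\<bar>\<Psi> (r, \<rho>) - ?F0 - (r * f1 + \<rho> * f2)\<bar> \<le> e / 4 * norm (r, \<rho>)"
          by (simp add: \<Psi>0)
        also have "\<dots> \<le> e / 4 * (2 * \<bar>r\<bar>)"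
          using e nrm by (intro mult_left_mono) auto
        finally show ?thesis by (simp add: abs_minus_commute algebra_simps)
      qed
      have "\<bar>H r - H 0\<bar> \<le> e / 2 * \<bar>r\<bar> * \<bar>r - 0\<bar>"
      proof -
        let ?I = "{- \<bar>r\<bar>..\<bar>r\<bar>}"
        have "norm (H r - H 0) \<le> (e / 2 * \<bar>r\<bar>) * norm (r - 0)"
        proof (rule field_differentiable_bound[where S = ?I and f' = "\<lambda>\<rho>. - \<Psi> (r, \<rho>) + ?F0 + r * f1 + \<rho> * f2"])
          show "(H has_real_derivative (- \<Psi> (r, \<rho>) + ?F0 + r * f1 + \<rho> * f2)) (at \<rho> within ?I)" if "\<rho> \<in> ?I" for \<rho>
            by (rule has_field_derivative_at_within[OF H']) (use that in auto)
          show "norm (- \<Psi> (r, \<rho>) + ?F0 + r * f1 + \<rho> * f2) \<le> e / 2 * \<bar>r\<bar>" if "\<rho> \<in> ?I" for \<rho>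
            unfolding real_norm_def by (rule bound) (use that in auto)
        qed auto
        then show ?thesis by simp
      qed
      then have "\<bar>H r\<bar> \<le> e / 2 * r\<^sup>2"
        by (simp add: H_def power2_eq_square)
      moreover have "(G r r - G r 0 + r * ?F0) / r\<^sup>2 - (- (f1 + f2 / 2)) = H r / r\<^sup>2"
        using r(1) by (simp add: H_def field_simps power2_eq_square)
      ultimately have "\<bar>(G r r - G r 0 + r * ?F0) / r\<^sup>2 - (- (f1 + f2 / 2))\<bar> \<le> e / 2"
        using r(1) by (simp add: divide_le_eq)
      then show ?thesis
        using e by (simp add: dist_real_def)
    qed
    then show "\<forall>\<^sub>F r in at 0. dist ((G r r - G r 0 + r * ?F0) / r\<^sup>2) (- (f1 + f2 / 2)) < e"
      unfolding eventually_at using d by (intro exI[of _ d]) (auto simp: dist_real_def)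
  qed
  have eq: "(G r r - G r 0 + r * ?F0) / r\<^sup>2 + (?\<nu> \<bullet> (curve t p v r - X p t)) / r\<^sup>2 =
      (?\<nu> \<bullet> (X (?c r) (t + r) - X p t) + r * ?F0) / r\<^sup>2" for r
    by (simp add: G_def curve_def inner_diff_right flip: add_divide_distrib)
  have val: "- (f1 + f2 / 2) + - second_ff (\<Omega> t) (X p t) (D t p v) (D t p v) / 2 =
      - Harnack_quantity \<Omega> X F p t (D t p v) / 2"
    by (simp add: Harnack_quantity_def f1 f2 field_simps)
  show ?thesis
    using tendsto_add[OF lim1 curve_second_order[OF p tJ v]] unfolding eq val .
qed


section \<open>Nested bodies and the arrival time\<close>

lemma boundary_point:
  assumes "p \<in> S" "t \<in> J"
  shows "X p t \<in> frontier (\<Omega> t)" "X p t \<in> \<Omega> t"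
proof -
  interpret E: convex_embedding "\<Omega> t" "\<lambda>p. X p t" "D t" using embedding assms by blast
  show "X p t \<in> frontier (\<Omega> t)" "X p t \<in> \<Omega> t"
    using E.Y_frontier[OF assms(1)] E.K_facts(5) by blast+
qed

lemma frontier_point:
  assumes "x \<in> frontier (\<Omega> t)" "t \<in> J"
  obtains p where "p \<in> S" "x = X p t"
proof -
  interpret E: convex_embedding "\<Omega> t" "\<lambda>p. X p t" "D t" using embedding assms by blast
  show ?thesis
    using assms(1) that unfolding E.Y_image[symmetric] by blast
qed

lemma body_facts:
  assumes "t \<in> J"
  shows "compact (\<Omega> t)" "closed (\<Omega> t)" "convex (\<Omega> t)" "interior (\<Omega> t) \<noteq> {}" "frontier (\<Omega> t) \<subseteq> \<Omega> t"
  using convex_embedding.K_facts[OF embedding[OF assms]] by blast+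

lemma mem_iff_halfspaces:
  assumes "t \<in> J"
  shows "x \<in> \<Omega> t \<longleftrightarrow> (\<forall>n. norm n = 1 \<longrightarrow> (\<exists>q\<in>S. n \<bullet> x \<le> n \<bullet> X q t))"
  by (rule convex_embedding.mem_iff_halfspaces[OF embedding[OF assms]])

lemma support_decreasing:
  assumes st: "s \<in> J" "t \<in> J" "s < t" and n: "norm n = 1"
  obtains q where "q \<in> S" "\<And>p. p \<in> S \<Longrightarrow> n \<bullet> X p t < n \<bullet> X q s"
proof -
  let ?C = "S \<times> {s..t}" and ?g = "\<lambda>(p, \<tau>). n \<bullet> X p \<tau>"
  have sub: "{s..t} \<subseteq> J"
    using st by auto
  have cont: "continuous_on ?C ?g"
    unfolding case_prod_unfold by (intro continuous_intros) (use sub in auto)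
  have early: "snd m = s" if m: "m \<in> ?C" "\<forall>y\<in>?C. ?g y \<le> ?g m" for m
  proof (rule ccontr)
    obtain q \<tau> where m_eq: "m = (q, \<tau>)" by fastforce
    assume "snd m \<noteq> s"
    then have \<tau>: "s < \<tau>" "\<tau> \<le> t" "q \<in> S" "\<tau> \<in> J"
      using m sub by (auto simp: m_eq)
    interpret E: convex_embedding "\<Omega> \<tau>" "\<lambda>p. X p \<tau>" "D \<tau>" using embedding \<tau> by blast
    have "N q \<tau> = n"
      by (rule E.normal_eqI[OF \<tau>(3) n]) (use m \<tau> in \<open>auto simp: m_eq\<close>)
    then have nn: "n \<bullet> N q \<tau> = 1"
      using n by (simp add: dot_square_norm)
    have "((\<lambda>\<sigma>. n \<bullet> X q \<sigma>) has_real_derivative - F (X q \<tau>) \<tau>) (at \<tau> within J)"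
      using bounded_bilinear.has_vector_derivative[OF bounded_bilinear_inner
          has_vector_derivative_const[of n] motion[OF \<tau>(4,3)]]
      by (simp add: has_real_derivative_iff_has_vector_derivative nn)
    from has_real_derivative_neg_dec_left[OF this]
    obtain d where d: "d > 0" "\<And>h. h > 0 \<Longrightarrow> \<tau> - h \<in> J \<Longrightarrow> h < d \<Longrightarrow> n \<bullet> X q \<tau> < n \<bullet> X q (\<tau> - h)"
      using speed_pos[OF \<tau>(3,4)] by auto
    define h where "h = min (d / 2) (\<tau> - s)"
    have h: "h > 0" "h < d" "\<tau> - h \<in> {s..t}"
      using d(1) \<tau> by (auto simp: h_def min_def)
    then have "n \<bullet> X q \<tau> < n \<bullet> X q (\<tau> - h)"
      using d(2) sub by blast
    moreover have "?g (q, \<tau> - h) \<le> ?g m"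
      using m(2) h(3) \<tau>(3) by blast
    ultimately show False
      by (simp add: m_eq)
  qed
  have "?C \<noteq> {}" "compact ?C"
    using S_nonempty st by (auto intro!: compact_Times)
  then obtain m where m: "m \<in> ?C" "\<forall>y\<in>?C. ?g y \<le> ?g m"
    using continuous_attains_sup[OF _ _ cont] by blast
  then obtain q where q: "m = (q, s)" "q \<in> S"
    using early[OF m] by force
  show ?thesis
  proof (rule that[OF q(2)])
    fix p assume p: "p \<in> S"
    then have pt: "(p, t) \<in> ?C" using st by auto
    have "?g (p, t) \<noteq> ?g m"
      using early[OF pt] m(2) st(3) by (metis less_irrefl snd_conv)
    then have "?g (p, t) < ?g m"
      using m(2) pt by (metis order_less_le)
    then show "n \<bullet> X p t < n \<bullet> X q s"
      by (simp add: q)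
  qed
qed

lemma nested_interior:
  assumes st: "s \<in> J" "t \<in> J" "s < t"
  shows "\<Omega> t \<subseteq> interior (\<Omega> s)"
proof
  fix x assume x: "x \<in> \<Omega> t"
  have upper: "\<exists>q\<in>S. n \<bullet> x < n \<bullet> X q s" if n: "norm n = 1" for n
  proof -
    obtain q where q: "q \<in> S" "\<And>p. p \<in> S \<Longrightarrow> n \<bullet> X p t < n \<bullet> X q s"
      using support_decreasing[OF st n] by blast
    then show ?thesis
      using x n unfolding mem_iff_halfspaces[OF st(2)] by (meson le_less_trans)
  qed
  then have xs: "x \<in> \<Omega> s"
    unfolding mem_iff_halfspaces[OF st(1)] by (meson less_imp_le)
  show "x \<in> interior (\<Omega> s)"
  proof (rule ccontr)
    assume "x \<notin> interior (\<Omega> s)"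
    then have "x \<in> frontier (\<Omega> s)"
      using xs closure_subset by (auto simp: frontier_def)
    then obtain n where n: "norm n = 1" "\<And>y. y \<in> \<Omega> s \<Longrightarrow> n \<bullet> y \<le> n \<bullet> x"
      using convex_body_support[OF body[OF st(1)]] by metis
    then show False
      using upper[OF n(1)] boundary_point(2)[OF _ st(1)] by fastforce
  qed
qed

lemma nested:
  assumes "s \<in> J" "t \<in> J" "s \<le> t"
  shows "\<Omega> t \<subseteq> \<Omega> s"
  using nested_interior[of s t] interior_subset assms by (cases "s = t") fastforce+

lemma time_uniform:
  assumes s: "s \<in> J" and e: "e > 0"
  obtains d where "d > 0"
    "\<And>t p. t \<in> J \<Longrightarrow> \<bar>t - s\<bar> < d \<Longrightarrow> p \<in> S \<Longrightarrow> dist (X p t) (X p s) < e"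
proof -
  define r where "r = (s + T) / 2"
  have r: "s < r" "r < T"
    using s by (auto simp: r_def)
  let ?C = "S \<times> {t\<^sub>0..r}"
  have "uniformly_continuous_on ?C (\<lambda>(p, t). X p t)"
    by (intro compact_uniformly_continuous compact_Times continuous_on_subset[OF X_continuous])
      (use r in auto)
  then obtain d where d: "d > 0"
    "\<And>x y. x \<in> ?C \<Longrightarrow> y \<in> ?C \<Longrightarrow> dist y x < d \<Longrightarrow>
      dist ((\<lambda>(p, t). X p t) y) ((\<lambda>(p, t). X p t) x) < e"
    unfolding uniformly_continuous_on_def using e by metis
  show ?thesis
  proof (rule that[of "min d (r - s)"])
    fix t p assume t: "t \<in> J" "\<bar>t - s\<bar> < min d (r - s)" "p \<in> S"
    have "dist (p, t) (p, s) = \<bar>t - s\<bar>"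
      by (simp add: dist_Pair_Pair dist_real_def)
    then show "dist (X p t) (X p s) < e"
      using d(2)[of "(p, s)" "(p, t)"] t s r by auto
  qed (use d r in auto)
qed

lemma interior_survives:
  assumes s: "s \<in> J" and x: "x \<in> interior (\<Omega> s)"
  obtains t where "t \<in> J" "s < t" "x \<in> \<Omega> t"
proof -
  obtain r where r: "r > 0" "cball x r \<subseteq> \<Omega> s"
    using x mem_interior_cball by blast
  obtain d where d: "d > 0" "\<And>t p. t \<in> J \<Longrightarrow> \<bar>t - s\<bar> < d \<Longrightarrow> p \<in> S \<Longrightarrow> dist (X p t) (X p s) < r"
    using time_uniform[OF s r(1)] by blast
  define t where "t = min (s + d / 2) ((s + T) / 2)"
  have t: "t \<in> J" "s < t" "\<bar>t - s\<bar> < d"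
    using d(1) s by (auto simp: t_def min_def)
  have "x \<in> \<Omega> t"
    unfolding mem_iff_halfspaces[OF t(1)]
  proof (intro allI impI)
    fix n :: "real^'m" assume n: "norm n = 1"
    have "x + r *\<^sub>R n \<in> \<Omega> s"
      using r n by (auto simp: subset_iff dist_norm)
    then obtain q where q: "q \<in> S" "n \<bullet> (x + r *\<^sub>R n) \<le> n \<bullet> X q s"
      using n unfolding mem_iff_halfspaces[OF s] by blast
    have "n \<bullet> (X q s - X q t) \<le> norm n * norm (X q s - X q t)"
      by (rule norm_cauchy_schwarz)
    also have "\<dots> < r"
      using d(2)[OF t(1,3) q(1)] n by (simp add: dist_norm norm_minus_commute)
    finally have "n \<bullet> x \<le> n \<bullet> X q t"
      using q(2) n by (simp add: inner_diff_right inner_add_right dot_square_norm)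
    then show "\<exists>q\<in>S. n \<bullet> x \<le> n \<bullet> X q t"
      using q(1) by blast
  qed
  then show ?thesis
    using that t by blast
qed

lemma left_closed:
  assumes t: "t \<in> J" "t\<^sub>0 < t" and x: "\<And>s. s \<in> J \<Longrightarrow> s < t \<Longrightarrow> x \<in> \<Omega> s"
  shows "x \<in> \<Omega> t"
proof (rule ccontr)
  assume "x \<notin> \<Omega> t"
  then obtain n where n: "norm n = 1" "\<And>q. q \<in> S \<Longrightarrow> n \<bullet> X q t < n \<bullet> x"
    unfolding mem_iff_halfspaces[OF t(1)] by (meson not_less)
  have "continuous_on S (\<lambda>q. n \<bullet> X q t)"
    by (intro continuous_intros) (use t in auto)
  then obtain m where m: "m \<in> S" "\<And>q. q \<in> S \<Longrightarrow> n \<bullet> X q t \<le> n \<bullet> X m t"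
    using continuous_attains_sup[OF compact_sphere S_nonempty] by metis
  define e where "e = n \<bullet> x - n \<bullet> X m t"
  have "e > 0"
    using n(2)[OF m(1)] by (simp add: e_def)
  then obtain d where d: "d > 0" "\<And>s p. s \<in> J \<Longrightarrow> \<bar>s - t\<bar> < d \<Longrightarrow> p \<in> S \<Longrightarrow> dist (X p s) (X p t) < e"
    using time_uniform[OF t(1)] by metis
  define s where "s = max t\<^sub>0 (t - d / 2)"
  have s: "s \<in> J" "s < t" "\<bar>s - t\<bar> < d"
    using d(1) t by (auto simp: s_def max_def)
  obtain q where q: "q \<in> S" "n \<bullet> x \<le> n \<bullet> X q s"
    using x[OF s(1,2)] n(1) unfolding mem_iff_halfspaces[OF s(1)] by blast
  have "n \<bullet> (X q s - X q t) \<le> norm n * norm (X q s - X q t)"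
    by (rule norm_cauchy_schwarz)
  also have "\<dots> < e"
    using d(2)[OF s(1,3) q(1)] n(1) by (simp add: dist_norm)
  finally show False
    using q(2) m(2)[OF q(1)] by (simp add: e_def inner_diff_right)
qed

end

locale contracting_flow = smooth_convex_flow f \<alpha> t\<^sub>0 T \<Omega> X F
  for f :: "real^'m \<Rightarrow> real^'n^'n \<Rightarrow> real" and \<alpha> t\<^sub>0 T \<Omega> X F +
  fixes z :: "real^'m"
  assumes contracts: "contracts_to \<Omega> T z"
begin

lemma near_end:
  assumes "e > 0" "s < T"
  obtains t where "t \<in> J" "s < t" "frontier (\<Omega> t) \<subseteq> ball z e"
proof -
  obtain b where b: "b < T" "\<And>t. b < t \<Longrightarrow> t < T \<Longrightarrow> frontier (\<Omega> t) \<subseteq> ball z e"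
    using contracts assms(1) unfolding contracts_to_def eventually_at_left_field by blast
  define t where "t = (max (max b s) t\<^sub>0 + T) / 2"
  have "b < t" "t < T" "s < t" "t\<^sub>0 \<le> t"
    using b(1) assms(2) before by (auto simp: t_def)
  then show ?thesis
    using that b(2) by auto
qed

lemma limit_point_in:
  assumes t: "t \<in> J"
  shows "z \<in> \<Omega> t"
proof -
  have "\<exists>y\<in>\<Omega> t. dist y z < e" if e: "e > 0" for e
  proof -
    obtain s where s: "s \<in> J" "t < s" "frontier (\<Omega> s) \<subseteq> ball z e"
      using near_end[OF e, of t] t by auto
    obtain q where "q \<in> S" using S_nonempty by blast
    then have "X q s \<in> \<Omega> t" "X q s \<in> ball z e"
      using boundary_point[of q s] nested[OF t s(1)] s by auto
    then show ?thesis by (auto simp: dist_commute)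
  qed
  then show ?thesis
    using body_facts(2)[OF t] closure_approachable closure_closed by metis
qed

lemma limit_point_interior:
  assumes t: "t \<in> J"
  shows "z \<in> interior (\<Omega> t)"
proof -
  have "(t + T) / 2 \<in> J" "t < (t + T) / 2"
    using t by auto
  then show ?thesis
    using nested_interior[OF t] limit_point_in by blast
qed

lemma leaves:
  assumes "x \<noteq> z" "s < T"
  obtains t where "t \<in> J" "s < t" "x \<notin> \<Omega> t"
proof -
  have pos: "norm (x - z) > 0" using assms by simp
  obtain t where t: "t \<in> J" "s < t" "frontier (\<Omega> t) \<subseteq> ball z (norm (x - z))"
    using near_end[OF pos assms(2)] by blast
  have "x \<notin> \<Omega> t"
  proof
    let ?n = "(x - z) /\<^sub>R norm (x - z)"
    assume "x \<in> \<Omega> t"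
    moreover have "norm ?n = 1"
      using pos by simp
    ultimately obtain q where q: "q \<in> S" "?n \<bullet> x \<le> ?n \<bullet> X q t"
      unfolding mem_iff_halfspaces[OF t(1)] by blast
    have "norm (x - z) = ?n \<bullet> x - ?n \<bullet> z"
      unfolding inner_diff_right[symmetric] using pos by (simp add: dot_square_norm power2_eq_square)
    also have "\<dots> \<le> ?n \<bullet> (X q t - z)"
      using q(2) by (simp add: inner_diff_right)
    also have "\<dots> \<le> norm ?n * norm (X q t - z)"
      by (rule norm_cauchy_schwarz)
    also have "\<dots> < norm (x - z)"
      using boundary_point(1)[OF q(1) t(1)] t(3) pos by (auto simp: dist_norm norm_minus_commute subset_iff)
    finally show False by simp
  qed
  then show ?thesis
    using that t by blast
qed

abbreviation u :: "real^'m \<Rightarrow> real" where "u \<equiv> arrival_time J \<Omega> T z"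

lemma arrival_frontier:
  assumes x: "x \<in> frontier (\<Omega> t)" and t: "t \<in> J"
  shows "u x = t"
proof -
  have "x \<noteq> z"
    using limit_point_interior[OF t] x by (auto simp: frontier_def)
  moreover have "(THE t. t \<in> J \<and> x \<in> frontier (\<Omega> t)) = t"
  proof (rule the_equality)
    fix s assume s: "s \<in> J \<and> x \<in> frontier (\<Omega> s)"
    have "\<not> s < t" "\<not> t < s"
      using nested_interior[of s t] nested_interior[of t s] s x t body_facts(5)
      by (auto simp: frontier_def)
    then show "s = t" by simp
  qed (use x t in simp)
  ultimately show ?thesis
    by (simp add: arrival_time_def)
qed

lemma arrival_limit [simp]: "u z = T"
  by (simp add: arrival_time_def)

lemma on_frontier:
  assumes x: "x \<in> \<Omega> t\<^sub>0" "x \<noteq> z"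
  obtains t where "t \<in> J" "x \<in> frontier (\<Omega> t)"
proof -
  define A where "A = {t \<in> J. x \<in> \<Omega> t}"
  obtain r where r: "r \<in> J" "x \<notin> \<Omega> r"
    using leaves[OF x(2) before] by blast
  have A0: "t\<^sub>0 \<in> A"
    using x before by (simp add: A_def)
  have bd: "t < r" if "t \<in> A" for t
    using nested[OF r(1), of t] r that by (cases "r \<le> t") (auto simp: A_def)
  then have bdd: "bdd_above A"
    by (meson bdd_above.I less_imp_le)
  define t where "t = Sup A"
  have t_ge: "s \<le> t" if "s \<in> A" for s
    unfolding t_def using that bdd by (rule cSup_upper)
  have "t \<le> r"
    unfolding t_def using A0 bd by (intro cSup_least) (auto intro: less_imp_le)
  then have tJ: "t \<in> J"
    using t_ge[OF A0] r(1) by auto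
  have xt: "x \<in> \<Omega> t"
  proof (cases "t = t\<^sub>0")
    case True then show ?thesis using x by simp
  next
    case False
    show ?thesis
    proof (rule left_closed[OF tJ])
      show "t\<^sub>0 < t" using False t_ge[OF A0] by simp
      fix s assume s: "s \<in> J" "s < t"
      then obtain s' where "s' \<in> A" "s < s'"
        unfolding t_def using less_cSup_iff[of A s] bdd A0 by blast
      then show "x \<in> \<Omega> s"
        using nested[OF s(1), of s'] by (auto simp: A_def)
    qed
  qed
  have "x \<notin> interior (\<Omega> t)"
  proof
    assume "x \<in> interior (\<Omega> t)"
    then obtain s where "s \<in> J" "t < s" "x \<in> \<Omega> s"
      using interior_survives[OF tJ] by blast
    then show False
      using t_ge[of s] by (auto simp: A_def)
  qed
  then show ?thesis
    using that[OF tJ] xt closure_subset by (auto simp: frontier_def)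
qed

lemma arrival_ge_iff:
  assumes x: "x \<in> \<Omega> t\<^sub>0" and t: "t \<in> J"
  shows "t \<le> u x \<longleftrightarrow> x \<in> \<Omega> t"
proof (cases "x = z")
  case True
  then show ?thesis using limit_point_in t by simp
next
  case False
  then obtain s where s: "s \<in> J" "x \<in> frontier (\<Omega> s)"
    using on_frontier[OF x] by blast
  have us: "u x = s"
    using arrival_frontier s by blast
  have "x \<in> \<Omega> s" "x \<notin> interior (\<Omega> s)"
    using s body_facts(5)[OF s(1)] by (auto simp: frontier_def)
  then show ?thesis
    using nested[OF t s(1)] nested_interior[OF s(1) t] unfolding us by (meson in_mono not_le)
qed

lemma arrival_lt:
  assumes x: "x \<in> \<Omega> t\<^sub>0" "x \<noteq> z"
  shows "u x < T"
proof -
  obtain t where t: "t \<in> J" "x \<in> frontier (\<Omega> t)"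
    using on_frontier[OF x] by blast
  then show ?thesis
    using arrival_frontier[OF t(2,1)] by simp
qed

lemma arrival_bounds:
  assumes x: "x \<in> \<Omega> t\<^sub>0"
  shows "t\<^sub>0 \<le> u x" "u x \<le> T"
proof -
  show "t\<^sub>0 \<le> u x"
    using arrival_ge_iff[OF x, of t\<^sub>0] x before by simp
  show "u x \<le> T"
    using arrival_lt[OF x] by (cases "x = z") auto
qed

lemma arrival_continuous: "continuous_on (\<Omega> t\<^sub>0) u"
  unfolding continuous_on_def
proof (intro ballI order_tendstoI)
  fix x a assume x: "x \<in> \<Omega> t\<^sub>0" and a: "a < u x"
  have in0: "\<forall>\<^sub>F y in at x within \<Omega> t\<^sub>0. y \<in> \<Omega> t\<^sub>0"
    by (simp add: eventually_at_filter)
  show "\<forall>\<^sub>F y in at x within \<Omega> t\<^sub>0. a < u y"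
  proof (cases "a < t\<^sub>0")
    case True
    show ?thesis
      using in0 by eventually_elim (use arrival_bounds True in force)
  next
    case False
    define b where "b = (2 * a + u x) / 3"
    define c where "c = (a + 2 * u x) / 3"
    have b: "a < b" "b < c" "c \<le> u x" "b \<in> J" "c \<in> J"
      using a False arrival_bounds[OF x] by (auto simp: b_def c_def field_simps)
    have "x \<in> interior (\<Omega> b)"
      using nested_interior[OF b(4,5,2)] arrival_ge_iff[OF x b(5)] b(3) by blast
    then have "\<forall>\<^sub>F y in at x within \<Omega> t\<^sub>0. y \<in> interior (\<Omega> b)"
      by (intro topological_tendstoD[OF tendsto_ident_at]) auto
    with in0 show ?thesis
    proof eventually_elim
      case (elim y)
      then have "b \<le> u y"
        using arrival_ge_iff[OF elim(1) b(4)] interior_subset by blast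
      then show ?case using b by simp
    qed
  qed
next
  fix x a assume x: "x \<in> \<Omega> t\<^sub>0" and a: "u x < a"
  have in0: "\<forall>\<^sub>F y in at x within \<Omega> t\<^sub>0. y \<in> \<Omega> t\<^sub>0"
    by (simp add: eventually_at_filter)
  show "\<forall>\<^sub>F y in at x within \<Omega> t\<^sub>0. u y < a"
  proof (cases "T < a")
    case True
    show ?thesis
      using in0 by eventually_elim (use arrival_bounds True in force)
  next
    case False
    define b where "b = (u x + a) / 2"
    have b: "u x < b" "b < a" "b \<in> J"
      using a False arrival_bounds[OF x] by (auto simp: b_def)
    have "x \<in> - \<Omega> b"
      using arrival_ge_iff[OF x b(3)] b(1) by auto
    then have "\<forall>\<^sub>F y in at x within \<Omega> t\<^sub>0. y \<in> - \<Omega> b"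
      using body_facts(2)[OF b(3)] by (intro topological_tendstoD[OF tendsto_ident_at]) auto
    with in0 show ?thesis
    proof eventually_elim
      case (elim y)
      then have "\<not> b \<le> u y"
        using arrival_ge_iff[OF elim(1) b(3)] by blast
      then show ?case using b by simp
    qed
  qed
qed


section \<open>Concavity of the root of the arrival time\<close>

definition time_of :: "real \<Rightarrow> real" where
  "time_of s = t\<^sub>0 + s powr (1 + \<alpha>) / (1 + \<alpha>)"

definition level_of :: "real \<Rightarrow> real" where
  "level_of t = ((1 + \<alpha>) * (t - t\<^sub>0)) powr (1 / (1 + \<alpha>))"

lemma time_of_0 [simp]: "time_of 0 = t\<^sub>0"
  by (simp add: time_of_def)

lemma time_of_level_of: "t\<^sub>0 \<le> t \<Longrightarrow> time_of (level_of t) = t"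
  using alpha by (simp add: time_of_def level_of_def powr_powr)

lemma time_of_less: "0 \<le> r \<Longrightarrow> r < s \<Longrightarrow> time_of r < time_of s"
  using alpha by (simp add: time_of_def divide_strict_right_mono powr_less_mono2)

lemma time_of_ge: "t\<^sub>0 \<le> time_of s"
  using alpha by (simp add: time_of_def)

lemma level_of_nonneg: "0 \<le> level_of t"
  by (simp add: level_of_def)

lemma time_of_in_J:
  assumes "0 \<le> s" "s < level_of T"
  shows "time_of s \<in> J"
  using time_of_less[OF assms] time_of_level_of[of T] time_of_ge before by simp

lemma time_of_derivative:
  assumes "0 \<le> s"
  shows "(time_of has_real_derivative s powr \<alpha>) (at s within {0..})"
proof (cases "s = 0")
  case False
  then have s: "s > 0" using assms by simp
  have "((\<lambda>s. t\<^sub>0 + s powr (1 + \<alpha>) / (1 + \<alpha>)) has_real_derivative s powr \<alpha>) (at s)"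
    using s alpha by (auto intro!: derivative_eq_intros simp: powr_diff)
  then show ?thesis
    unfolding time_of_def [abs_def] by (rule has_field_derivative_at_within)
next
  case True
  have lim: "((\<lambda>y. y powr \<alpha> / (1 + \<alpha>)) \<longlongrightarrow> 0 / (1 + \<alpha>)) (at 0 within {0..})"
    by (intro tendsto_divide tendsto_zero_powrI[where b = \<alpha>] tendsto_ident_at tendsto_const)
      (use alpha in \<open>auto simp: eventually_at_filter\<close>)
  have "\<forall>\<^sub>F y in at 0 within {0..}. y powr \<alpha> / (1 + \<alpha>) = (time_of y - time_of 0) / (y - 0)"
    by (auto simp: eventually_at_filter time_of_def powr_add)
  from Lim_transform_eventually[OF lim this] show ?thesis
    unfolding has_field_derivative_iff True using alpha by simp
qed

definition w :: "real^'m \<Rightarrow> real" where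
  "w x = level_of (u x)"

lemma level_of_mono: "s \<le> t \<Longrightarrow> t\<^sub>0 \<le> s \<Longrightarrow> level_of s \<le> level_of t"
  using alpha by (auto simp: level_of_def intro!: powr_mono2)

lemma w_bounds:
  assumes "x \<in> \<Omega> t\<^sub>0"
  shows "0 \<le> w x" "w x \<le> level_of T"
  using arrival_bounds[OF assms] level_of_mono level_of_nonneg by (auto simp: w_def)

lemma w_ge_iff:
  assumes x: "x \<in> \<Omega> t\<^sub>0" and s: "0 \<le> s" "s < level_of T"
  shows "s \<le> w x \<longleftrightarrow> x \<in> \<Omega> (time_of s)"
proof -
  have u: "time_of (w x) = u x"
    using time_of_level_of arrival_bounds(1)[OF x] by (simp add: w_def)
  have "s \<le> w x \<longleftrightarrow> time_of s \<le> time_of (w x)"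
    using time_of_less[of s "w x"] time_of_less[of "w x" s] s(1) w_bounds(1)[OF x]
    by (cases "s = w x") (force simp: not_le)+
  then show ?thesis
    using arrival_ge_iff[OF x time_of_in_J[OF s]] u by simp
qed

lemma w_continuous: "continuous_on (\<Omega> t\<^sub>0) w"
  unfolding w_def [abs_def] level_of_def
  by (intro continuous_intros continuous_on_powr' arrival_continuous)
    (use arrival_bounds alpha in auto)

lemma level_of_T_pos: "0 < level_of T"
  using before alpha by (simp add: level_of_def)

lemma moving_point_derivative:
  assumes p: "p \<in> S" and s: "0 \<le> s" "s < level_of T"
    and r: "\<And>\<epsilon>. 0 \<le> \<epsilon> \<Longrightarrow> \<epsilon> \<le> r \<Longrightarrow> 0 \<le> s + k * \<epsilon> \<and> s + k * \<epsilon> < level_of T"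
  shows "((\<lambda>\<epsilon>. X p (time_of (s + k * \<epsilon>))) has_vector_derivative
      - (k * s powr \<alpha> * F (X p (time_of s)) (time_of s)) *\<^sub>R N p (time_of s)) (at 0 within {0..r})"
proof -
  let ?g = "\<lambda>\<epsilon>. s + k * \<epsilon>"
  have "(?g has_real_derivative k) (at 0 within {0..r})"
    by (auto intro!: derivative_eq_intros)
  moreover have "(time_of has_real_derivative s powr \<alpha>) (at (?g 0) within ?g ` {0..r})"
  proof -
    have "?g ` {0..r} \<subseteq> {0..}"
      using r by auto
    from has_field_derivative_subset[OF time_of_derivative[OF s(1)] this] show ?thesis
      by simp
  qed
  ultimately have "((time_of \<circ> ?g) has_real_derivative s powr \<alpha> * k) (at 0 within {0..r})"
    by (intro DERIV_image_chain) auto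
  then have 1: "((\<lambda>\<epsilon>. time_of (?g \<epsilon>)) has_vector_derivative s powr \<alpha> * k) (at 0 within {0..r})"
    by (simp add: has_real_derivative_iff_has_vector_derivative comp_def)
  have sub: "(\<lambda>\<epsilon>. time_of (?g \<epsilon>)) ` {0..r} \<subseteq> J"
    using r time_of_in_J by auto
  have "(X p has_derivative (\<lambda>h. h *\<^sub>R (- F (X p (time_of s)) (time_of s) *\<^sub>R N p (time_of s))))
      (at (time_of (?g 0)) within (\<lambda>\<epsilon>. time_of (?g \<epsilon>)) ` {0..r})"
    using has_derivative_subset[OF motion[OF time_of_in_J[OF s] p, unfolded has_vector_derivative_def] sub]
    by simp
  from vector_derivative_diff_chain_within[OF 1 this] show ?thesis
    by (simp add: comp_def mult_ac)
qed

lemma normal_time_tendsto: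
  assumes p: "p \<in> S" and s: "0 \<le> s" "s < level_of T"
    and r: "\<And>\<epsilon>. 0 \<le> \<epsilon> \<Longrightarrow> \<epsilon> \<le> r \<Longrightarrow> 0 \<le> s + k * \<epsilon> \<and> s + k * \<epsilon> < level_of T" and "0 < r"
  shows "((\<lambda>\<epsilon>. N p (time_of (s + k * \<epsilon>))) \<longlongrightarrow> N p (time_of s)) (at 0 within {0..r})"
proof -
  have "continuous_on {0..r} (\<lambda>\<epsilon>. time_of (s + k * \<epsilon>))"
    unfolding time_of_def using r alpha
    by (intro continuous_intros continuous_on_powr') auto
  then have "continuous_on {0..r} (\<lambda>\<epsilon>. (p, time_of (s + k * \<epsilon>)))"
    by (intro continuous_intros)
  moreover have "(\<lambda>\<epsilon>. (p, time_of (s + k * \<epsilon>))) ` {0..r} \<subseteq> S \<times> J"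
    using p r time_of_in_J by auto
  ultimately have "continuous_on {0..r} (\<lambda>\<epsilon>. (\<lambda>(p, t). N p t) (p, time_of (s + k * \<epsilon>)))"
    by (rule continuous_on_compose2[OF normal_continuous])
  then show ?thesis
    using \<open>0 < r\<close> unfolding continuous_on_def by force
qed

text \<open>The boundary moves with speed \<open>a powr \<alpha> * F\<close> in the parameter \<open>a\<close>. This vanishes at
  \<open>a = 0\<close>, which excludes \<open>a = 0\<close> by moving forwards; moving backwards compares the speeds.\<close>

lemma touching_first_order_speed:
  assumes p: "p0 \<in> S" "p1 \<in> S" and a: "0 \<le> a" "a \<le> c" and d: "0 < d" "d < c"
    and c: "c < level_of T" and m: "0 < m"
    and pos: "X p0 (time_of d) = m *\<^sub>R X p1 (time_of a) + v"
    and normal: "N p1 (time_of a) = N p0 (time_of d)"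
    and incl: "\<And>a' x. 0 \<le> a' \<Longrightarrow> a' \<le> c \<Longrightarrow> 0 \<le> d + m * (a' - a) \<Longrightarrow> d + m * (a' - a) \<le> c \<Longrightarrow>
       x \<in> \<Omega> (time_of a') \<Longrightarrow> m *\<^sub>R x + v \<in> \<Omega> (time_of (d + m * (a' - a)))"
  shows "0 < a"
    and "a powr \<alpha> * F (X p1 (time_of a)) (time_of a) \<le> d powr \<alpha> * F (X p0 (time_of d)) (time_of d)"
proof -
  let ?\<nu> = "N p0 (time_of d)"
  let ?Fa = "F (X p1 (time_of a)) (time_of a)" and ?Fd = "F (X p0 (time_of d)) (time_of d)"
  have aJ: "time_of a \<in> J" "time_of d \<in> J"
    using a d c by (auto intro!: time_of_in_J simp del: atLeastLessThan_iff)
  have nn: "?\<nu> \<bullet> ?\<nu> = 1"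
    using convex_embedding.normal_support(1)[OF embedding[OF aJ(2)] p(1)] by (simp add: dot_square_norm)
  have step: "k * (d powr \<alpha> * ?Fd - a powr \<alpha> * ?Fa) \<le> 0"
    if r: "0 < r" "m * \<bar>k\<bar> * r \<le> d" "m * \<bar>k\<bar> * r \<le> c - d"
      "\<And>\<epsilon>. 0 \<le> \<epsilon> \<Longrightarrow> \<epsilon> \<le> r \<Longrightarrow> 0 \<le> a + k * \<epsilon> \<and> a + k * \<epsilon> \<le> c" for k r
  proof -
    have bd: "0 \<le> d + (m * k) * \<epsilon> \<and> d + (m * k) * \<epsilon> \<le> c" if "0 \<le> \<epsilon>" "\<epsilon> \<le> r" for \<epsilon>
    proof -
      have "\<bar>m * k * \<epsilon>\<bar> \<le> m * \<bar>k\<bar> * r"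
        using that m by (simp add: abs_mult mult_left_mono mult_nonneg_nonneg)
      then show ?thesis using r by linarith
    qed
    have bd': "0 \<le> d + (m * k) * \<epsilon> \<and> d + (m * k) * \<epsilon> < level_of T"
      and ba': "0 \<le> a + k * \<epsilon> \<and> a + k * \<epsilon> < level_of T" if "0 \<le> \<epsilon>" "\<epsilon> \<le> r" for \<epsilon>
      using bd[OF that] r(4)[OF that] c by auto
    define e where "e \<epsilon> = m *\<^sub>R X p1 (time_of (a + k * \<epsilon>)) + v - X p0 (time_of (d + (m * k) * \<epsilon>))" for \<epsilon>
    have "?\<nu> \<bullet> (m *\<^sub>R (- (k * a powr \<alpha> * ?Fa) *\<^sub>R N p1 (time_of a)) + 0
        - (- (m * k * d powr \<alpha> * ?Fd) *\<^sub>R ?\<nu>)) \<le> 0"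
    proof (rule touching_first_order[OF r(1), where e = e])
      show "((\<lambda>\<epsilon>. N p0 (time_of (d + (m * k) * \<epsilon>))) \<longlongrightarrow> ?\<nu>) (at 0 within {0..r})"
        by (rule normal_time_tendsto[OF p(1) _ _ bd' r(1)]) (use d c in auto)
      show "(e has_vector_derivative m *\<^sub>R (- (k * a powr \<alpha> * ?Fa) *\<^sub>R N p1 (time_of a)) + 0
        - (- (m * k * d powr \<alpha> * ?Fd) *\<^sub>R ?\<nu>)) (at 0 within {0..r})"
        unfolding e_def [abs_def]
        by (intro has_vector_derivative_diff has_vector_derivative_add has_vector_derivative_const
            bounded_linear.has_vector_derivative[OF bounded_linear_scaleR_right]
            moving_point_derivative[OF p(1) _ _ bd'] moving_point_derivative[OF p(2) _ _ ba'])
          (use a d c in auto)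
      show "e 0 = 0" by (simp add: e_def pos)
      fix \<epsilon> assume \<epsilon>: "0 < \<epsilon>" "\<epsilon> \<le> r"
      have 1: "0 \<le> a + k * \<epsilon>" "a + k * \<epsilon> \<le> c" "0 \<le> d + m * (a + k * \<epsilon> - a)" "d + m * (a + k * \<epsilon> - a) \<le> c"
        using r(4)[of \<epsilon>] bd[of \<epsilon>] \<epsilon> by (auto simp: mult.assoc)
      have J: "time_of (a + k * \<epsilon>) \<in> J" "time_of (d + m * k * \<epsilon>) \<in> J"
        using ba'[of \<epsilon>] bd'[of \<epsilon>] \<epsilon> by (auto intro!: time_of_in_J simp del: atLeastLessThan_iff)
      have "m *\<^sub>R X p1 (time_of (a + k * \<epsilon>)) + v \<in> \<Omega> (time_of (d + m * k * \<epsilon>))"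
        using incl[OF 1 boundary_point(2)[OF p(2) J(1)]] by (simp add: mult.assoc)
      from convex_embedding.normal_support(2)[OF embedding[OF J(2)] p(1) this]
      show "N p0 (time_of (d + (m * k) * \<epsilon>)) \<bullet> e \<epsilon> \<le> 0"
        by (simp add: e_def inner_diff_right)
    qed
    then have "m * (k * (d powr \<alpha> * ?Fd - a powr \<alpha> * ?Fa)) \<le> 0"
      by (simp add: normal nn inner_add_right inner_diff_right algebra_simps)
    then show ?thesis
      using m by (simp add: mult_le_0_iff)
  qed
  show a_pos: "0 < a"
  proof (rule ccontr)
    assume "\<not> 0 < a"
    then have a0: "a = 0" using a by simp
    define r where "r = min (min (d / m) ((c - d) / m)) c"
    have r: "0 < r" "r \<le> d / m" "r \<le> (c - d) / m" "r \<le> c"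
      using d m by (auto simp: r_def)
    have "1 * (d powr \<alpha> * ?Fd - a powr \<alpha> * ?Fa) \<le> 0"
      by (rule step[where r = r]) (use r m a0 in \<open>auto simp: field_simps\<close>)
    then show False
      using speed_pos[OF p(1) aJ(2)] d(1) a0 by (simp add: mult_le_0_iff)
  qed
  define r where "r = min (min (d / m) ((c - d) / m)) a"
  have r: "0 < r" "r \<le> d / m" "r \<le> (c - d) / m" "r \<le> a"
    using d m a_pos by (auto simp: r_def)
  have "(-1) * (d powr \<alpha> * ?Fd - a powr \<alpha> * ?Fa) \<le> 0"
    by (rule step[where r = r]) (use r m a in \<open>auto simp: field_simps\<close>)
  then show "a powr \<alpha> * ?Fa \<le> d powr \<alpha> * ?Fd"
    by simp
qed

lemma speed_quotient:
  assumes "0 < a" "0 < d" "0 < Fa" "0 < Fd" "a powr \<alpha> * Fa \<le> d powr \<alpha> * Fd"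
  shows "a / d * Fd powr (- 1 / \<alpha>) \<le> Fa powr (- 1 / \<alpha>)"
proof -
  have "(d powr \<alpha> * Fd) powr (- 1 / \<alpha>) \<le> (a powr \<alpha> * Fa) powr (- 1 / \<alpha>)"
    using assms alpha by (intro powr_mono2') auto
  then have "Fd powr (- 1 / \<alpha>) / d \<le> Fa powr (- 1 / \<alpha>) / a"
    using assms alpha by (simp add: powr_mult powr_powr powr_minus_divide mult.commute)
  then have "a * (Fd powr (- 1 / \<alpha>) / d) \<le> a * (Fa powr (- 1 / \<alpha>) / a)"
    using assms by (intro mult_left_mono) auto
  then show ?thesis
    using assms by simp
qed

text \<open>The truncation keeps the touching points away from \<open>z\<close>, where \<open>w\<close> need not be
  differentiable: for \<open>f = 1\<close> and shrinking unit balls, \<open>u\<close> is the distance to the boundary.\<close>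

lemma truncation_concave:
  assumes c: "0 < c" "c < level_of T" and l: "0 < l" "l < 1"
    and xy: "x \<in> \<Omega> t\<^sub>0" "y \<in> \<Omega> t\<^sub>0"
  shows "(1 - l) * min (w x) c + l * min (w y) c \<le> min (w ((1 - l) *\<^sub>R x + l *\<^sub>R y)) c"
proof (rule ccontr)
  assume neg: "\<not> ?thesis"
  define W where "W x = min (w x) c" for x
  define Z where "Z = (\<lambda>(x, y). W ((1 - l) *\<^sub>R x + l *\<^sub>R y) - (1 - l) * W x - l * W y)"
  let ?C = "\<Omega> t\<^sub>0 \<times> \<Omega> t\<^sub>0"
  have t0J: "t\<^sub>0 \<in> J" using before by simp
  note K0 = body_facts[OF t0J]
  have conv: "(1 - l) *\<^sub>R x + l *\<^sub>R y \<in> \<Omega> t\<^sub>0" if "x \<in> \<Omega> t\<^sub>0" "y \<in> \<Omega> t\<^sub>0" for x y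
    using convexD[OF K0(3) that, of "1 - l" l] l by simp
  have W_cont: "continuous_on (\<Omega> t\<^sub>0) W"
    unfolding W_def [abs_def] by (intro continuous_intros w_continuous)
  have "continuous_on ?C Z"
    unfolding Z_def case_prod_unfold
    by (intro continuous_intros continuous_on_compose2[OF W_cont]) (use conv in auto)
  moreover have "compact ?C" "?C \<noteq> {}"
    using K0(1) xy by (auto intro: compact_Times)
  ultimately obtain m where m: "m \<in> ?C" "\<forall>y\<in>?C. Z m \<le> Z y"
    using continuous_attains_inf by blast
  obtain x0 y0 where m_eq: "m = (x0, y0)" by fastforce
  have x0: "x0 \<in> \<Omega> t\<^sub>0" "y0 \<in> \<Omega> t\<^sub>0"
    using m(1) by (auto simp: m_eq)
  have min: "Z (x0, y0) \<le> Z (x', y')" if "x' \<in> \<Omega> t\<^sub>0" "y' \<in> \<Omega> t\<^sub>0" for x' y'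
    using m(2) that unfolding m_eq by blast
  have neg0: "Z (x0, y0) < 0"
  proof -
    have "\<not> (1 - l) * W x + l * W y \<le> W ((1 - l) *\<^sub>R x + l *\<^sub>R y)"
      using neg unfolding W_def .
    then show ?thesis
      using min[OF xy] by (simp add: Z_def)
  qed
  define xb where "xb = (1 - l) *\<^sub>R x0 + l *\<^sub>R y0"
  define a b d where "a = W x0" and "b = W y0" and "d = W xb"
  have xb: "xb \<in> \<Omega> t\<^sub>0"
    unfolding xb_def by (rule conv[OF x0])
  have W_bounds: "0 \<le> W x" "W x \<le> c" if "x \<in> \<Omega> t\<^sub>0" for x
    using w_bounds(1)[OF that] c by (auto simp: W_def)
  have ab: "0 \<le> a" "a \<le> c" "0 \<le> b" "b \<le> c" "0 \<le> d"
    unfolding a_def b_def d_def using W_bounds x0 xb by blast+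
  have d_less: "d < (1 - l) * a + l * b"
    using neg0 by (simp add: Z_def a_def b_def d_def xb_def)
  also have "\<dots> \<le> c"
    using convex_bound_le[OF ab(2,4), of "1 - l" l] l by simp
  finally have d_c: "d < c" .
  have W_ge: "s \<le> W x \<longleftrightarrow> x \<in> \<Omega> (time_of s)" if "x \<in> \<Omega> t\<^sub>0" "0 \<le> s" "s \<le> c" for x s
    using w_ge_iff[OF that(1,2)] that(3) c by (simp add: W_def)
  have J: "time_of s \<in> J" if "0 \<le> s" "s \<le> c" for s
    by (rule time_of_in_J) (use that c in auto)
  have in0: "\<Omega> (time_of s) \<subseteq> \<Omega> t\<^sub>0" if "0 \<le> s" "s \<le> c" for s
    by (rule nested[OF t0J J[OF that] time_of_ge])
  have incl: "(1 - l) *\<^sub>R x + l *\<^sub>R y \<in> \<Omega> (time_of (d + (1 - l) * (a' - a) + l * (b' - b)))"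
    if "x \<in> \<Omega> (time_of a')" "y \<in> \<Omega> (time_of b')" "0 \<le> a'" "a' \<le> c" "0 \<le> b'" "b' \<le> c"
      "0 \<le> d + (1 - l) * (a' - a) + l * (b' - b)" "d + (1 - l) * (a' - a) + l * (b' - b) \<le> c"
    for x y a' b'
  proof -
    have in': "x \<in> \<Omega> t\<^sub>0" "y \<in> \<Omega> t\<^sub>0"
      using that in0 by blast+
    have "a' \<le> W x" "b' \<le> W y"
      using W_ge in' that by blast+
    then have "(1 - l) * a' + l * b' \<le> (1 - l) * W x + l * W y"
      using l by (intro add_mono mult_left_mono) auto
    then have "d + (1 - l) * (a' - a) + l * (b' - b) \<le> W ((1 - l) *\<^sub>R x + l *\<^sub>R y)"
      using min[OF in'] by (simp add: Z_def a_def b_def d_def xb_def algebra_simps)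
    then show ?thesis
      using W_ge[OF conv[OF in'] that(7,8)] by blast
  qed
  have "xb \<noteq> z"
    using d_c c by (auto simp: d_def W_def w_def)
  then obtain t where t: "t \<in> J" "xb \<in> frontier (\<Omega> t)"
    using on_frontier[OF xb] by blast
  have "w xb = d"
    using d_c by (auto simp: d_def W_def min_def split: if_splits)
  then have "t = time_of d"
    using arrival_frontier[OF t(2,1)] time_of_level_of[of t] t(1) by (simp add: w_def)
  then obtain p0 where p0: "p0 \<in> S" "xb = X p0 (time_of d)"
    using frontier_point t by metis
  have dJ: "time_of d \<in> J" "time_of a \<in> J" "time_of b \<in> J"
    using J ab d_c by auto
  let ?\<nu> = "N p0 (time_of d)"
  interpret E: convex_embedding "\<Omega> (time_of d)" "\<lambda>p. X p (time_of d)" "D (time_of d)"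
    using embedding dJ by blast
  have x0_in: "x0 \<in> \<Omega> (time_of a)" "y0 \<in> \<Omega> (time_of b)"
    using W_ge[OF x0(1) ab(1,2)] W_ge[OF x0(2) ab(3,4)] by (simp_all add: a_def b_def)
  have incl0: "(1 - l) *\<^sub>R x + l *\<^sub>R y \<in> \<Omega> (time_of d)"
    if "x \<in> \<Omega> (time_of a)" "y \<in> \<Omega> (time_of b)" for x y
    using incl[OF that ab(1-4)] ab(5) d_c by simp
  have sup: "?\<nu> \<bullet> ((1 - l) *\<^sub>R x + l *\<^sub>R y) \<le> ?\<nu> \<bullet> xb"
    if "x \<in> \<Omega> (time_of a)" "y \<in> \<Omega> (time_of b)" for x y
    using E.normal_support(2)[OF p0(1) incl0[OF that]] p0(2) by simp
  have touch: "\<exists>q\<in>S. x = X q (time_of s) \<and> N q (time_of s) = ?\<nu>"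
    if s: "0 \<le> s" "s \<le> c" and x: "x \<in> \<Omega> (time_of s)"
      and max: "\<And>y. y \<in> \<Omega> (time_of s) \<Longrightarrow> ?\<nu> \<bullet> y \<le> ?\<nu> \<bullet> x" for x s
  proof -
    interpret E1: convex_embedding "\<Omega> (time_of s)" "\<lambda>p. X p (time_of s)" "D (time_of s)"
      using embedding J[OF s] by blast
    have "?\<nu> \<noteq> 0"
      using E.normal_support(1)[OF p0(1)] by auto
    then have "x \<notin> interior (\<Omega> (time_of s))"
      using interior_not_maximal max by (metis not_less)
    then have "x \<in> frontier (\<Omega> (time_of s))"
      using x closure_subset by (auto simp: frontier_def)
    then obtain q where q: "q \<in> S" "x = X q (time_of s)"
      using frontier_point J[OF s] by metis
    moreover have "N q (time_of s) = ?\<nu>"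
      by (rule E1.outward_normal_eq[OF q(1) E.normal_support(1)[OF p0(1)]]) (use max q in auto)
    ultimately show ?thesis by blast
  qed
  have "?\<nu> \<bullet> x \<le> ?\<nu> \<bullet> x0" if "x \<in> \<Omega> (time_of a)" for x
    using sup[OF that x0_in(2)] l by (simp add: xb_def inner_add_right)
  then obtain p1 where p1: "p1 \<in> S" "x0 = X p1 (time_of a)" "N p1 (time_of a) = ?\<nu>"
    using touch[OF ab(1,2) x0_in(1)] by blast
  have "?\<nu> \<bullet> y \<le> ?\<nu> \<bullet> y0" if "y \<in> \<Omega> (time_of b)" for y
    using sup[OF x0_in(1) that] l by (simp add: xb_def inner_add_right)
  then obtain p2 where p2: "p2 \<in> S" "y0 = X p2 (time_of b)" "N p2 (time_of b) = ?\<nu>"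
    using touch[OF ab(3,4) x0_in(2)] by blast
  have d_pos: "0 < d"
  proof (rule ccontr)
    assume "\<not> 0 < d"
    then have d0: "d = 0" using ab by simp
    then have "0 < a \<or> 0 < b"
      using d_less l ab by (smt (verit) mult_nonneg_nonpos)
    moreover have False if "0 < a"
    proof -
      have "x0 \<in> interior (\<Omega> t\<^sub>0)"
        using nested_interior[OF t0J dJ(2)] time_of_less[OF _ that] x0_in by auto
      from mem_interior_convex_shrink[OF K0(3) this x0(2), of "1 - l"]
      have "xb \<in> interior (\<Omega> t\<^sub>0)"
        using l by (simp add: xb_def algebra_simps)
      then show False
        using t \<open>t = time_of d\<close> d0 by (simp add: frontier_def)
    qed
    moreover have False if "0 < b"
    proof -
      have "y0 \<in> interior (\<Omega> t\<^sub>0)"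
        using nested_interior[OF t0J dJ(3)] time_of_less[OF _ that] x0_in by auto
      from mem_interior_convex_shrink[OF K0(3) this x0(1), of l]
      have "xb \<in> interior (\<Omega> t\<^sub>0)"
        using l by (simp add: xb_def algebra_simps)
      then show False
        using t \<open>t = time_of d\<close> d0 by (simp add: frontier_def)
    qed
    ultimately show False by blast
  qed
  have 1: "0 < a" "a powr \<alpha> * F (X p1 (time_of a)) (time_of a) \<le> d powr \<alpha> * F (X p0 (time_of d)) (time_of d)"
    using touching_first_order_speed[OF p0(1) p1(1) ab(1,2) d_pos d_c c(2), of "1 - l" "l *\<^sub>R y0"]
      incl[OF _ x0_in(2) _ _ ab(3,4)] l p0 p1 by (auto simp: xb_def)
  have 2: "0 < b" "b powr \<alpha> * F (X p2 (time_of b)) (time_of b) \<le> d powr \<alpha> * F (X p0 (time_of d)) (time_of d)"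
    using touching_first_order_speed[OF p0(1) p2(1) ab(3,4) d_pos d_c c(2), of l "(1 - l) *\<^sub>R x0"]
      incl[OF x0_in(1) _ ab(1,2)] l p0 p2 by (auto simp: xb_def add.commute)
  let ?Fd = "F (X p0 (time_of d)) (time_of d) powr (- 1 / \<alpha>)"
  have Fd: "0 < ?Fd"
    using speed_pos[OF p0(1) dJ(1)] by simp
  have "(1 - l) * (a / d * ?Fd) + l * (b / d * ?Fd) \<le>
      (1 - l) * F (X p1 (time_of a)) (time_of a) powr (- 1 / \<alpha>) + l * F (X p2 (time_of b)) (time_of b) powr (- 1 / \<alpha>)"
    using l by (intro add_mono mult_left_mono speed_quotient 1 2 d_pos speed_pos p0 p1 p2 dJ) auto
  also have "\<dots> \<le> ?Fd"
    by (rule touching_speeds[OF p0(1) p1(1) p2(1) dJ p1(3) p2(3)])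
      (use l incl0 in \<open>auto simp: p0(2)[symmetric] p1(2)[symmetric] p2(2)[symmetric] xb_def\<close>)
  finally have "((1 - l) * a + l * b) / d * ?Fd \<le> 1 * ?Fd"
    by (simp add: algebra_simps add_divide_distrib diff_divide_distrib)
  then have "((1 - l) * a + l * b) / d \<le> 1"
    using Fd by (rule mult_right_le_imp_le)
  then show False
    using d_less d_pos by (simp add: divide_le_eq)
qed

lemma w_concave: "concave_on (\<Omega> t\<^sub>0) w"
proof -
  have *: "(1 - l) * w x + l * w y \<le> w ((1 - l) *\<^sub>R x + l *\<^sub>R y)"
    if l: "0 < l" "l < 1" and xy: "x \<in> \<Omega> t\<^sub>0" "y \<in> \<Omega> t\<^sub>0" for l x y
  proof (rule field_le_epsilon)
    fix e :: real assume e: "e > 0"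
    define c where "c = max (level_of T / 2) (level_of T - e)"
    have c: "0 < c" "c < level_of T" "level_of T - e \<le> c"
      using level_of_T_pos e by (auto simp: c_def)
    have "w x - e \<le> min (w x) c" "w y - e \<le> min (w y) c"
      using w_bounds(2)[OF xy(1)] w_bounds(2)[OF xy(2)] c e by auto
    then have "(1 - l) * (w x - e) + l * (w y - e) \<le> (1 - l) * min (w x) c + l * min (w y) c"
      using l by (intro add_mono mult_left_mono) auto
    also have "\<dots> \<le> w ((1 - l) *\<^sub>R x + l *\<^sub>R y)"
      using truncation_concave[OF c(1,2) l xy] by simp
    finally show "(1 - l) * w x + l * w y \<le> w ((1 - l) *\<^sub>R x + l *\<^sub>R y) + e"
      by (simp add: algebra_simps)
  qed
  show ?thesis
    unfolding concave_on_iff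
  proof (intro conjI ballI allI impI)
    show "convex (\<Omega> t\<^sub>0)"
      using body_facts(3) before by simp
    fix x y and k l :: real
    assume "x \<in> \<Omega> t\<^sub>0" "y \<in> \<Omega> t\<^sub>0" and kl: "0 \<le> k" "0 \<le> l" "k + l = 1"
    moreover have "k = 1 - l"
      using kl by simp
    ultimately show "k * w x + l * w y \<le> w (k *\<^sub>R x + l *\<^sub>R y)"
      using *[of l x y] by (cases "l = 0"; cases "l = 1") auto
  qed
qed


section \<open>The Harnack inequality\<close>

lemma time_of_second_difference:
  assumes s: "0 < s"
  shows "((\<lambda>\<delta>. (time_of (s + \<delta>) + time_of (s - \<delta>) - 2 * time_of s) / \<delta>\<^sup>2) \<longlongrightarrow> \<alpha> * s powr (\<alpha> - 1)) (at_right 0)"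
proof (rule lhopital_right_0)
  have d: "(time_of has_real_derivative r powr \<alpha>) (at r)" if "r > 0" for r
    using time_of_derivative[of r] that at_within_interior[of r "{0..}"] by simp
  have ct: "isCont time_of s"
    using DERIV_isCont[OF d[OF s]] .
  have pl: "((\<lambda>\<delta>. s + \<delta>) \<longlongrightarrow> s) (at_right 0)" and mi: "((\<lambda>\<delta>. s - \<delta>) \<longlongrightarrow> s) (at_right 0)"
    by (auto intro!: tendsto_eq_intros)
  show "((\<lambda>\<delta>. time_of (s + \<delta>) + time_of (s - \<delta>) - 2 * time_of s) \<longlongrightarrow> 0) (at_right 0)"
    by (rule tendsto_eq_intros isCont_tendsto_compose[OF ct pl] isCont_tendsto_compose[OF ct mi] refl | simp)+
  show "((\<lambda>\<delta>::real. \<delta>\<^sup>2) \<longlongrightarrow> 0) (at_right 0)"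
    by (auto intro!: tendsto_eq_intros)
  show "\<forall>\<^sub>F \<delta>::real in at_right 0. \<delta>\<^sup>2 \<noteq> 0" "\<forall>\<^sub>F \<delta>::real in at_right 0. 2 * \<delta> \<noteq> 0"
    by (auto simp: eventually_at_filter)
  show "\<forall>\<^sub>F \<delta> in at_right 0. ((\<lambda>\<delta>. time_of (s + \<delta>) + time_of (s - \<delta>) - 2 * time_of s)
      has_real_derivative (s + \<delta>) powr \<alpha> - (s - \<delta>) powr \<alpha>) (at \<delta>)"
    unfolding eventually_at_right_field
  proof (intro exI[of _ s] conjI allI impI)
    fix \<delta> assume \<delta>: "0 < \<delta>" "\<delta> < s"
    show "((\<lambda>\<delta>. time_of (s + \<delta>) + time_of (s - \<delta>) - 2 * time_of s)
      has_real_derivative (s + \<delta>) powr \<alpha> - (s - \<delta>) powr \<alpha>) (at \<delta>)"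
    proof -
      have "((\<lambda>\<delta>. time_of (s + \<delta>)) has_real_derivative (s + \<delta>) powr \<alpha> * 1) (at \<delta>)"
        by (rule DERIV_chain2[OF d]) (use \<delta> s in \<open>auto intro!: derivative_eq_intros\<close>)
      moreover have "((\<lambda>\<delta>. time_of (s - \<delta>)) has_real_derivative (s - \<delta>) powr \<alpha> * - 1) (at \<delta>)"
        by (rule DERIV_chain2[OF d]) (use \<delta> s in \<open>auto intro!: derivative_eq_intros\<close>)
      ultimately show ?thesis
        by (auto intro!: derivative_eq_intros)
    qed
  qed (rule s)
  show "\<forall>\<^sub>F \<delta> in at_right 0. ((\<lambda>\<delta>::real. \<delta>\<^sup>2) has_real_derivative 2 * \<delta>) (at \<delta>)"
    by (auto intro!: always_eventually derivative_eq_intros)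
  have "((\<lambda>\<delta>. ((s + \<delta>) powr \<alpha> - (s - \<delta>) powr \<alpha>) / 2) has_real_derivative \<alpha> * s powr (\<alpha> - 1)) (at 0)"
    using s by (auto intro!: derivative_eq_intros simp: powr_diff)
  then have "((\<lambda>\<delta>. ((s + \<delta>) powr \<alpha> - (s - \<delta>) powr \<alpha>) / (2 * \<delta>)) \<longlongrightarrow> \<alpha> * s powr (\<alpha> - 1)) (at 0)"
    by (simp add: has_field_derivative_iff)
  from tendsto_mono[OF at_le[OF subset_UNIV] this]
  show "((\<lambda>\<delta>. ((s + \<delta>) powr \<alpha> - (s - \<delta>) powr \<alpha>) / (2 * \<delta>)) \<longlongrightarrow> \<alpha> * s powr (\<alpha> - 1)) (at_right 0)" .
qed

lemma midpoint_in:
  assumes s: "0 < \<delta>" "\<delta> \<le> s" "s + \<delta> < level_of T"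
    and x: "x \<in> \<Omega> (time_of (s - \<delta>))" "y \<in> \<Omega> (time_of (s + \<delta>))"
  shows "(1 / 2) *\<^sub>R x + (1 / 2) *\<^sub>R y \<in> \<Omega> (time_of s)"
proof -
  have J: "time_of (s - \<delta>) \<in> J" "time_of (s + \<delta>) \<in> J" "t\<^sub>0 \<in> J"
    using s before by (auto intro!: time_of_in_J simp del: atLeastLessThan_iff simp: atLeastLessThan_iff[of t\<^sub>0])
  have in0: "x \<in> \<Omega> t\<^sub>0" "y \<in> \<Omega> t\<^sub>0"
    using nested[OF J(3,1) time_of_ge] nested[OF J(3,2) time_of_ge] x by auto
  have "s - \<delta> \<le> w x" "s + \<delta> \<le> w y"
    using w_ge_iff[OF in0(1)] w_ge_iff[OF in0(2)] s x by auto
  then have "s \<le> (1 / 2) * w x + (1 / 2) * w y"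
    by simp
  also have "\<dots> \<le> w ((1 / 2) *\<^sub>R x + (1 / 2) *\<^sub>R y)"
  proof -
    have "\<forall>k\<ge>0. \<forall>l\<ge>0. k + l = 1 \<longrightarrow> k * w x + l * w y \<le> w (k *\<^sub>R x + l *\<^sub>R y)"
      using w_concave in0 unfolding concave_on_iff by blast
    from this[rule_format, of "1 / 2" "1 / 2"] show ?thesis by simp
  qed
  finally have "s \<le> w ((1 / 2) *\<^sub>R x + (1 / 2) *\<^sub>R y)" .
  moreover have "(1 / 2) *\<^sub>R x + (1 / 2) *\<^sub>R y \<in> \<Omega> t\<^sub>0"
    using convexD[OF body_facts(3)[OF J(3)] in0, of "1 / 2" "1 / 2"] by simp
  ultimately show ?thesis
    using w_ge_iff s by simp
qed

lemma Harnack: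
  assumes t: "t\<^sub>0 < t" "t < T" and p: "p \<in> S" and V: "V \<in> tangent_space (frontier (\<Omega> t)) (X p t)"
  shows "0 \<le> Harnack_quantity \<Omega> X F p t V + \<alpha> * F (X p t) t / ((1 + \<alpha>) * (t - t\<^sub>0))"
proof -
  have tJ: "t \<in> J" using t by simp
  interpret E: convex_embedding "\<Omega> t" "\<lambda>p. X p t" "D t" using embedding tJ by blast
  have "N p t \<bullet> V = 0"
    using V E.tangent_eq(1)[OF p] by blast
  then obtain v where v: "p \<bullet> v = 0" "D t p v = V"
    using tangent_preimage[OF p tJ] by blast
  define s where "s = level_of t"
  have ts: "time_of s = t"
    using time_of_level_of t by (simp add: s_def)
  have s: "0 < s" "s < level_of T"
    using t alpha by (auto simp: s_def level_of_def intro!: powr_less_mono2)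
  let ?Q = "Harnack_quantity \<Omega> X F p t V" and ?F0 = "F (X p t) t"
  define g where "g r = (N p t \<bullet> (X (sphere_curve p v r) (t + r) - X p t) + r * ?F0) / r\<^sup>2" for r
  have g: "(g \<longlongrightarrow> - ?Q / 2) (at 0)"
    using boundary_second_order[OF p t v(1)] unfolding g_def [abs_def] v(2) .
  define r where "r \<delta> = time_of (s + \<delta>) - t" for \<delta>
  have r_deriv: "(r has_real_derivative s powr \<alpha>) (at 0)"
  proof -
    have "(time_of has_real_derivative s powr \<alpha>) (at (s + 0))"
      using time_of_derivative[of s] s at_within_interior[of s "{0..}"] by simp
    then have "((\<lambda>\<delta>. time_of (s + \<delta>)) has_real_derivative s powr \<alpha> * 1) (at 0)"
      by (rule DERIV_chain'[rotated]) (auto intro!: derivative_eq_intros)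
    then show ?thesis
      unfolding r_def [abs_def] by (auto intro!: derivative_eq_intros)
  qed
  have r0: "r 0 = 0" by (simp add: r_def ts)
  have quot: "((\<lambda>\<delta>. r \<delta> / \<delta>) \<longlongrightarrow> s powr \<alpha>) (at 0)"
    using r_deriv by (simp add: has_field_derivative_iff r0)
  have r_ne: "r \<delta> \<noteq> 0" if "\<delta> \<noteq> 0" "\<bar>\<delta>\<bar> < s" for \<delta>
    using time_of_less[of "s + \<delta>" s] time_of_less[of s "s + \<delta>"] that s
    by (cases "\<delta> < 0") (auto simp: r_def ts)
  have "(r \<longlongrightarrow> 0) (at 0)"
    using DERIV_isCont[OF r_deriv] by (simp add: isCont_def r0)
  moreover have "\<forall>\<^sub>F \<delta> in at 0. r \<delta> \<noteq> 0"
    unfolding eventually_at using s(1) r_ne by (intro exI[of _ s]) auto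
  ultimately have "filterlim r (at 0) (at 0)"
    by (simp add: filterlim_at)
  then have gr: "((\<lambda>\<delta>. g (r \<delta>) * (r \<delta> / \<delta>)\<^sup>2) \<longlongrightarrow> - ?Q / 2 * (s powr \<alpha>)\<^sup>2) (at 0)"
    by (intro tendsto_mult tendsto_power quot filterlim_compose[OF g])
  have plus: "((\<lambda>\<delta>. g (r \<delta>) * (r \<delta> / \<delta>)\<^sup>2) \<longlongrightarrow> - ?Q / 2 * (s powr \<alpha>)\<^sup>2) (at_right 0)"
    by (rule tendsto_mono[OF at_le gr]) simp
  have "filterlim (\<lambda>\<delta>::real. - \<delta>) (at 0) (at_right 0)"
    by (auto simp: filterlim_at eventually_at_filter intro!: tendsto_eq_intros)
  from filterlim_compose[OF gr this]
  have minus: "((\<lambda>\<delta>. g (r (- \<delta>)) * (r (- \<delta>) / \<delta>)\<^sup>2) \<longlongrightarrow> - ?Q / 2 * (s powr \<alpha>)\<^sup>2) (at_right 0)"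
    by simp
  have second: "((\<lambda>\<delta>. ?F0 * ((r \<delta> + r (- \<delta>)) / \<delta>\<^sup>2)) \<longlongrightarrow> ?F0 * (\<alpha> * s powr (\<alpha> - 1))) (at_right 0)"
    using tendsto_mult[OF tendsto_const time_of_second_difference[OF s(1)], of ?F0]
    by (simp add: r_def ts algebra_simps)
  have le: "g (r \<delta>) * (r \<delta> / \<delta>)\<^sup>2 + g (r (- \<delta>)) * (r (- \<delta>) / \<delta>)\<^sup>2 \<le> ?F0 * ((r \<delta> + r (- \<delta>)) / \<delta>\<^sup>2)"
    if \<delta>: "0 < \<delta>" "\<delta> < s" "s + \<delta> < level_of T" for \<delta>
  proof -
    let ?x = "\<lambda>\<delta>. X (sphere_curve p v (r \<delta>)) (t + r \<delta>)"
    have tr: "t + r \<delta> = time_of (s + \<delta>)" for \<delta> by (simp add: r_def)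
    have "?x \<delta> \<in> \<Omega> (time_of (s + \<delta>))" "?x (- \<delta>) \<in> \<Omega> (time_of (s - \<delta>))"
      using boundary_point(2)[OF sphere_curve_in_sphere[OF p v(1)]] time_of_in_J[of "s + \<delta>"]
        time_of_in_J[of "s - \<delta>"] \<delta> by (auto simp: tr)
    then have "(1 / 2) *\<^sub>R ?x (- \<delta>) + (1 / 2) *\<^sub>R ?x \<delta> \<in> \<Omega> t"
      using midpoint_in[of \<delta> s] \<delta> ts by auto
    from E.normal_support(2)[OF p this]
    have "N p t \<bullet> (?x \<delta> - X p t) + N p t \<bullet> (?x (- \<delta>) - X p t) \<le> 0"
      by (simp add: inner_add_right inner_diff_right)
    moreover have "g (r \<delta>) * (r \<delta>)\<^sup>2 = N p t \<bullet> (?x \<delta> - X p t) + r \<delta> * ?F0"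
      "g (r (- \<delta>)) * (r (- \<delta>))\<^sup>2 = N p t \<bullet> (?x (- \<delta>) - X p t) + r (- \<delta>) * ?F0"
      using r_ne[of \<delta>] r_ne[of "- \<delta>"] \<delta> by (simp_all add: g_def)
    ultimately have "(g (r \<delta>) * (r \<delta>)\<^sup>2 + g (r (- \<delta>)) * (r (- \<delta>))\<^sup>2) / \<delta>\<^sup>2 \<le> (?F0 * (r \<delta> + r (- \<delta>))) / \<delta>\<^sup>2"
      by (intro divide_right_mono) (auto simp: algebra_simps)
    then show ?thesis
      by (simp add: power_divide add_divide_distrib distrib_left)
  qed
  have "\<forall>\<^sub>F \<delta> in at_right 0. 0 < \<delta> \<and> \<delta> < s \<and> s + \<delta> < level_of T"
    unfolding eventually_at_right_field using s
    by (intro exI[of _ "min s (level_of T - s)"]) auto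
  then have "\<forall>\<^sub>F \<delta> in at_right 0. g (r \<delta>) * (r \<delta> / \<delta>)\<^sup>2 + g (r (- \<delta>)) * (r (- \<delta>) / \<delta>)\<^sup>2 \<le>
      ?F0 * ((r \<delta> + r (- \<delta>)) / \<delta>\<^sup>2)"
    by eventually_elim (use le in blast)
  from tendsto_le[OF _ second tendsto_add[OF plus minus] this]
  have ineq: "- ?Q * (s powr \<alpha>)\<^sup>2 \<le> ?F0 * (\<alpha> * s powr (\<alpha> - 1))"
    by (simp add: trivial_limit_at_right_real)
  have sp: "s powr (1 + \<alpha>) = (1 + \<alpha>) * (t - t\<^sub>0)"
    using t alpha by (simp add: s_def level_of_def powr_powr)
  have sq: "(s powr \<alpha>)\<^sup>2 = s powr (\<alpha> - 1) * s powr (1 + \<alpha>)"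
    by (simp add: power2_eq_square flip: powr_add)
  have "s powr (\<alpha> - 1) * (- ?Q * s powr (1 + \<alpha>)) \<le> s powr (\<alpha> - 1) * (?F0 * \<alpha>)"
    using ineq unfolding sq by (simp add: mult_ac)
  then have "- ?Q * s powr (1 + \<alpha>) \<le> ?F0 * \<alpha>"
    by (rule mult_left_le_imp_le) (use s(1) in simp)
  then have "- ?Q * ((1 + \<alpha>) * (t - t\<^sub>0)) \<le> ?F0 * \<alpha>"
    unfolding sp .
  then have "- ?Q \<le> \<alpha> * ?F0 / ((1 + \<alpha>) * (t - t\<^sub>0))"
    using t alpha by (simp add: pos_le_divide_eq mult.commute)
  then show ?thesis by simp
qed

end


section \<open>Ancient solutions\<close>

lemma smooth_on_subset:
  assumes "smooth_on S g" "R \<subseteq> S"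
  shows "smooth_on R g"
  unfolding smooth_on_def
proof
  fix x assume "x \<in> R"
  then have "x \<in> S"
    using assms(2) by blast
  then obtain U h where U: "open U" "x \<in> U" "\<forall>k. C_k_on k U h" "\<forall>y\<in>S \<inter> U. h y = g y"
    using assms(1) unfolding smooth_on_def by blast
  have "\<forall>y\<in>R \<inter> U. h y = g y"
    using U(4) assms(2) by blast
  then show "\<exists>U h. open U \<and> x \<in> U \<and> (\<forall>k. C_k_on k U h) \<and> (\<forall>y\<in>R \<inter> U. h y = g y)"
    using U(1-3) by blast
qed

lemma convex_flow_subset:
  assumes "convex_flow f \<alpha> J \<Omega> X F" "I \<subseteq> J"
  shows "convex_flow f \<alpha> I \<Omega> X F"
proof -
  have "smooth_on (sphere 0 1 \<times> I) (\<lambda>(p, t). X p t)"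
    by (rule smooth_on_subset[of "sphere 0 1 \<times> J"]) (use assms in \<open>auto simp: convex_flow_def\<close>)
  moreover have "(X p has_vector_derivative - F (X p t) t *\<^sub>R outward_normal (\<Omega> t) (X p t)) (at t within I)"
    if "t \<in> I" "p \<in> sphere 0 1" for t p
  proof -
    have "t \<in> J"
      using assms(2) that(1) by blast
    then have "(X p has_vector_derivative - F (X p t) t *\<^sub>R outward_normal (\<Omega> t) (X p t)) (at t within J)"
      using assms(1) that(2) unfolding convex_flow_def by blast
    then show ?thesis
      using has_vector_derivative_within_subset assms(2) by blast
  qed
  ultimately show ?thesis
    using assms unfolding convex_flow_def by blast
qed

lemma tendsto_scaled_powr:
  fixes a b :: real
  assumes "b > 0"
  shows "((\<lambda>n. n * ((1 + a / n) powr b - 1)) \<longlongrightarrow> b * a) at_top"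
proof -
  have "((\<lambda>\<epsilon>. (1 + a * \<epsilon>) powr b) has_real_derivative b * a) (at 0)"
    by (auto intro!: derivative_eq_intros)
  then have "((\<lambda>\<epsilon>. ((1 + a * \<epsilon>) powr b - 1) / \<epsilon>) \<longlongrightarrow> b * a) (at 0)"
    by (simp add: has_field_derivative_iff)
  moreover have "filterlim (\<lambda>n::real. inverse n) (at 0) at_top"
    using filterlim_inverse_at_right_top filterlim_mono[OF _ at_le order_refl] by blast
  ultimately have "((\<lambda>n. ((1 + a * inverse n) powr b - 1) / inverse n) \<longlongrightarrow> b * a) at_top"
    by (rule filterlim_compose)
  then show ?thesis
    by (simp add: field_simps)
qed

lemma concave_from_shifted_powers:
  fixes a b c k l \<beta> :: real
  assumes \<beta>: "\<beta> > 0" and kl: "k + l = 1"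
    and ev: "\<forall>\<^sub>F n in at_top. k * (a + n) powr \<beta> + l * (b + n) powr \<beta> \<le> (c + n) powr \<beta>"
  shows "k * a + l * b \<le> c"
proof -
  let ?g = "\<lambda>a n. n * ((1 + a / n) powr \<beta> - 1)"
  have lim: "((\<lambda>n. k * ?g a n + l * ?g b n) \<longlongrightarrow> k * (\<beta> * a) + l * (\<beta> * b)) at_top"
    by (intro tendsto_add tendsto_mult tendsto_const tendsto_scaled_powr \<beta>)
  have "\<forall>\<^sub>F n in at_top. n > max 0 (max (- a) (max (- b) (- c)))"
    by (rule eventually_gt_at_top)
  with ev have "\<forall>\<^sub>F n in at_top. k * ?g a n + l * ?g b n \<le> ?g c n"
  proof eventually_elim
    case (elim n)
    have split: "(y + n) powr \<beta> = n powr \<beta> * (1 + y / n) powr \<beta>" if "- y < n" for y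
    proof -
      have "y + n = n * (1 + y / n)"
        using elim(2) by (simp add: field_simps)
      moreover have "0 \<le> 1 + y / n"
        using elim(2) that by (simp add: field_simps)
      ultimately show ?thesis
        using elim(2) by (simp add: powr_mult)
    qed
    have "n powr \<beta> * (k * (1 + a / n) powr \<beta> + l * (1 + b / n) powr \<beta>) \<le> n powr \<beta> * (1 + c / n) powr \<beta>"
      using elim(1) split[of a] split[of b] split[of c] elim(2) by (simp add: algebra_simps)
    then have "k * (1 + a / n) powr \<beta> + l * (1 + b / n) powr \<beta> \<le> (1 + c / n) powr \<beta>"
      by (rule mult_left_le_imp_le) (use elim(2) in simp)
    then have "k * ((1 + a / n) powr \<beta> - 1) + l * ((1 + b / n) powr \<beta> - 1) \<le> (1 + c / n) powr \<beta> - 1"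
      using kl by (simp add: algebra_simps flip: distrib_left)
    then have "n * (k * ((1 + a / n) powr \<beta> - 1) + l * ((1 + b / n) powr \<beta> - 1)) \<le> ?g c n"
      using elim(2) by (intro mult_left_mono) auto
    then show ?case
      by (simp add: algebra_simps)
  qed
  from tendsto_le[OF _ tendsto_scaled_powr[OF \<beta>] lim this]
  have "\<beta> * (k * a + l * b) \<le> \<beta> * c"
    by (simp add: algebra_simps)
  then show ?thesis
    using \<beta> by simp
qed

theorem corollary3p2:
  fixes f :: "real^'m \<Rightarrow> real^'n^'n \<Rightarrow> real"
    and \<alpha> T :: real
    and \<Omega> :: "real \<Rightarrow> (real^'m) set"
    and X :: "real^'m \<Rightarrow> real \<Rightarrow> real^'m"
    and F :: "real^'m \<Rightarrow> real \<Rightarrow> real"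
    and z :: "real^'m"
  assumes "CARD('m) = CARD('n) + 1"
    and "\<alpha> > 0"
    and "admissible_speed f"
    and "contracts_to \<Omega> T z"
  shows
    "(\<forall>t\<^sub>0<T. convex_flow f \<alpha> {t\<^sub>0..<T} \<Omega> X F \<longrightarrow>
        concave_on (\<Omega> t\<^sub>0)
          (\<lambda>p. ((1 + \<alpha>) * (arrival_time {t\<^sub>0..<T} \<Omega> T z p - t\<^sub>0)) powr (1 / (1 + \<alpha>))) \<and>
        (\<forall>t\<in>{t\<^sub>0<..<T}. \<forall>p\<in>sphere 0 1. \<forall>V\<in>tangent_space (frontier (\<Omega> t)) (X p t).
           Harnack_quantity \<Omega> X F p t V + \<alpha> * F (X p t) t / ((1 + \<alpha>) * (t - t\<^sub>0)) \<ge> 0))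
     \<and>
     (convex_flow f \<alpha> {..<T} \<Omega> X F \<longrightarrow>
        concave_on (\<Union>t\<in>{..<T}. \<Omega> t) (arrival_time {..<T} \<Omega> T z) \<and>
        (\<forall>t\<in>{..<T}. \<forall>p\<in>sphere 0 1. \<forall>V\<in>tangent_space (frontier (\<Omega> t)) (X p t).
           Harnack_quantity \<Omega> X F p t V \<ge> 0))"
proof -
  have flow: "contracting_flow f \<alpha> t\<^sub>0 T \<Omega> X F z" if "t\<^sub>0 < T" "convex_flow f \<alpha> {t\<^sub>0..<T} \<Omega> X F" for t\<^sub>0
    by unfold_locales (use assms that in auto)
  show ?thesis
  proof (intro conjI allI impI)
    fix t\<^sub>0 assume t0: "t\<^sub>0 < T" "convex_flow f \<alpha> {t\<^sub>0..<T} \<Omega> X F"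
    interpret C: contracting_flow f \<alpha> t\<^sub>0 T \<Omega> X F z
      by (rule flow[OF t0])
    show "concave_on (\<Omega> t\<^sub>0)
          (\<lambda>p. ((1 + \<alpha>) * (arrival_time {t\<^sub>0..<T} \<Omega> T z p - t\<^sub>0)) powr (1 / (1 + \<alpha>)))"
      using C.w_concave unfolding C.w_def [abs_def] C.level_of_def .
    show "\<forall>t\<in>{t\<^sub>0<..<T}. \<forall>p\<in>sphere 0 1. \<forall>V\<in>tangent_space (frontier (\<Omega> t)) (X p t).
           Harnack_quantity \<Omega> X F p t V + \<alpha> * F (X p t) t / ((1 + \<alpha>) * (t - t\<^sub>0)) \<ge> 0"
      using C.Harnack by simp
  next
    assume "convex_flow f \<alpha> {..<T} \<Omega> X F"
    then have C: "contracting_flow f \<alpha> s T \<Omega> X F z" if "s < T" for s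
      using flow[OF that] convex_flow_subset that by (metis atLeastLessThan_iff lessThan_iff subsetI)
    have nested: "\<Omega> t \<subseteq> \<Omega> s" if "s \<le> t" "t < T" for s t
    proof -
      interpret contracting_flow f \<alpha> s T \<Omega> X F z
        by (rule C) (use that in simp)
      show ?thesis
        using nested[of s t] that by simp
    qed
    define u where "u = arrival_time {..<T} \<Omega> T z"
    have u_eq: "arrival_time {s..<T} \<Omega> T z x = u x" if s: "s < T" "x \<in> \<Omega> s" for s x
    proof (cases "x = z")
      case True
      then show ?thesis by (simp add: u_def arrival_time_def)
    next
      case False
      interpret Cs: contracting_flow f \<alpha> s T \<Omega> X F z
        by (rule C[OF s(1)])
      obtain t where t: "t \<in> {s..<T}" "x \<in> frontier (\<Omega> t)"
        using Cs.on_frontier[OF s(2) False] by blast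
      have "(THE t. t \<in> {..<T} \<and> x \<in> frontier (\<Omega> t)) = t"
      proof (rule the_equality)
        fix r assume r: "r \<in> {..<T} \<and> x \<in> frontier (\<Omega> r)"
        interpret Cr: contracting_flow f \<alpha> "min r s" T \<Omega> X F z
          by (rule C) (use s in auto)
        show "r = t"
          using Cr.arrival_frontier[of x r] Cr.arrival_frontier[of x t] r t by auto
      qed (use t in auto)
      then show ?thesis
        using Cs.arrival_frontier[OF t(2,1)] False by (simp add: u_def arrival_time_def)
    qed
    have conv: "convex (\<Omega> t)" if "t < T" for t
    proof -
      interpret contracting_flow f \<alpha> t T \<Omega> X F z
        by (rule C[OF that])
      show ?thesis
        using body_facts(3) that by simp
    qed
    show "concave_on (\<Union>t\<in>{..<T}. \<Omega> t) (arrival_time {..<T} \<Omega> T z)"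
      unfolding concave_on_iff u_def[symmetric]
    proof (intro conjI ballI allI impI)
      show "convex (\<Union>t\<in>{..<T}. \<Omega> t)"
      proof (rule convexI)
        fix x y and k l :: real
        assume "x \<in> (\<Union>t\<in>{..<T}. \<Omega> t)" "y \<in> (\<Union>t\<in>{..<T}. \<Omega> t)" and kl: "0 \<le> k" "0 \<le> l" "k + l = 1"
        then obtain s t where "s < T" "x \<in> \<Omega> s" "t < T" "y \<in> \<Omega> t" by auto
        then have "min s t < T" "x \<in> \<Omega> (min s t)" "y \<in> \<Omega> (min s t)"
          using nested[of "min s t" s] nested[of "min s t" t] by auto
        then have "k *\<^sub>R x + l *\<^sub>R y \<in> \<Omega> (min s t)"
          using kl by (intro convexD[OF conv])
        then show "k *\<^sub>R x + l *\<^sub>R y \<in> (\<Union>t\<in>{..<T}. \<Omega> t)"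
          using \<open>min s t < T\<close> by blast
      qed
      fix x y and k l :: real
      assume "x \<in> (\<Union>t\<in>{..<T}. \<Omega> t)" "y \<in> (\<Union>t\<in>{..<T}. \<Omega> t)" and kl: "0 \<le> k" "0 \<le> l" "k + l = 1"
      then obtain r s where rs: "r < T" "x \<in> \<Omega> r" "s < T" "y \<in> \<Omega> s" by auto
      have "k * (u x + n) powr (1 / (1 + \<alpha>)) + l * (u y + n) powr (1 / (1 + \<alpha>)) \<le>
          (u (k *\<^sub>R x + l *\<^sub>R y) + n) powr (1 / (1 + \<alpha>))" if n: "max (- r) (- s) \<le> n" for n
      proof -
        let ?b = "1 / (1 + \<alpha>)" and ?xy = "k *\<^sub>R x + l *\<^sub>R y"
        have nT: "- n < T" using n rs by auto
        interpret Cn: contracting_flow f \<alpha> "- n" T \<Omega> X F z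
          by (rule C[OF nT])
        have xy: "x \<in> \<Omega> (- n)" "y \<in> \<Omega> (- n)"
          using nested[of "- n" r] nested[of "- n" s] rs n by auto
        have xyn: "?xy \<in> \<Omega> (- n)"
          by (rule convexD[OF conv[OF nT] xy kl])
        have w: "Cn.w y = (1 + \<alpha>) powr ?b * (u y + n) powr ?b" if "y \<in> \<Omega> (- n)" for y
          using Cn.arrival_bounds(1)[OF that] u_eq[OF nT that] assms(2)
          by (simp add: Cn.w_def Cn.level_of_def powr_mult)
        have "k * Cn.w x + l * Cn.w y \<le> Cn.w ?xy"
          using Cn.w_concave xy kl unfolding concave_on_iff by blast
        then have "(1 + \<alpha>) powr ?b * (k * (u x + n) powr ?b + l * (u y + n) powr ?b) \<le>
            (1 + \<alpha>) powr ?b * (u ?xy + n) powr ?b"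
          unfolding w[OF xy(1)] w[OF xy(2)] w[OF xyn] by (simp add: algebra_simps)
        then show ?thesis
          by (rule mult_left_le_imp_le) (use assms(2) in simp)
      qed
      then have ev: "\<forall>\<^sub>F n in at_top. k * (u x + n) powr (1 / (1 + \<alpha>)) + l * (u y + n) powr (1 / (1 + \<alpha>)) \<le>
          (u (k *\<^sub>R x + l *\<^sub>R y) + n) powr (1 / (1 + \<alpha>))"
        using eventually_ge_at_top by (rule eventually_mono[rotated])
      show "k * u x + l * u y \<le> u (k *\<^sub>R x + l *\<^sub>R y)"
        by (rule concave_from_shifted_powers[OF _ kl(3) ev]) (use assms(2) in simp)
    qed
    show "\<forall>t\<in>{..<T}. \<forall>p\<in>sphere 0 1. \<forall>V\<in>tangent_space (frontier (\<Omega> t)) (X p t).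
           Harnack_quantity \<Omega> X F p t V \<ge> 0"
    proof (intro ballI)
      fix t p V
      assume t: "t \<in> {..<T}" and p: "p \<in> sphere 0 1" and V: "V \<in> tangent_space (frontier (\<Omega> t)) (X p t)"
      let ?Q = "Harnack_quantity \<Omega> X F p t V" and ?C = "\<alpha> * F (X p t) t / (1 + \<alpha>)"
      have "0 \<le> ?Q + ?C / n" if "n > 0" for n
      proof -
        interpret Cn: contracting_flow f \<alpha> "t - n" T \<Omega> X F z
          by (rule C) (use t that in auto)
        show ?thesis
          using Cn.Harnack[OF _ _ p V] t that by simp
      qed
      then have ev: "\<forall>\<^sub>F n in at_top. 0 \<le> ?Q + ?C / n"
        using eventually_gt_at_top[of 0] by (rule eventually_mono[rotated])
      have "((\<lambda>n. ?Q + ?C / n) \<longlongrightarrow> ?Q + 0) at_top"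
        by (intro tendsto_add tendsto_const tendsto_divide_0[OF tendsto_const] filterlim_at_top_imp_at_infinity filterlim_ident)
      from tendsto_lowerbound[OF this ev] show "0 \<le> ?Q"
        by simp
    qed
  qed
qed

end
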